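(* Let $\nu(s)=\zeta(s)\zeta''(s)-\zeta'(s)^2$, and for $T>0$ let $N_\nu(T)$ be the number of zeros $\rho$ of $\nu$, counted with multiplicity, with $0<\operatorname{Im}(\rho)<T$ and $-4<\operatorname{Re}(\rho)$. Then, as $T\to\infty$, $$N_\nu(T)=2\left(\frac{T}{2\pi}\log\left(\frac{T}{2\pi}\right)-\frac{T}{2\pi}\right)-\frac{\log(2)}{\pi}T+O\left(\log(T)\right).$$
   Context: $\zeta(s)$ denotes the Riemann zeta function (meromorphically continued to $\mathbb{C}$), and $\zeta'$, $\zeta''$ are its first and second derivatives. The implied constant is absolute. *)

theory Defs
  imports "HOL-Complex_Analysis.Complex_Analysis" "HOL-Library.Landau_Symbols"
begin

(* The meromorphic continuation to the whole plane of the Dirichlet series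
   sum_{n >= 1} n^(-s).  The predicate nicely_meromorphic_on fixes the values at isolated
   singularities (0 at a pole, the limit at a removable singularity); this normalisation makes
   the continuation unique as a total function, with zeta 1 = 0. *)
definition zeta :: "complex \<Rightarrow> complex" where
  "zeta = (THE f. f nicely_meromorphic_on UNIV \<and>
     (\<forall>s. Re s > 1 \<longrightarrow> (\<lambda>n. 1 / of_nat (Suc n) powr s) sums f s))"

definition nu :: "complex \<Rightarrow> complex" where
  "nu s = zeta s * (deriv ^^ 2) zeta s - (deriv zeta s)\<^sup>2"

definition nu_zeros :: "real \<Rightarrow> complex set" where
  "nu_zeros T = {\<rho>. nu \<rho> = 0 \<and> 0 < Im \<rho> \<and> Im \<rho> < T \<and> - 4 < Re \<rho>}"

(* nu is analytic off s = 1, so zorder is the multiplicity at each of these zeros.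
   A sum over an infinite set would be 0, so unbounded growth of N_nu also entails that
   nu_zeros T is finite for all T. *)
definition N_nu :: "real \<Rightarrow> nat" where
  "N_nu T = (\<Sum>\<rho>\<in>nu_zeros T. nat (zorder nu \<rho>))"

end

theory Submission
  imports Defs
begin

text \<open>
  Where zeta does not vanish, nu = zeta^2 (zeta'/zeta)', so for large real part nu(s) is dominated by the
  first term (log 2)^2 2^(-s) of a Dirichlet series; numerically this already holds for Re s \<ge> 5. The
  functional equation zeta(s) = chi(s) zeta(1 - s) gives
  nu(s) = chi(s)^2 ((log chi)''(s) zeta(1 - s)^2 + nu(1 - s)). Since (log chi)''(s) = O(1 / Im s), on
  Re s \<le> -4 the value of nu is chi(s)^2 (log 2)^2 2^(s - 1) up to a factor close to 1. Apply the argument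
  principle to a rectangle with vertical sides Re s = -5 and Re s = 6: the powers of 2 contribute
  -T log 2 on each vertical side, and chi^2 contributes the main term by Stirling's formula. On the
  horizontal side at height T, polynomial growth bounds the number of zeros in a fixed disc by O(log T);
  after dividing these out, the Borel--Caratheodory inequality bounds the variation of the argument
  by O(log T).
\<close>

section \<open>Euler--Maclaurin continuation of the zeta function\<close>

text \<open>Since \<open>zeta\<close> is a definite description, nothing is known about it until a
  function with the two defining properties has been constructed, so continuation and functional
  equation come first. Euler--Maclaurin only reaches Re s > -1; further left the functional equation
  itself serves as the definition, and the point to prove is agreement on the strip -1 < Re s < 0.
  The threshold 5 fixes the sides of the rectangle: reflection turns Re s >= 5 into Re s <= -4, so 6
  and -5 lie one unit inside regions without zeros at large height, and the strip between -5 and -4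
  adds nothing to the count. The right half plane already uses up a relative error of 9/10, so the
  term with (log chi)'' has to stay below 1/20; this is where the height 600000 comes from, and the
  zeros below a fixed height of that size only add a constant. Two obstacles remain. The top side
  must avoid zeros, so the count is proved at zero-free heights and then carried over to all T by
  monotonicity. And zeros of nu might accumulate at the pole, which is excluded by passing to an
  entire multiple of nu.\<close>

text \<open>
  The error of the trapezoidal rule for the integral of x^(-s) over [n + 1, n + 2], multiplied by s - 1
  to remove the pole.
\<close>

definition em_term :: "nat \<Rightarrow> complex \<Rightarrow> complex" where
  "em_term n s = (s - 1) * (of_nat (Suc n) powr (-s) + of_nat (Suc (Suc n)) powr (-s)) / 2
     - of_nat (Suc n) powr (1 - s) + of_nat (Suc (Suc n)) powr (1 - s)"

text \<open>This is (s - 1) zeta(s) by the first-order Euler--Maclaurin formula: the integral of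
  x^(-s) over [1, oo) contributes 1 after multiplication by s - 1, and half of the first term of the
  series contributes (s - 1) / 2.\<close>

definition em_zeta :: "complex \<Rightarrow> complex" where
  "em_zeta s = 1 + (s - 1) / 2 + (\<Sum>n. em_term n s)"

text \<open>As a function of the length u of the interval, the trapezoidal error vanishes at u = 0
  together with its first derivative, so a bound on the second derivative is integrated twice by the
  mean value inequality. The exponent obtained is summable over n exactly for Re s > -1.\<close>

lemma norm_em_term_le:
  assumes "Re s \<ge> -2"
  shows "norm (em_term n s) \<le> norm ((s - 1) * s * (s + 1)) / 2 * real (Suc n) powr (-Re s - 2)"
proof -
  define N where "N = complex_of_nat (Suc n)"
  define S where "S = closed_segment (0::complex) 1"
  define B where "B = norm ((s - 1) * s * (s + 1)) / 2 * real (Suc n) powr (-Re s - 2)"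
  define G where "G = (\<lambda>u. (s - 1) * u / 2 * (N powr (-s) + (N + u) powr (-s))
                       - N powr (1 - s) + (N + u) powr (1 - s))"
  define G' where "G' = (\<lambda>u. (s - 1) / 2 * (N powr (-s) - (N + u) powr (-s) - s * u * (N + u) powr (-s - 1)))"
  define G'' where "G'' = (\<lambda>u. (s - 1) * s * (s + 1) / 2 * u * (N + u) powr (-s - 2))"
  have S: "Re u \<ge> 0 \<and> Re u \<le> 1 \<and> Im u = 0" if "u \<in> S" for u
    using that by (auto simp: S_def closed_segment_def)
  have Nu: "N + u \<notin> \<real>\<^sub>\<le>\<^sub>0" "N + u \<noteq> 0" if "u \<in> S" for u
    using S[OF that] by (auto simp: N_def complex_nonpos_Reals_iff complex_eq_iff)
  have pw: "((\<lambda>u. (N + u) powr a) has_field_derivative a * (N + u) powr (a - 1)) (at u within S)"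
    if "u \<in> S" for u a
    using Nu[OF that] by (auto intro!: derivative_eq_intros)
  have D1: "(G has_field_derivative G' u) (at u within S)" if "u \<in> S" for u
    unfolding G_def G'_def using Nu[OF that]
    by (auto intro!: derivative_eq_intros pw[OF that] simp: field_simps)
  have D2: "(G' has_field_derivative G'' u) (at u within S)" if "u \<in> S" for u
    unfolding G''_def G'_def using Nu[OF that]
    by (auto intro!: derivative_eq_intros pw[OF that] simp: field_simps)
  have B2: "norm (G'' u) \<le> B" if "u \<in> S" for u
  proof -
    have eq: "N + u = of_real (real (Suc n) + Re u)"
      using S[OF that] by (auto simp: N_def complex_eq_iff)
    have "norm ((N + u) powr (-s - 2)) = (real (Suc n) + Re u) powr (-Re s - 2)"
      unfolding eq using S[OF that] by (subst norm_powr_real_powr) auto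
    also have "\<dots> \<le> real (Suc n) powr (-Re s - 2)"
      using S[OF that] assms by (intro powr_mono2') auto
    finally have 1: "norm ((N + u) powr (-s - 2)) \<le> real (Suc n) powr (-Re s - 2)" .
    have 2: "norm u \<le> 1" using S[OF that] by (simp add: cmod_def)
    have "norm (G'' u) = norm ((s - 1) * s * (s + 1)) / 2 * (norm u * norm ((N + u) powr (-s - 2)))"
      by (simp add: G''_def norm_mult norm_divide)
    also have "\<dots> \<le> norm ((s - 1) * s * (s + 1)) / 2 * (1 * real (Suc n) powr (-Re s - 2))"
      by (intro mult_left_mono mult_mono 1 2) auto
    finally show ?thesis by (simp add: B_def)
  qed
  have B0: "B \<ge> 0" by (simp add: B_def)
  have cS: "convex S" "0 \<in> S" "1 \<in> S" by (auto simp: S_def)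
  have B1: "norm (G' u) \<le> B" if "u \<in> S" for u
  proof -
    have "norm (G' u - G' 0) \<le> B * norm (u - 0)"
      by (rule field_differentiable_bound[OF cS(1) D2 B2]) (use that cS in auto)
    also have "\<dots> \<le> B * 1" using S[OF that] B0 by (intro mult_left_mono) (auto simp: cmod_def)
    finally show ?thesis by (simp add: G'_def)
  qed
  have "norm (G 1 - G 0) \<le> B * norm (1 - 0 :: complex)"
    by (rule field_differentiable_bound[OF cS(1) D1 B1]) (use cS in auto)
  moreover have "G 1 - G 0 = em_term n s"
    by (simp add: G_def em_term_def N_def add_ac)
  ultimately show ?thesis by (simp add: B_def)
qed

lemma holomorphic_em_term: "em_term n holomorphic_on A"
  unfolding em_term_def by (auto intro!: holomorphic_intros)

lemma open_Re_gt: "open {s. Re s > c}" and open_Re_lt: "open {s. Re s < c}"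
  by (auto intro: open_halfspace_Re_gt open_halfspace_Re_lt)

lemma holomorphic_em_zeta: "em_zeta holomorphic_on {s. Re s > -1}"
proof -
  have "(\<lambda>s. \<Sum>n. em_term n s) holomorphic_on {s. Re s > -1}"
  proof (rule holomorphic_uniform_sequence[where f = "\<lambda>n s. \<Sum>k<n. em_term k s"])
    show "open {s. Re s > -1}" by (rule open_Re_gt)
    show "(\<lambda>s. \<Sum>k<n. em_term k s) holomorphic_on {s. -1 < Re s}" for n
      by (intro holomorphic_on_sum holomorphic_em_term)
    fix x assume "x \<in> {s. Re s > -1}"
    \<comment> \<open>With half the distance to the line Re s = -1 as radius, the closed disc stays
      in Re s >= -1 + d, and the majorant has the summable exponent -1 - d.\<close>
    define d where "d = (Re x + 1) / 2"
    have d: "d > 0" using \<open>x \<in> _\<close> by (simp add: d_def)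
    have Re: "Re s \<ge> -1 + d" if "s \<in> cball x d" for s
    proof -
      have "\<bar>Re (x - s)\<bar> \<le> norm (x - s)" by (rule abs_Re_le_cmod)
      then show ?thesis using that by (auto simp: d_def dist_norm field_simps)
    qed
    have "compact ((\<lambda>s. norm ((s - 1) * s * (s + 1)) / 2) ` cball x d)"
      by (intro compact_continuous_image continuous_intros) auto
    then have "bdd_above ((\<lambda>s. norm ((s - 1) * s * (s + 1)) / 2) ` cball x d)"
      by (rule bounded_imp_bdd_above[OF compact_imp_bounded])
    then obtain K where K: "norm ((s - 1) * s * (s + 1)) / 2 \<le> K" if "s \<in> cball x d" for s
      unfolding bdd_above_def by blast
    have "uniform_limit (cball x d) (\<lambda>n s. \<Sum>k<n. em_term k s) (\<lambda>s. \<Sum>n. em_term n s) sequentially"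
    proof (rule Weierstrass_m_test)
      fix n s assume s: "s \<in> cball x d"
      have "norm (em_term n s) \<le> norm ((s - 1) * s * (s + 1)) / 2 * real (Suc n) powr (-Re s - 2)"
        using Re[OF s] d by (intro norm_em_term_le) auto
      also have "\<dots> \<le> K * real (Suc n) powr (-1 - d)"
        using Re[OF s] d order_trans[OF _ K[OF s], of 0] by (intro mult_mono K[OF s] powr_mono) auto
      finally show "norm (em_term n s) \<le> K * real (Suc n) powr (-1 - d)" .
    next
      have "summable (\<lambda>n. real n powr (-1 - d))"
        using d by (subst summable_real_powr_iff) auto
      then show "summable (\<lambda>n. K * real (Suc n) powr (-1 - d))"
        by (intro summable_mult) (subst summable_Suc_iff)
    qed
    then show "\<exists>d>0. cball x d \<subseteq> {s. -1 < Re s} \<and>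
        uniform_limit (cball x d) (\<lambda>n s. \<Sum>k<n. em_term k s) (\<lambda>s. \<Sum>n. em_term n s) sequentially"
      using d Re by (intro exI[of _ d]) (auto dest!: Re)
  qed
  then show ?thesis
    unfolding em_zeta_def by (intro holomorphic_intros) auto
qed

lemma summable_dirichlet:
  assumes "Re s > 1"
  shows "summable (\<lambda>n. of_nat (Suc n) powr (-s) :: complex)"
proof (rule summable_norm_cancel)
  have "summable (\<lambda>n. real n powr (-Re s))"
    using assms by (subst summable_real_powr_iff) auto
  then have "summable (\<lambda>n. real (Suc n) powr (-Re s))"
    by (subst summable_Suc_iff)
  then show "summable (\<lambda>n. norm (of_nat (Suc n) powr (-s) :: complex))"
    by (subst norm_powr_real_powr) auto
qed

lemma em_zeta_eq_dirichlet:
  assumes "Re s > 1"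
  shows "em_zeta s = (s - 1) * (\<Sum>n. of_nat (Suc n) powr (-s))"
proof -
  define a where "a = (\<lambda>n. of_nat (Suc n) powr (-s) :: complex)"
  define b where "b = (\<lambda>n. of_nat (Suc n) powr (1 - s) :: complex)"
  have a: "a sums suminf a" unfolding a_def using summable_dirichlet[OF assms] by (rule summable_sums)
  then have a': "(\<lambda>n. a (Suc n)) sums (suminf a - a 0)" by (subst sums_Suc_iff) auto
  have "(\<lambda>n. norm (b n)) \<longlonglongrightarrow> 0"
  proof -
    have "norm (b n) = real (Suc n) powr (1 - Re s)" for n
      unfolding b_def by (subst norm_powr_real_powr) auto
    moreover have "(\<lambda>n. real (Suc n) powr (1 - Re s)) \<longlonglongrightarrow> 0"
      using assms filterlim_compose[OF filterlim_real_sequentially filterlim_Suc]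
      by (intro tendsto_neg_powr) auto
    ultimately show ?thesis by simp
  qed
  then have "b \<longlonglongrightarrow> 0" by (rule tendsto_norm_zero_cancel)
  then have b: "(\<lambda>n. b (Suc n) - b n) sums (0 - b 0)" by (rule telescope_sums)
  have "(\<lambda>n. (s - 1) * (a n + a (Suc n)) / 2 + (b (Suc n) - b n)) sums
          ((s - 1) * (suminf a + (suminf a - a 0)) / 2 + (0 - b 0))"
    by (intro sums_add sums_divide sums_mult a a' b)
  then have "(\<lambda>n. em_term n s) sums ((s - 1) * (suminf a + (suminf a - a 0)) / 2 + (0 - b 0))"
    by (simp add: em_term_def a_def b_def algebra_simps)
  then show ?thesis
    by (simp add: em_zeta_def sums_iff a_def b_def field_simps)
qed

section \<open>The functional equation\<close>

lemma nn_integral_powr_exp: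
  assumes a: "a > 0" and c: "c > 0"
  shows "(\<integral>\<^sup>+x\<in>{0<..}. ennreal (x powr (a - 1) * exp (-c * x)) \<partial>lborel) = ennreal (Gamma a * c powr (-a))"
    (is "?I = _")
proof -
  have "ennreal (Gamma a) = (\<integral>\<^sup>+t. ennreal (indicator {0..} t * t powr (a - 1) / exp t) \<partial>lborel)"
    by (rule Gamma_conv_nn_integral_real[OF a])
  also have "\<dots> = ennreal \<bar>c\<bar> * (\<integral>\<^sup>+x. ennreal (indicator {0..} (0 + c * x) * (0 + c * x) powr (a - 1) / exp (0 + c * x)) \<partial>lborel)"
    using c by (intro nn_integral_real_affine) auto
  also have "(\<integral>\<^sup>+x. ennreal (indicator {0..} (0 + c * x) * (0 + c * x) powr (a - 1) / exp (0 + c * x)) \<partial>lborel) =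
      (\<integral>\<^sup>+x. ennreal (c powr (a - 1)) * (ennreal (x powr (a - 1) * exp (-c * x)) * indicator {0<..} x) \<partial>lborel)"
  proof (intro nn_integral_cong)
    fix x :: real
    show "ennreal (indicator {0..} (0 + c * x) * (0 + c * x) powr (a - 1) / exp (0 + c * x)) =
          ennreal (c powr (a - 1)) * (ennreal (x powr (a - 1) * exp (-c * x)) * indicator {0<..} x)"
      using c by (cases "x > 0"; cases "x = 0")
        (auto simp: powr_mult ennreal_mult' [symmetric] exp_minus field_simps indicator_def zero_le_mult_iff)
  qed
  also have "\<dots> = ennreal (c powr (a - 1)) * ?I"
    by (rule nn_integral_cmult) measurable
  finally have *: "ennreal (Gamma a) = ennreal \<bar>c\<bar> * (ennreal (c powr (a - 1)) * ?I)" .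
  have "ennreal (Gamma a * c powr (-a)) = ennreal (c powr (-a)) * ennreal (Gamma a)"
    using a by (simp add: ennreal_mult' mult.commute)
  also have "\<dots> = ennreal (c powr (-a) * \<bar>c\<bar> * c powr (a - 1)) * ?I"
    unfolding * using c by (simp add: ennreal_mult' mult.assoc)
  also have "c powr (-a) * \<bar>c\<bar> * c powr (a - 1) = 1"
    using c by (simp add: powr_diff powr_minus)
  finally show ?thesis by simp
qed

text \<open>Tonelli for (1 - exp(-u x)) / x, the integral of exp(-v x) over v in [0, u]. Taking 1 -
  exp instead of exp is what makes the integral converge at 0 for the exponent -p - 1.\<close>

lemma nn_integral_powr_one_minus_exp:
  assumes p: "0 < p" "p < 1" and u: "u \<ge> 0"
  shows "(\<integral>\<^sup>+x\<in>{0<..}. ennreal (x powr (-p - 1) * (1 - exp (-u * x))) \<partial>lborel)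
           = ennreal (Gamma (1 - p) / p * u powr p)"
proof -
  have "(\<integral>\<^sup>+x\<in>{0<..}. ennreal (x powr (-p - 1) * (1 - exp (-u * x))) \<partial>lborel)
      = (\<integral>\<^sup>+x. (\<integral>\<^sup>+v. ennreal (x powr (-p) * exp (-v * x)) * indicator {0<..} x * indicator {0..u} v \<partial>lborel) \<partial>lborel)"
  proof (rule nn_integral_cong)
    fix x :: real
    show "ennreal (x powr (-p - 1) * (1 - exp (-u * x))) * indicator {0<..} x =
          (\<integral>\<^sup>+v. ennreal (x powr (-p) * exp (-v * x)) * indicator {0<..} x * indicator {0..u} v \<partial>lborel)"
    proof (cases "x > 0")
      case True
      have "(\<integral>\<^sup>+v\<in>{0..u}. ennreal (x powr (-p) * exp (-v * x)) \<partial>lborel) =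
          ennreal (- (x powr (-p - 1)) * exp (-u * x) - (- (x powr (-p - 1)) * exp (-0 * x)))"
        using u True by (intro nn_integral_FTC_Icc)
          (auto intro!: derivative_eq_intros simp: powr_diff field_simps)
      then show ?thesis using True by (simp add: algebra_simps)
    qed auto
  qed
  also have "\<dots> = (\<integral>\<^sup>+v. (\<integral>\<^sup>+x. ennreal (x powr (-p) * exp (-v * x)) * indicator {0<..} x * indicator {0..u} v \<partial>lborel) \<partial>lborel)"
    by (rule lborel_pair.Fubini') measurable
  also have "\<dots> = (\<integral>\<^sup>+v. ennreal (Gamma (1 - p)) * (ennreal (v powr (p - 1)) * indicator {0..u} v) \<partial>lborel)"
  proof (rule nn_integral_cong_AE)
    \<comment> \<open>At v = 0 the inner integral diverges while \<open>v powr (p - 1)\<close> is 0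
      by convention, so the two sides agree only almost everywhere.\<close>
    have "AE v in lborel. v \<noteq> (0::real)" by (rule AE_lborel_singleton)
    then show "AE v in lborel. (\<integral>\<^sup>+x. ennreal (x powr (-p) * exp (-v * x)) * indicator {0<..} x * indicator {0..u} v \<partial>lborel) =
       ennreal (Gamma (1 - p)) * (ennreal (v powr (p - 1)) * indicator {0..u} v)"
    proof eventually_elim
      case (elim v)
      show ?case
      proof (cases "v \<in> {0..u}")
        case True
        then show ?thesis
          using nn_integral_powr_exp[of "1 - p" v] p elim Gamma_real_pos[of "1 - p"] by (simp add: ennreal_mult')
      qed simp
    qed
  qed
  also have "\<dots> = ennreal (Gamma (1 - p)) * (\<integral>\<^sup>+v\<in>{0..u}. ennreal (v powr (p - 1)) \<partial>lborel)"
    by (rule nn_integral_cmult) measurable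
  also have "(\<integral>\<^sup>+v\<in>{0..u}. ennreal (v powr (p - 1)) \<partial>lborel) = ennreal (u powr (p - 1 + 1) / (p - 1 + 1))"
    using p u by (intro nn_integral_has_integral_lebesgue' has_integral_powr_from_0) auto
  also have "ennreal (Gamma (1 - p)) * ennreal (u powr (p - 1 + 1) / (p - 1 + 1)) = ennreal (Gamma (1 - p) / p * u powr p)"
    using p Gamma_real_pos[of "1 - p"] by (simp flip: ennreal_mult')
  finally show ?thesis .
qed

text \<open>The error of the trapezoidal rule on [n, n + 1] for the function u |-> exp(-u
  x).\<close>

definition trap :: "nat \<Rightarrow> real \<Rightarrow> real" where
  "trap n x = (exp (- (real n * x)) + exp (- (real (Suc n) * x))) / 2
              - (exp (- (real n * x)) - exp (- (real (Suc n) * x))) / x"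

text \<open>Convexity of the exponential. After splitting off exp(-n x) / (2 x), the remaining
  factor \<open>k\<close> vanishes at 0 and has the derivative 1 - (1 + y) exp(-y) >= 0.\<close>

lemma trap_nonneg:
  assumes "x > 0"
  shows "trap n x \<ge> 0"
proof -
  define k where "k = (\<lambda>x::real. x * (1 + exp (-x)) - 2 * (1 - exp (-x)))"
  have "k 0 \<le> k x"
  proof (rule DERIV_nonneg_imp_nondecreasing[of 0 x k])
    fix y :: real assume y: "0 \<le> y" "y \<le> x"
    have "1 + y \<le> exp y" by (rule exp_ge_add_one_self)
    then have "exp (-y) * (1 + y) \<le> exp (-y) * exp y" by (intro mult_left_mono) auto
    then have "1 - exp (-y) * (1 + y) \<ge> 0" by (simp flip: exp_add)
    moreover have "(k has_real_derivative 1 - exp (-y) * (1 + y)) (at y)"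
      unfolding k_def by (auto intro!: derivative_eq_intros simp: algebra_simps)
    ultimately show "\<exists>d. (k has_real_derivative d) (at y) \<and> d \<ge> 0" by blast
  qed (use assms in auto)
  then have "k x \<ge> 0" by (simp add: k_def)
  moreover have "trap n x = exp (- (real n * x)) * k x / (2 * x)"
  proof -
    have "exp (- (real (Suc n) * x)) = exp (- (real n * x)) * exp (-x)"
      by (simp add: algebra_simps flip: exp_add)
    then show ?thesis using assms by (simp add: trap_def k_def field_simps)
  qed
  ultimately show ?thesis using assms by simp
qed

text \<open>The trapezoidal rule is exact on constants, so exp(-u x) may be replaced by 1 - exp(-u
  x) with the sign reversed, and this function has a finite transform, a multiple of u^p. To avoid
  differences of extended reals, the two endpoint terms are first added to the left side and
  subtracted only after both sides are known to be finite.\<close>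

lemma nn_integral_powr_trap:
  assumes p: "0 < p" "p < 1"
  shows "(\<integral>\<^sup>+x\<in>{0<..}. ennreal (x powr (-p - 1) * trap n x) \<partial>lborel)
           = ennreal (Gamma (1 - p) / p * ((real (Suc n) powr (p + 1) - real n powr (p + 1)) / (p + 1)
                - (real n powr p + real (Suc n) powr p) / 2))"
    and "(real (Suc n) powr (p + 1) - real n powr (p + 1)) / (p + 1) - (real n powr p + real (Suc n) powr p) / 2 \<ge> 0"
proof -
  define G where "G = Gamma (1 - p) / p"
  have G: "G > 0" using p by (simp add: G_def Gamma_real_pos)
  define \<phi> where "\<phi> = (\<lambda>u x::real. x powr (-p - 1) * (1 - exp (-u * x)))"
  have \<phi>0: "\<phi> u x \<ge> 0" if "u \<ge> 0" "x > 0" for u x using that by (simp add: \<phi>_def)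
  have \<phi>I: "(\<integral>\<^sup>+x\<in>{0<..}. ennreal (\<phi> u x) \<partial>lborel) = ennreal (G * u powr p)" if "u \<ge> 0" for u
    unfolding \<phi>_def G_def by (rule nn_integral_powr_one_minus_exp[OF p that])
  have [measurable]: "case_prod \<phi> \<in> borel_measurable (lborel \<Otimes>\<^sub>M lborel)" unfolding \<phi>_def by measurable
  have "(\<integral>\<^sup>+x\<in>{0<..}. ennreal (x powr (-p - 1) * trap n x) \<partial>lborel) +
        (\<integral>\<^sup>+x. ennreal (1/2) * (ennreal (\<phi> n x) * indicator {0<..} x) + ennreal (1/2) * (ennreal (\<phi> (Suc n) x) * indicator {0<..} x) \<partial>lborel)
     = (\<integral>\<^sup>+x. ennreal (x powr (-p - 1) * trap n x) * indicator {0<..} x +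
        (ennreal (1/2) * (ennreal (\<phi> n x) * indicator {0<..} x) + ennreal (1/2) * (ennreal (\<phi> (Suc n) x) * indicator {0<..} x)) \<partial>lborel)"
    unfolding trap_def \<phi>_def by (rule nn_integral_add[symmetric]) measurable
  also have "\<dots> = (\<integral>\<^sup>+x. (\<integral>\<^sup>+u. ennreal (\<phi> u x) * indicator {0<..} x * indicator {real n..real (Suc n)} u \<partial>lborel) \<partial>lborel)"
  proof (rule nn_integral_cong)
    fix x :: real
    show "ennreal (x powr (-p - 1) * trap n x) * indicator {0<..} x +
        (ennreal (1/2) * (ennreal (\<phi> n x) * indicator {0<..} x) + ennreal (1/2) * (ennreal (\<phi> (Suc n) x) * indicator {0<..} x))
       = (\<integral>\<^sup>+u. ennreal (\<phi> u x) * indicator {0<..} x * indicator {real n..real (Suc n)} u \<partial>lborel)"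
    proof (cases "x > 0")
      case True
      have "(\<integral>\<^sup>+u\<in>{real n..real (Suc n)}. ennreal (\<phi> u x) \<partial>lborel) =
          ennreal (x powr (-p - 1) * (real (Suc n) + exp (-(real (Suc n) * x)) / x) - x powr (-p - 1) * (real n + exp (-(real n * x)) / x))"
        using True by (intro nn_integral_FTC_Icc)
          (auto intro!: derivative_eq_intros \<phi>0 simp: \<phi>_def field_simps)
      also have "x powr (-p - 1) * (real (Suc n) + exp (-(real (Suc n) * x)) / x) - x powr (-p - 1) * (real n + exp (-(real n * x)) / x)
          = x powr (-p - 1) * trap n x + (1/2 * \<phi> n x + 1/2 * \<phi> (Suc n) x)"
        by (simp add: trap_def \<phi>_def algebra_simps diff_divide_distrib add_divide_distrib)
      also have "ennreal \<dots> = ennreal (x powr (-p - 1) * trap n x) + (ennreal (1/2) * ennreal (\<phi> n x) + ennreal (1/2) * ennreal (\<phi> (Suc n) x))"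
        using trap_nonneg[OF True, of n] \<phi>0[OF _ True] by (simp only: ennreal_plus ennreal_mult' mult_nonneg_nonneg add_nonneg_nonneg powr_ge_zero of_nat_0_le_iff zero_le_divide_1_iff zero_le_numeral ennreal_plus[symmetric])
      finally show ?thesis using True by simp
    qed auto
  qed
  also have "\<dots> = (\<integral>\<^sup>+u. (\<integral>\<^sup>+x. ennreal (\<phi> u x) * indicator {0<..} x * indicator {real n..real (Suc n)} u \<partial>lborel) \<partial>lborel)"
    by (rule lborel_pair.Fubini') measurable
  also have "\<dots> = (\<integral>\<^sup>+u\<in>{real n..real (Suc n)}. ennreal (G * u powr p) \<partial>lborel)"
  proof (rule nn_integral_cong)
    fix u :: real
    show "(\<integral>\<^sup>+x. ennreal (\<phi> u x) * indicator {0<..} x * indicator {real n..real (Suc n)} u \<partial>lborel) =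
          ennreal (G * u powr p) * indicator {real n..real (Suc n)} u"
      using \<phi>I[of u] by (cases "u \<in> {real n..real (Suc n)}") auto
  qed
  also have "\<dots> = ennreal (G * (real (Suc n) powr (p + 1) - real n powr (p + 1)) / (p + 1))"
  proof (rule nn_integral_has_integral_lebesgue')
    have "((\<lambda>x. x powr p) has_integral (real (Suc n) powr (p + 1) / (p + 1) - real n powr (p + 1) / (p + 1))) {real n..real (Suc n)}"
    proof (rule fundamental_theorem_of_calculus_interior)
      show "continuous_on {real n..real (Suc n)} (\<lambda>x. x powr (p + 1) / (p + 1))"
        using p by (intro continuous_on_divide continuous_on_powr' continuous_intros) auto
      fix x assume "x \<in> {real n<..<real (Suc n)}"
      then have "x > 0" by auto
      then have "((\<lambda>x. x powr (p + 1) / (p + 1)) has_real_derivative x powr p) (at x)"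
        using p by (auto intro!: derivative_eq_intros)
      then show "((\<lambda>x. x powr (p + 1) / (p + 1)) has_vector_derivative x powr p) (at x)"
        by (simp add: has_real_derivative_iff_has_vector_derivative)
    qed simp
    then show "((\<lambda>x. G * x powr p) has_integral (G * (real (Suc n) powr (p + 1) - real n powr (p + 1)) / (p + 1))) {real n..real (Suc n)}"
      using has_integral_mult_right by (simp only: times_divide_eq_right[symmetric] diff_divide_distrib) blast
  qed (use G in auto)
  also have "(\<integral>\<^sup>+x. ennreal (1/2) * (ennreal (\<phi> n x) * indicator {0<..} x) + ennreal (1/2) * (ennreal (\<phi> (Suc n) x) * indicator {0<..} x) \<partial>lborel)
     = (\<integral>\<^sup>+x. ennreal (1/2) * (ennreal (\<phi> n x) * indicator {0<..} x) \<partial>lborel) + (\<integral>\<^sup>+x. ennreal (1/2) * (ennreal (\<phi> (Suc n) x) * indicator {0<..} x) \<partial>lborel)"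
    unfolding \<phi>_def by (rule nn_integral_add) measurable
  also have "\<dots> = ennreal (1/2) * ennreal (G * real n powr p) + ennreal (1/2) * ennreal (G * real (Suc n) powr p)"
    unfolding \<phi>I[OF of_nat_0_le_iff, symmetric] \<phi>_def by (subst (1 2) nn_integral_cmult) measurable
  also have "\<dots> = ennreal (G * (real n powr p + real (Suc n) powr p) / 2)"
  proof -
    have "ennreal (1/2) * ennreal (G * real n powr p) + ennreal (1/2) * ennreal (G * real (Suc n) powr p) =
       ennreal (1/2 * (G * real n powr p) + 1/2 * (G * real (Suc n) powr p))"
      using G by (simp only: ennreal_mult' ennreal_plus mult_nonneg_nonneg powr_ge_zero zero_le_divide_1_iff zero_le_numeral less_imp_le)
    then show ?thesis by (simp only: distrib_left add_divide_distrib mult_1 times_divide_eq_left)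
  qed
  finally have *: "(\<integral>\<^sup>+x\<in>{0<..}. ennreal (x powr (-p - 1) * trap n x) \<partial>lborel) + ennreal (G * (real n powr p + real (Suc n) powr p) / 2)
     = ennreal (G * (real (Suc n) powr (p + 1) - real n powr (p + 1)) / (p + 1))" .
  have "(\<integral>\<^sup>+x\<in>{0<..}. ennreal (x powr (-p - 1) * trap n x) \<partial>lborel) =
      ennreal (G * (real (Suc n) powr (p + 1) - real n powr (p + 1)) / (p + 1)) - ennreal (G * (real n powr p + real (Suc n) powr p) / 2)"
    unfolding *[symmetric] by simp
  also have "\<dots> = ennreal (G * (real (Suc n) powr (p + 1) - real n powr (p + 1)) / (p + 1) - G * (real n powr p + real (Suc n) powr p) / 2)"
    using G by (simp add: ennreal_minus)
  finally show "(\<integral>\<^sup>+x\<in>{0<..}. ennreal (x powr (-p - 1) * trap n x) \<partial>lborel)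
           = ennreal (Gamma (1 - p) / p * ((real (Suc n) powr (p + 1) - real n powr (p + 1)) / (p + 1)
                - (real n powr p + real (Suc n) powr p) / 2))"
    by (simp add: G_def algebra_simps)
  \<comment> \<open>\<open>ennreal\<close> truncates negative numbers to 0, so the sign has to be
    read off from an inequality between two nonnegative quantities.\<close>
  have "ennreal (G * (real n powr p + real (Suc n) powr p) / 2) \<le> ennreal (G * (real (Suc n) powr (p + 1) - real n powr (p + 1)) / (p + 1))"
    unfolding *[symmetric] by simp
  moreover have "G * (real (Suc n) powr (p + 1) - real n powr (p + 1)) / (p + 1) \<ge> 0"
    using G p by (intro divide_nonneg_nonneg mult_nonneg_nonneg) (auto intro!: powr_mono2)
  ultimately have "G * (real n powr p + real (Suc n) powr p) / 2 \<le> G * (real (Suc n) powr (p + 1) - real n powr (p + 1)) / (p + 1)"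
    by (simp only: ennreal_le_iff)
  then have "G * ((real n powr p + real (Suc n) powr p) / 2) \<le> G * ((real (Suc n) powr (p + 1) - real n powr (p + 1)) / (p + 1))"
    by (simp only: times_divide_eq_right)
  then show "(real (Suc n) powr (p + 1) - real n powr (p + 1)) / (p + 1) - (real n powr p + real (Suc n) powr p) / 2 \<ge> 0"
    using G by (simp only: mult_le_cancel_left_pos diff_ge_0_iff_ge)
qed

section \<open>The two expansions of coth(x/2)/2 - 1/x\<close>

lemma trap_sums:
  assumes "x > 0"
  shows "(\<lambda>n. trap n x) sums ((1 + exp (-x)) / (2 * (1 - exp (-x))) - 1 / x)"
proof -
  define e where "e = exp (-x)"
  have e: "0 < e" "e < 1" using assms by (auto simp: e_def)
  have "trap n x = e ^ n * ((1 + e) / 2 - (1 - e) / x)" for n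
  proof -
    have "exp (- (real n * x)) = e ^ n" "exp (- (real (Suc n) * x)) = e ^ n * e"
      by (simp_all add: e_def algebra_simps flip: exp_of_nat_mult exp_add)
    then show ?thesis by (simp add: trap_def field_simps)
  qed
  moreover have "(\<lambda>n. e ^ n * ((1 + e) / 2 - (1 - e) / x)) sums (1 / (1 - e) * ((1 + e) / 2 - (1 - e) / x))"
    using e by (intro sums_mult2 geometric_sums) auto
  moreover have "1 / (1 - e) * ((1 + e) / 2 - (1 - e) / x) = (1 + e) / (2 * (1 - e)) - 1 / x"
    using e assms by (simp add: field_simps)
  ultimately show ?thesis by (simp add: e_def)
qed

text \<open>Logarithmic derivative of Gamma(z) Gamma(1 - z) = pi / sin(pi z), followed by the shift
  from z to 1 + z. The symmetric arguments 1 + z and 1 - z are those at which the two digamma series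
  combine term by term.\<close>

lemma Digamma_reflection_complex:
  fixes z :: complex
  assumes "z \<notin> \<int>"
  shows "Digamma (1 + z) - Digamma (1 - z) = 1 / z - pi * cos (pi * z) / sin (pi * z)"
proof -
  have nz: "z \<notin> \<int>\<^sub>\<le>\<^sub>0" "1 - z \<notin> \<int>\<^sub>\<le>\<^sub>0"
    using assms by (auto elim!: nonpos_Ints_cases) (metis Ints_1 Ints_diff Ints_of_int add_diff_cancel_left' diff_add_cancel)
  have sin: "sin (pi * z) \<noteq> 0"
    using assms by (auto simp: sin_eq_0 Ints_def mult.commute)
  have "((\<lambda>z. Gamma z * Gamma (1 - z)) has_field_derivative
           Gamma z * Digamma z * Gamma (1 - z) - Gamma z * (Gamma (1 - z) * Digamma (1 - z))) (at z)"
    using nz by (auto intro!: derivative_eq_intros)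
  moreover have "((\<lambda>z. Gamma z * Gamma (1 - z)) has_field_derivative - pi * pi * cos (pi * z) / sin (pi * z) ^ 2) (at z)"
    unfolding Gamma_reflection_complex using sin
    by (auto intro!: derivative_eq_intros simp: power2_eq_square)
  ultimately have "Gamma z * Digamma z * Gamma (1 - z) - Gamma z * (Gamma (1 - z) * Digamma (1 - z))
      = - pi * pi * cos (pi * z) / sin (pi * z) ^ 2"
    by (rule DERIV_unique)
  then have "(Gamma z * Gamma (1 - z)) * (Digamma z - Digamma (1 - z)) = - pi * pi * cos (pi * z) / sin (pi * z) ^ 2"
    by (simp add: algebra_simps)
  then have "of_real pi / sin (pi * z) * (Digamma z - Digamma (1 - z)) = of_real pi / sin (pi * z) * (- pi * cos (pi * z) / sin (pi * z))"
    unfolding Gamma_reflection_complex by (simp add: power2_eq_square)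
  then have "Digamma z - Digamma (1 - z) = - pi * cos (pi * z) / sin (pi * z)"
    using sin by (subst (asm) mult_cancel_left) auto
  moreover have "Digamma (z + 1) = Digamma z + 1 / z"
    using assms by (intro Digamma_plus1) auto
  ultimately show ?thesis by (simp add: algebra_simps)
qed

text \<open>The difference of the digamma series at 1 - z and 1 + z is a partial fraction series; at
  z = i x / (2 pi) its denominators become x^2 + (2 pi k)^2 up to a constant, and the cotangent of
  the reflection formula becomes hyperbolic.\<close>

lemma coth_partial_fractions_sums:
  fixes x :: real
  assumes "x > 0"
  shows "(\<lambda>k. 2 * x / (x^2 + (2 * pi * real (Suc k))^2)) sums ((1 + exp (-x)) / (2 * (1 - exp (-x))) - 1 / x)"
proof -
  define z where "z = \<i> * of_real (x / (2 * pi))"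
  have z: "z \<notin> \<int>" "z \<noteq> 0"
    using assms by (auto simp: z_def complex_is_Int_iff)
  have "Re z = 0" by (simp add: z_def)
  then have nz1: "1 + z \<noteq> 0" "1 - z \<noteq> 0"
    using assms by (auto simp: z_def complex_eq_iff)
  have S: "(\<lambda>k. inverse (of_nat (Suc k)) - inverse (w + of_nat k)) sums (Digamma w + euler_mascheroni)" if "w \<noteq> 0" for w :: complex
    using summable_Digamma[OF that] by (simp add: Digamma_def summable_sums)
  have "(\<lambda>k. (inverse (of_nat (Suc k)) - inverse (1 + z + of_nat k)) - (inverse (of_nat (Suc k)) - inverse (1 - z + of_nat k)))
     sums ((Digamma (1 + z) + euler_mascheroni) - (Digamma (1 - z) + euler_mascheroni))"
    by (intro sums_diff S nz1)
  then have "(\<lambda>k. inverse (1 - z + of_nat k) - inverse (1 + z + of_nat k)) sums (1 / z - pi * cos (pi * z) / sin (pi * z))"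
    by (simp add: Digamma_reflection_complex[OF z(1)])
  then have *: "(\<lambda>k. (inverse (1 - z + of_nat k) - inverse (1 + z + of_nat k)) / (2 * pi * \<i>)) sums ((1 / z - pi * cos (pi * z) / sin (pi * z)) / (2 * pi * \<i>))"
    by (intro sums_divide)
  have 1: "(inverse (1 - z + of_nat k) - inverse (1 + z + of_nat k)) / (2 * pi * \<i>) = of_real (2 * x / (x^2 + (2 * pi * real (Suc k))^2))" for k
  proof -
    have nz: "1 - z + of_nat k \<noteq> 0" "1 + z + of_nat k \<noteq> 0" using assms by (auto simp: z_def complex_eq_iff)
    have "(inverse (1 - z + of_nat k) - inverse (1 + z + of_nat k)) = 2 * z / ((1 - z + of_nat k) * (1 + z + of_nat k))"
      using nz by (simp add: field_simps)
    also have "(1 - z + of_nat k) * (1 + z + of_nat k) = (of_nat (Suc k))^2 - z^2"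
      by (simp add: algebra_simps power2_eq_square)
    also have "\<dots> = of_real ((real (Suc k))^2 + (x / (2 * pi))^2)"
      by (simp add: z_def power_mult_distrib power_divide)
    also have "2 * z = of_real (x / pi) * \<i>" by (simp add: z_def)
    also have "(of_real (x / pi) * \<i> / of_real ((real (Suc k))^2 + (x / (2 * pi))^2)) / (2 * pi * \<i>) =
       complex_of_real ((x / pi) / ((real (Suc k))^2 + (x / (2 * pi))^2) / (2 * pi))"
      by simp
    also have "(x / pi) / ((real (Suc k))^2 + (x / (2 * pi))^2) / (2 * pi) = 2 * x / (x^2 + (2 * pi * real (Suc k))^2)"
    proof -
      have "(real (Suc k))^2 + (x / (2 * pi))^2 = (x^2 + (2 * pi * real (Suc k))^2) / (2 * pi)^2"
        by (simp add: power_mult_distrib power_divide add_divide_distrib)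
      moreover have "(x / pi) / (D / (2 * pi)^2) / (2 * pi) = 2 * x / D" for D
        by (cases "D = 0") (auto simp: field_simps power2_eq_square)
      ultimately show ?thesis by (simp only:)
    qed
    finally show ?thesis .
  qed
  have 2: "(1 / z - pi * cos (pi * z) / sin (pi * z)) / (2 * pi * \<i>) = of_real ((1 + exp (-x)) / (2 * (1 - exp (-x))) - 1 / x)"
  proof -
    define q where "q = exp (x / 2)"
    have q: "q > 1" "exp (-(x/2)) = 1 / q" "exp (-x) = 1 / q^2" using assms
      by (auto simp: q_def exp_minus field_simps simp flip: exp_double)
    have pz: "of_real pi * z = \<i> * of_real (x / 2)" by (simp add: z_def)
    have e1: "exp (\<i> * (\<i> * of_real (x / 2))) = of_real (1 / q)"
      unfolding q(2)[symmetric] exp_of_real[symmetric] by simp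
    have e2: "exp (- (\<i> * (\<i> * of_real (x / 2)))) = of_real q"
      unfolding q_def exp_of_real[symmetric] by simp
    have c: "cos (of_real pi * z) = of_real ((1 / q + q) / 2)"
      unfolding cos_exp_eq pz e1 e2 by simp
    have s: "sin (of_real pi * z) = of_real ((q - 1 / q) / 2) * \<i>"
      unfolding sin_exp_eq pz e1 e2 by (simp add: field_simps)
    have qq: "q * q > 1" using q(1) by (metis less_1_mult)
    have "pi * cos (pi * z) / sin (pi * z) / (2 * pi * \<i>) = of_real (- ((1 / q + q) / (2 * (q - 1 / q))))"
    proof -
      have gen: "complex_of_real pi * of_real A / (of_real B * \<i>) / (2 * pi * \<i>) = of_real (- (A / (2 * B)))" for A B :: real
        by (cases "B = 0") (auto simp: field_simps)
      have "(a / 2) / (2 * (b / 2)) = a / (2 * b)" for a b :: real by simp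
      then show ?thesis unfolding c s gen by (simp only:)
    qed
    moreover have "1 / z / (2 * pi * \<i>) = of_real (- (1 / x))" using assms by (simp add: z_def field_simps)
    moreover have "(1 / q + q) / (2 * (q - 1 / q)) = (1 + exp (-x)) / (2 * (1 - exp (-x)))"
      unfolding q(3) using q(1) qq by (simp add: divide_simps power2_eq_square)
    ultimately have "(1 / z - pi * cos (pi * z) / sin (pi * z)) / (2 * pi * \<i>)
        = of_real (- (1 / x)) - of_real (- ((1 + exp (-x)) / (2 * (1 - exp (-x)))))"
      by (simp only: diff_divide_distrib)
    then show ?thesis by (simp only: of_real_diff [symmetric] minus_diff_minus minus_diff_eq)
  qed
  show ?thesis using * unfolding 1 2 by (simp only: sums_of_real_iff)
qed

section \<open>Mellin transform of the partial fractions\<close>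

lemma nn_integral_powr_gauss:
  assumes p: "0 < p" "p < 1" and t: "t > 0"
  shows "(\<integral>\<^sup>+x\<in>{0<..}. ennreal (2 * x powr (-p) * exp (- (t * x^2))) \<partial>lborel) = ennreal (Gamma ((1 - p) / 2) * t powr (- ((1 - p) / 2)))"
proof -
  \<comment> \<open>The substitution w = x^2 turns the Gaussian integral into a gamma integral with
    parameter \<open>b\<close>.\<close>
  define b where "b = (1 - p) / 2"
  have b: "b > 0" using p by (simp add: b_def)
  define f where "f = (\<lambda>w. w powr (b - 1) * exp (- t * w))"
  have f0: "f w \<ge> 0" for w by (simp add: f_def)
  have "((\<lambda>w. f w * indicator {0<..} w) has_integral Gamma b * t powr (-b)) UNIV"
  proof (rule nn_integral_has_integral)
    show "(\<integral>\<^sup>+w. ennreal (f w * indicator {0<..} w) \<partial>lborel) = ennreal (Gamma b * t powr (-b))"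
      using nn_integral_powr_exp[OF b t] by (simp add: f_def ennreal_mult' ennreal_indicator)
  qed (use Gamma_real_pos[OF b] in \<open>auto simp: f_def\<close>)
  also have "(\<lambda>w. f w * indicator {0<..} w) = (\<lambda>w. if w \<in> {0<..} then f w else 0)"
    by (auto simp: fun_eq_iff indicator_def)
  finally have hi: "(f has_integral Gamma b * t powr (-b)) {0<..}"
    by (simp only: has_integral_restrict_UNIV)
  have im: "(\<lambda>x::real. x^2) ` {0<..} = {0<..}"
  proof (intro equalityI subsetI)
    fix y :: real assume "y \<in> {0<..}"
    then have "y = (sqrt y)^2" "sqrt y \<in> {0<..}" by auto
    then show "y \<in> (\<lambda>x. x^2) ` {0<..}" by (rule image_eqI)
  qed auto
  have "(\<lambda>x. \<bar>2 * x\<bar> * f (x^2)) absolutely_integrable_on {0<..} \<and> integral {0<..} (\<lambda>x. \<bar>2 * x\<bar> * f (x^2)) = Gamma b * t powr (-b)"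
  proof (rule iffD2[OF has_absolute_integral_change_of_variables_1'[where g = "\<lambda>x. x^2" and g' = "\<lambda>x. 2 * x" and S = "{0<..}" and f = f]])
    show "inj_on (\<lambda>x::real. x^2) {0<..}" by (auto intro!: inj_onI simp: power2_eq_iff)
    show "f absolutely_integrable_on (\<lambda>x. x\<^sup>2) ` {0<..} \<and> integral ((\<lambda>x. x\<^sup>2) ` {0<..}) f = Gamma b * t powr (- b)"
      unfolding im using hi f0 by (auto intro!: nonnegative_absolutely_integrable_1 simp: has_integral_iff)
  qed (auto intro!: derivative_eq_intros)
  then have "((\<lambda>x. \<bar>2 * x\<bar> * f (x^2)) has_integral Gamma b * t powr (-b)) {0<..}"
    by (auto simp: has_integral_iff set_lebesgue_integral_eq_integral)
  then have "(\<integral>\<^sup>+x\<in>{0<..}. ennreal (\<bar>2 * x\<bar> * f (x^2)) \<partial>lborel) = ennreal (Gamma b * t powr (-b))"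
    by (intro nn_integral_has_integral_lebesgue') (auto simp: f0)
  moreover have "\<bar>2 * x\<bar> * f (x^2) = 2 * x powr (-p) * exp (- (t * x^2))" if "x > 0" for x
  proof -
    have "(x^2) powr (b - 1) = x powr (2 * (b - 1))"
      using that by (simp add: powr_powr flip: powr_numeral)
    also have "2 * (b - 1) = -p - 1" by (simp add: b_def field_simps)
    finally have "(x^2) powr (b - 1) = x powr (-p - 1)" .
    moreover have "x * x powr (-p - 1) = x powr (-p)" using that by (simp add: powr_diff)
    ultimately have "2 * (x * (x^2) powr (b - 1)) = 2 * x powr (-p)" by simp
    then show ?thesis using that by (simp add: f_def del: mult_cancel_left)
  qed
  then have "(\<integral>\<^sup>+x\<in>{0<..}. ennreal (\<bar>2 * x\<bar> * f (x^2)) \<partial>lborel) = (\<integral>\<^sup>+x\<in>{0<..}. ennreal (2 * x powr (-p) * exp (- (t * x^2))) \<partial>lborel)"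
    by (intro nn_integral_cong) (simp add: indicator_def)
  ultimately show ?thesis unfolding b_def by simp
qed

text \<open>Write 1 / (x^2 + a^2) as the integral of exp(-t (x^2 + a^2)) over t > 0 and exchange the
  order. The x-integral gives Gamma(b), the t-integral gives Gamma(1 - b), and reflection turns
  their product into pi / sin(pi b) with sin(pi b) = cos(pi p / 2).\<close>

lemma nn_integral_powr_cauchy_kernel:
  assumes p: "0 < p" "p < 1" and a: "a > 0"
  shows "(\<integral>\<^sup>+x\<in>{0<..}. ennreal (x powr (-p - 1) * (2 * x / (x^2 + a^2))) \<partial>lborel)
           = ennreal (a powr (-p - 1) * (pi / cos (pi * p / 2)))"
proof -
  define b where "b = (1 - p) / 2"
  have b: "b > 0" "b < 1" using p by (auto simp: b_def)
  have "(\<integral>\<^sup>+x\<in>{0<..}. ennreal (x powr (-p - 1) * (2 * x / (x^2 + a^2))) \<partial>lborel) =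
    (\<integral>\<^sup>+x. (\<integral>\<^sup>+t. ennreal (2 * x powr (-p) * exp (- (t * x^2))) * indicator {0<..} x * (ennreal (exp (- (t * a^2))) * indicator {0<..} t) \<partial>lborel) \<partial>lborel)"
  proof (rule nn_integral_cong)
    fix x :: real
    show "ennreal (x powr (-p - 1) * (2 * x / (x^2 + a^2))) * indicator {0<..} x =
      (\<integral>\<^sup>+t. ennreal (2 * x powr (-p) * exp (- (t * x^2))) * indicator {0<..} x * (ennreal (exp (- (t * a^2))) * indicator {0<..} t) \<partial>lborel)"
    proof (cases "x > 0")
      case True
      \<comment> \<open>The factor \<open>t powr (1 - 1)\<close> brings the integrand into the form
        of \<open>nn_integral_powr_exp\<close> with parameter 1.\<close>
      have "(\<integral>\<^sup>+t. ennreal (2 * x powr (-p) * exp (- (t * x^2))) * (ennreal (exp (- (t * a^2))) * indicator {0<..} t) \<partial>lborel)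
         = (\<integral>\<^sup>+t. ennreal (2 * x powr (-p)) * (ennreal (t powr (1 - 1) * exp (- (x^2 + a^2) * t)) * indicator {0<..} t) \<partial>lborel)"
      proof (rule nn_integral_cong)
        fix t :: real
        have "exp (- (t * x^2)) * exp (- (t * a^2)) = exp (- (x^2 + a^2) * t)"
          by (simp add: algebra_simps flip: exp_add)
        then have "ennreal (2 * x powr (-p) * exp (- (t * x^2))) * ennreal (exp (- (t * a^2))) = ennreal (2 * x powr (-p)) * ennreal (exp (- (x^2 + a^2) * t))"
          by (simp flip: ennreal_mult' add: mult.assoc)
        then show "ennreal (2 * x powr (-p) * exp (- (t * x^2))) * (ennreal (exp (- (t * a^2))) * indicator {0<..} t) =
          ennreal (2 * x powr (-p)) * (ennreal (t powr (1 - 1) * exp (- (x^2 + a^2) * t)) * indicator {0<..} t)"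
          by (cases "t > 0") auto
      qed
      also have "\<dots> = ennreal (2 * x powr (-p)) * (\<integral>\<^sup>+t\<in>{0<..}. ennreal (t powr (1 - 1) * exp (- (x^2 + a^2) * t)) \<partial>lborel)"
        by (rule nn_integral_cmult) measurable
      also have "\<dots> = ennreal (2 * x powr (-p)) * ennreal (Gamma 1 * (x^2 + a^2) powr (-1))"
        using a by (subst nn_integral_powr_exp) (auto intro: add_nonneg_pos)
      also have "\<dots> = ennreal (2 * x powr (-p) * (x^2 + a^2) powr (-1))"
        by (simp flip: ennreal_mult')
      also have "2 * x powr (-p) * (x^2 + a^2) powr (-1) = x powr (-p - 1) * (2 * x / (x^2 + a^2))"
      proof -
        have "x^2 + a^2 > 0" using a by (auto intro: add_nonneg_pos)
        then show ?thesis using True by (simp add: powr_diff powr_minus powr_one divide_inverse)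
      qed
      finally show ?thesis using True by simp
    qed auto
  qed
  also have "\<dots> = (\<integral>\<^sup>+t. (\<integral>\<^sup>+x. ennreal (2 * x powr (-p) * exp (- (t * x^2))) * indicator {0<..} x * (ennreal (exp (- (t * a^2))) * indicator {0<..} t) \<partial>lborel) \<partial>lborel)"
    by (rule lborel_pair.Fubini') measurable
  also have "\<dots> = (\<integral>\<^sup>+t. ennreal (Gamma b) * (ennreal (t powr ((1 - b) - 1) * exp (- (a^2) * t)) * indicator {0<..} t) \<partial>lborel)"
  proof (rule nn_integral_cong)
    fix t :: real
    have "(\<integral>\<^sup>+x. ennreal (2 * x powr (-p) * exp (- (t * x^2))) * indicator {0<..} x * (ennreal (exp (- (t * a^2))) * indicator {0<..} t) \<partial>lborel)
       = (\<integral>\<^sup>+x\<in>{0<..}. ennreal (2 * x powr (-p) * exp (- (t * x^2))) \<partial>lborel) * (ennreal (exp (- (t * a^2))) * indicator {0<..} t)"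
      by (rule nn_integral_multc) measurable
    also have "\<dots> = ennreal (Gamma b) * (ennreal (t powr ((1 - b) - 1) * exp (- (a^2) * t)) * indicator {0<..} t)"
    proof (cases "t > 0")
      case True
      then show ?thesis
        using nn_integral_powr_gauss[OF p True] Gamma_real_pos[OF b(1)]
        by (simp add: b_def[symmetric] ennreal_mult' mult.assoc mult.commute)
    qed auto
    finally show "(\<integral>\<^sup>+x. ennreal (2 * x powr (-p) * exp (- (t * x^2))) * indicator {0<..} x * (ennreal (exp (- (t * a^2))) * indicator {0<..} t) \<partial>lborel)
       = ennreal (Gamma b) * (ennreal (t powr ((1 - b) - 1) * exp (- (a^2) * t)) * indicator {0<..} t)" .
  qed
  also have "\<dots> = ennreal (Gamma b) * (\<integral>\<^sup>+t\<in>{0<..}. ennreal (t powr ((1 - b) - 1) * exp (- (a^2) * t)) \<partial>lborel)"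
    by (rule nn_integral_cmult) measurable
  also have "\<dots> = ennreal (Gamma b) * ennreal (Gamma (1 - b) * (a^2) powr (- (1 - b)))"
    using a b by (subst nn_integral_powr_exp) auto
  also have "\<dots> = ennreal (Gamma b * Gamma (1 - b) * (a^2) powr (- (1 - b)))"
    using Gamma_real_pos[OF b(1)] by (simp flip: ennreal_mult' add: mult.assoc)
  also have "(a^2) powr (- (1 - b)) = a powr (-p - 1)"
  proof -
    have "(a^2) powr (- (1 - b)) = a powr (2 * (- (1 - b)))"
      using a by (simp add: powr_powr flip: powr_numeral)
    also have "2 * (- (1 - b)) = -p - 1" by (simp add: b_def field_simps)
    finally show ?thesis .
  qed
  also have "Gamma b * Gamma (1 - b) = pi / sin (pi * b)"
  proof -
    have "complex_of_real (Gamma b * Gamma (1 - b)) = Gamma (of_real b) * Gamma (1 - of_real b)"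
      using Gamma_complex_of_real[of "1 - b"] by (simp add: Gamma_complex_of_real)
    also have "\<dots> = of_real (pi / sin (pi * b))"
      unfolding Gamma_reflection_complex by (simp flip: sin_of_real)
    finally show ?thesis by (simp only: of_real_eq_iff)
  qed
  also have "sin (pi * b) = cos (pi * p / 2)"
  proof -
    have "pi * b = pi / 2 - pi * p / 2" by (simp add: b_def field_simps)
    then show ?thesis by (simp only: cos_sin_eq of_real_eq_id id_apply)
  qed
  finally show ?thesis by (simp add: mult.commute)
qed

text \<open>
  The Mellin transform of coth(x/2)/2 - 1/x is evaluated twice by Tonelli: the trapezoidal expansion in
  powers of exp(-x) gives the continued zeta at -p, the partial fractions of coth give the Dirichlet
  series at 1 + p. For real p in (0, 1) all integrands are nonnegative, so no convergence issue arises.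
\<close>

lemma em_zeta_of_real_neg:
  assumes p: "0 < p" "p < 1"
  shows "em_zeta (of_real (-p)) = of_real ((p + 1) * (p / Gamma (1 - p)) *
           ((2 * pi) powr (-p - 1) * (pi / cos (pi * p / 2)) * (\<Sum>k. real (Suc k) powr (-p - 1))))"
proof -
  define G where "G = Gamma (1 - p) / p"
  have G: "G > 0" using p by (simp add: G_def Gamma_real_pos)
  define C where "C = (2 * pi) powr (-p - 1) * (pi / cos (pi * p / 2))"
  have cos: "cos (pi * p / 2) > 0"
    using p by (intro cos_gt_zero) auto
  then have C: "C \<ge> 0" by (simp add: C_def)
  define \<tau> where "\<tau> = (\<lambda>n. (real (Suc n) powr (p + 1) - real n powr (p + 1)) / (p + 1) - (real n powr p + real (Suc n) powr p) / 2)"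
  have \<tau>: "\<tau> n \<ge> 0" for n unfolding \<tau>_def by (rule nn_integral_powr_trap(2)[OF p])
  have sp: "summable (\<lambda>k. real (Suc k) powr (-p - 1))"
  proof -
    have "summable (\<lambda>n. real n powr (-p - 1))"
      using p by (subst summable_real_powr_iff) auto
    then show ?thesis by (subst summable_Suc_iff)
  qed
  define h where "h = (\<lambda>x::real. (1 + exp (-x)) / (2 * (1 - exp (-x))) - 1 / x)"
  have "(\<Sum>n. ennreal (G * \<tau> n)) = (\<Sum>n. \<integral>\<^sup>+x\<in>{0<..}. ennreal (x powr (-p - 1) * trap n x) \<partial>lborel)"
    by (simp only: nn_integral_powr_trap(1)[OF p] G_def \<tau>_def)
  also have "\<dots> = (\<integral>\<^sup>+x. (\<Sum>n. ennreal (x powr (-p - 1) * trap n x) * indicator {0<..} x) \<partial>lborel)"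
    unfolding trap_def by (rule nn_integral_suminf[symmetric]) measurable
  also have "\<dots> = (\<integral>\<^sup>+x. (\<Sum>k. ennreal (x powr (-p - 1) * (2 * x / (x^2 + (2 * pi * real (Suc k))^2))) * indicator {0<..} x) \<partial>lborel)"
  proof (rule nn_integral_cong)
    fix x :: real
    show "(\<Sum>n. ennreal (x powr (-p - 1) * trap n x) * indicator {0<..} x) =
      (\<Sum>k. ennreal (x powr (-p - 1) * (2 * x / (x^2 + (2 * pi * real (Suc k))^2))) * indicator {0<..} x)"
    proof (cases "x > 0")
      case True
      have "(\<Sum>n. ennreal (x powr (-p - 1) * trap n x)) = ennreal (x powr (-p - 1) * h x)"
        unfolding h_def using True by (intro suminf_ennreal_eq sums_mult trap_sums) (auto intro!: mult_nonneg_nonneg trap_nonneg)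
      moreover have "(\<Sum>k. ennreal (x powr (-p - 1) * (2 * x / (x^2 + (2 * pi * real (Suc k))^2)))) = ennreal (x powr (-p - 1) * h x)"
        unfolding h_def using True by (intro suminf_ennreal_eq sums_mult coth_partial_fractions_sums) auto
      ultimately show ?thesis using True by simp
    qed simp
  qed
  also have "\<dots> = (\<Sum>k. \<integral>\<^sup>+x\<in>{0<..}. ennreal (x powr (-p - 1) * (2 * x / (x^2 + (2 * pi * real (Suc k))^2))) \<partial>lborel)"
    by (rule nn_integral_suminf) measurable
  also have "\<dots> = (\<Sum>k. ennreal ((2 * pi * real (Suc k)) powr (-p - 1) * (pi / cos (pi * p / 2))))"
    by (intro suminf_cong nn_integral_powr_cauchy_kernel p) auto
  also have "\<dots> = (\<Sum>k. ennreal (C * real (Suc k) powr (-p - 1)))"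
    by (intro suminf_cong arg_cong[where f = ennreal]) (simp add: powr_mult C_def)
  also have "\<dots> = ennreal (C * (\<Sum>k. real (Suc k) powr (-p - 1)))"
    using C sp by (subst suminf_ennreal2) (auto intro: summable_mult simp: suminf_mult)
  finally have *: "(\<Sum>n. ennreal (G * \<tau> n)) = ennreal (C * (\<Sum>k. real (Suc k) powr (-p - 1)))" .
  have sG: "summable (\<lambda>n. G * \<tau> n)"
    by (rule summable_suminf_not_top) (use * G \<tau> in auto)
  have "ennreal (\<Sum>n. G * \<tau> n) = ennreal (C * (\<Sum>k. real (Suc k) powr (-p - 1)))"
    using * sG G \<tau> by (subst (asm) suminf_ennreal2) auto
  then have "(\<Sum>n. G * \<tau> n) = C * (\<Sum>k. real (Suc k) powr (-p - 1))"
    using sG G \<tau> C sp by (subst (asm) ennreal_inj) (auto intro!: suminf_nonneg mult_nonneg_nonneg)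
  then have "(\<lambda>n. G * \<tau> n) sums (C * (\<Sum>k. real (Suc k) powr (-p - 1)))"
    using sG by (simp add: sums_iff)
  from sums_divide[OF this, of G] have "\<tau> sums ((C * (\<Sum>k. real (Suc k) powr (-p - 1))) / G)"
    using G by simp
  from sums_mult[OF this, of "p + 1"]
  have "(\<lambda>n. (p + 1) * \<tau> n) sums ((p + 1) * (p / Gamma (1 - p)) * (C * (\<Sum>k. real (Suc k) powr (-p - 1))))"
    by (simp add: G_def mult_ac)
  \<comment> \<open>\<open>\<tau>\<close> is indexed from the interval [0, 1],
    \<open>em_term\<close> from [1, 2]. The split-off term (p + 1) \<tau>(0) equals 1 - (p + 1) / 2,
    the part of \<open>em_zeta\<close> at -p outside the series, so the two corrections cancel
    below.\<close>
  then have "(\<lambda>n. (p + 1) * \<tau> (Suc n)) sums ((p + 1) * (p / Gamma (1 - p)) * (C * (\<Sum>k. real (Suc k) powr (-p - 1))) - (p + 1) * \<tau> 0)"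
    by (subst sums_Suc_iff) simp
  then have "(\<lambda>n. complex_of_real ((p + 1) * \<tau> (Suc n))) sums of_real ((p + 1) * (p / Gamma (1 - p)) * (C * (\<Sum>k. real (Suc k) powr (-p - 1))) - (p + 1) * \<tau> 0)"
    by (simp only: sums_of_real_iff)
  moreover have "complex_of_real ((p + 1) * \<tau> (Suc n)) = em_term n (of_real (-p))" for n
  proof -
    have pw: "complex_of_nat m powr (complex_of_real r) = of_real (real m powr r)" for m r
      using powr_of_real[of "real m" r] by simp
    have e: "- complex_of_real (-p) = of_real p" "1 - complex_of_real (-p) = of_real (p + 1)" by auto
    have "em_term n (of_real (-p)) = of_real ((- p - 1) * (real (Suc n) powr p + real (Suc (Suc n)) powr p) / 2
       - real (Suc n) powr (p + 1) + real (Suc (Suc n)) powr (p + 1))"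
      unfolding em_term_def e pw by simp
    also have "(- p - 1) * (real (Suc n) powr p + real (Suc (Suc n)) powr p) / 2
       - real (Suc n) powr (p + 1) + real (Suc (Suc n)) powr (p + 1) = (p + 1) * \<tau> (Suc n)"
      unfolding \<tau>_def using p by (simp add: field_simps)
    finally show ?thesis ..
  qed
  ultimately have "(\<Sum>n. em_term n (of_real (-p))) = of_real ((p + 1) * (p / Gamma (1 - p)) * (C * (\<Sum>k. real (Suc k) powr (-p - 1))) - (p + 1) * \<tau> 0)"
    by (simp add: sums_iff)
  moreover have "(p + 1) * \<tau> 0 = 1 - (p + 1) / 2"
    using p by (simp add: \<tau>_def field_simps)
  ultimately have em: "(\<Sum>n. em_term n (of_real (-p))) = of_real ((p + 1) * (p / Gamma (1 - p)) * (C * (\<Sum>k. real (Suc k) powr (-p - 1))) - (1 - (p + 1) / 2))"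
    by (simp only:)
  have "em_zeta (of_real (-p)) = of_real (1 - (p + 1) / 2) + (\<Sum>n. em_term n (of_real (-p)))"
    by (simp add: em_zeta_def field_simps)
  then show ?thesis
    unfolding em by (simp only: C_def of_real_add [symmetric] add.commute[of "1 - (p + 1) / 2"] diff_add_cancel)
qed

section \<open>Functional equation and the entire function (s - 1) zeta(s)\<close>

definition dirichlet_zeta :: "complex \<Rightarrow> complex" where
  "dirichlet_zeta s = (\<Sum>n. of_nat (Suc n) powr (-s))"

definition chi :: "complex \<Rightarrow> complex" where
  "chi s = 2 powr s * of_real pi powr (s - 1) * sin (of_real pi * s / 2) * Gamma (1 - s)"

text \<open>For Re s <= -1 the functional equation serves as definition: there 1 - s has real part
  at least 2, where the Dirichlet series converges. The two branches are glued along the strip -1 <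
  Re s < 0, where both formulas hold.\<close>

definition zeta_num :: "complex \<Rightarrow> complex" where
  "zeta_num s = (if Re s > -1 then em_zeta s else (s - 1) * chi s * dirichlet_zeta (1 - s))"

lemma dirichlet_zeta_eq: "Re s > 1 \<Longrightarrow> dirichlet_zeta s = em_zeta s / (s - 1)"
  using em_zeta_eq_dirichlet[of s] by (auto simp: dirichlet_zeta_def)

lemma holomorphic_dirichlet_zeta: "dirichlet_zeta holomorphic_on {s. Re s > 1}"
proof -
  have "(\<lambda>s. em_zeta s / (s - 1)) holomorphic_on {s. Re s > 1}"
    by (intro holomorphic_intros holomorphic_on_subset[OF holomorphic_em_zeta]) auto
  then show ?thesis by (rule holomorphic_transform) (simp add: dirichlet_zeta_eq)
qed

lemma one_minus_notin_nonpos_Ints: "Re s < 1 \<Longrightarrow> 1 - s \<notin> \<int>\<^sub>\<le>\<^sub>0"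
  by (auto elim!: nonpos_Ints_cases simp: complex_eq_iff)

lemma holomorphic_chi: "chi holomorphic_on {s. Re s < 1}"
  unfolding chi_def using one_minus_notin_nonpos_Ints by (auto intro!: holomorphic_intros)

lemma holomorphic_reflected_zeta: "(\<lambda>s. (s - 1) * chi s * dirichlet_zeta (1 - s)) holomorphic_on {s. Re s < 0}"
proof -
  have "(\<lambda>s. dirichlet_zeta (1 - s)) holomorphic_on {s. Re s < 0}"
    by (rule holomorphic_on_compose_gen[of "\<lambda>s. 1 - s" _ dirichlet_zeta "{s. Re s > 1}", unfolded o_def])
      (auto intro!: holomorphic_intros holomorphic_dirichlet_zeta)
  then show ?thesis
    by (intro holomorphic_intros holomorphic_on_subset[OF holomorphic_chi]) auto
qed

text \<open>Gamma(1 + p) = p Gamma(p), the reflection formula and sin(pi p) = 2 sin(pi p / 2) cos(pi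
  p / 2) bring the sine and gamma factors into exactly the constant that occurs in
  \<open>em_zeta_of_real_neg\<close>.\<close>

lemma chi_of_real_neg:
  assumes p: "0 < p" "p < 1"
  shows "chi (of_real (-p)) = - of_real (p / Gamma (1 - p) * ((2 * pi) powr (-p - 1) * (pi / cos (pi * p / 2))))"
proof -
  have e1: "complex_of_real 2 powr complex_of_real (-p) = of_real (2 powr (-p))"
    by (subst powr_of_real) auto
  have e2: "complex_of_real pi powr complex_of_real (-p - 1) = of_real (pi powr (-p - 1))"
    by (subst powr_of_real) auto
  have e3: "sin (complex_of_real (- (pi * p / 2))) = of_real (- sin (pi * p / 2))"
    by (simp only: sin_of_real sin_minus)
  have e4: "Gamma (complex_of_real (1 + p)) = of_real (Gamma (1 + p))"
    by (rule Gamma_complex_of_real)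
  have "chi (of_real (-p)) = complex_of_real 2 powr complex_of_real (-p) * complex_of_real pi powr complex_of_real (-p - 1)
      * sin (complex_of_real (- (pi * p / 2))) * Gamma (complex_of_real (1 + p))"
    unfolding chi_def by simp
  also have "\<dots> = - of_real (2 powr (-p) * pi powr (-p - 1) * sin (pi * p / 2) * Gamma (1 + p))"
    unfolding e1 e2 e3 e4 by simp
  also have "2 powr (-p) * pi powr (-p - 1) * sin (pi * p / 2) * Gamma (1 + p) =
     p / Gamma (1 - p) * ((2 * pi) powr (-p - 1) * (pi / cos (pi * p / 2)))"
  proof -
    have pos: "Gamma (1 - p) > 0" "Gamma p > 0" using p by (auto intro: Gamma_real_pos)
    have cs: "cos (pi * p / 2) > 0" "sin (pi * p / 2) > 0"
      using p by (auto intro!: cos_gt_zero sin_gt_zero simp: field_simps)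
    have G: "Gamma (1 + p) = p * Gamma p"
      using Gamma_plus1[of p] p nonpos_Ints_nonpos[of p] by (force simp: add.commute)
    have "complex_of_real (Gamma p * Gamma (1 - p)) = Gamma (of_real p) * Gamma (1 - of_real p)"
      using Gamma_complex_of_real[of "1 - p"] by (simp add: Gamma_complex_of_real)
    also have "\<dots> = of_real (pi / sin (pi * p))"
      unfolding Gamma_reflection_complex by (simp flip: sin_of_real)
    finally have R: "Gamma p * Gamma (1 - p) = pi / sin (pi * p)" by (simp only: of_real_eq_iff)
    have "sin (pi * p) = 2 * sin (pi * p / 2) * cos (pi * p / 2)"
      using sin_double[of "pi * p / 2"] by simp
    with R have "Gamma p * Gamma (1 - p) = pi / (2 * sin (pi * p / 2) * cos (pi * p / 2))"
      by (simp only:)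
    then have "Gamma p = pi / (2 * sin (pi * p / 2) * cos (pi * p / 2)) / Gamma (1 - p)"
      using pos by (simp only: nonzero_eq_divide_eq less_imp_neq[symmetric] not_False_eq_True)
    then have "sin (pi * p / 2) * Gamma (1 + p) = p * pi / (2 * cos (pi * p / 2) * Gamma (1 - p))"
      unfolding G using cs by simp
    moreover have "(2 * pi) powr (-p - 1) = 2 powr (-p) / 2 * pi powr (-p - 1)"
      by (simp add: powr_mult powr_diff)
    ultimately have "2 powr (-p) * pi powr (-p - 1) * (sin (pi * p / 2) * Gamma (1 + p)) =
        2 powr (-p) * pi powr (-p - 1) * (p * pi / (2 * cos (pi * p / 2) * Gamma (1 - p)))"
      and "(2 * pi) powr (-p - 1) = 2 powr (-p) / 2 * pi powr (-p - 1)"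
      by (simp_all only:)
    then show ?thesis by (simp only: mult.assoc) (simp add: mult_ac)
  qed
  finally show ?thesis .
qed

text \<open>Identity theorem in the strip: equality is known on the real segment (-1, 0), which has
  the limit point -1/2 inside the strip.\<close>

lemma em_zeta_functional_equation:
  assumes "-1 < Re s" "Re s < 0"
  shows "em_zeta s = (s - 1) * chi s * dirichlet_zeta (1 - s)"
proof -
  define S where "S = {s. -1 < Re s} \<inter> {s. Re s < 0}"
  define f where "f = (\<lambda>s. em_zeta s - (s - 1) * chi s * dirichlet_zeta (1 - s))"
  have "f s = 0"
  proof (rule analytic_continuation[where f = f and w = s and S = S and U = "of_real ` {-1<..<0}" and \<xi> = "of_real (-1/2)"])
    show "f holomorphic_on S" unfolding f_def S_def
      by (intro holomorphic_on_diff holomorphic_on_subset[OF holomorphic_em_zeta] holomorphic_on_subset[OF holomorphic_reflected_zeta]) auto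
    show "open S" unfolding S_def by (intro open_Int open_Re_gt open_Re_lt)
    show "connected S" unfolding S_def
      by (intro convex_connected convex_Int convex_halfspace_Re_gt convex_halfspace_Re_lt)
    show "complex_of_real ` {-1<..<0} \<subseteq> S" by (auto simp: S_def)
    show "complex_of_real (-1/2) \<in> S" by (simp add: S_def)
    have "(-1/2::real) islimpt {-1<..<0}" by (intro interior_limit_point) auto
    moreover have "isCont complex_of_real (-1/2)" by (intro continuous_intros)
    moreover have "eventually (\<lambda>x. complex_of_real x \<noteq> complex_of_real (-1/2)) (at (-1/2))"
      unfolding of_real_eq_iff by (simp add: eventually_at_filter)
    ultimately show "complex_of_real (-1/2) islimpt of_real ` {-1<..<0}"
      by (rule islimpt_isCont_image)
    show "s \<in> S" using assms by (simp add: S_def)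
    fix z assume "z \<in> complex_of_real ` {-1<..<0}"
    then obtain x where x: "z = of_real x" "-1 < x" "x < 0" by auto
    define p where "p = -x"
    have p: "0 < p" "p < 1" "z = of_real (-p)" using x by (auto simp: p_def)
    have "complex_of_nat (Suc n) powr (- (1 - z)) = of_real (real (Suc n) powr (-p - 1))" for n
    proof -
      have "- (1 - z) = complex_of_real (-p - 1)" by (simp add: p(3))
      then show ?thesis using powr_of_real[of "real (Suc n)" "-p - 1"] by (simp only: of_real_of_nat_eq of_nat_0_le_iff)
    qed
    then have d: "dirichlet_zeta (1 - z) = of_real (\<Sum>k. real (Suc k) powr (-p - 1))"
      unfolding dirichlet_zeta_def using summable_dirichlet[of "1 - z"] p
      by (subst suminf_of_real) (auto simp: summable_of_real_iff)
    have gen: "of_real ((p + 1) * X * (Y * D)) - (complex_of_real (-p) - 1) * (- of_real (X * Y)) * of_real D = 0" for X Y D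
      by (simp add: algebra_simps)
    show "f z = 0"
      unfolding f_def d unfolding p(3) chi_of_real_neg[OF p(1,2)] em_zeta_of_real_neg[OF p(1,2)]
      by (rule gen)
  qed
  then show ?thesis by (simp add: f_def)
qed

lemma holomorphic_zeta_num: "zeta_num holomorphic_on UNIV"
proof -
  have "zeta_num holomorphic_on {s. Re s > -1}"
    by (rule holomorphic_transform[OF holomorphic_em_zeta]) (simp add: zeta_num_def)
  moreover have "zeta_num holomorphic_on {s. Re s < 0}"
    by (rule holomorphic_transform[OF holomorphic_reflected_zeta]) (simp add: zeta_num_def em_zeta_functional_equation)
  ultimately have "zeta_num holomorphic_on ({s. Re s > -1} \<union> {s. Re s < 0})"
    by (rule holomorphic_on_Un[OF _ _ open_Re_gt open_Re_lt])
  also have "{s. Re s > -1} \<union> {s. Re s < 0} = UNIV" by auto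
  finally show ?thesis .
qed

section \<open>Identification of \<open>zeta\<close>\<close>

lemma zeta_num_1: "zeta_num 1 = 1"
  by (simp add: zeta_num_def em_zeta_def em_term_def del: of_nat_Suc)

text \<open>The difference is meromorphic and vanishes on a nonempty open set, hence off a sparse
  set. So both functions have the same poles and the same limits, and the normalisation of values at
  isolated singularities then forces equality at every point.\<close>

lemma nicely_meromorphic_unique:
  assumes f: "f nicely_meromorphic_on UNIV" and g: "g nicely_meromorphic_on UNIV"
    and U: "open U" "U \<noteq> {}" "\<And>z. z \<in> U \<Longrightarrow> f z = g z"
  shows "f = g"
proof
  fix z
  have mero: "(\<lambda>z. f z - g z) meromorphic_on UNIV"
    using f g by (auto intro!: meromorphic_intros simp: nicely_meromorphic_on_def)
  have "eventually (\<lambda>z. f z - g z = 0) (cosparse UNIV)"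
  proof (rule ccontr)
    assume "\<not> eventually (\<lambda>z. f z - g z = 0) (cosparse UNIV)"
    then have *: "eventually (\<lambda>z. f z - g z \<noteq> 0) (cosparse UNIV)"
      using meromorphic_imp_constant_or_avoid[OF mero open_UNIV connected_UNIV] by blast
    obtain u where u: "u \<in> U" using U by auto
    from * have "eventually (\<lambda>z. f z - g z \<noteq> 0) (at u)"
      by (simp add: eventually_cosparse_open_eq)
    moreover have "eventually (\<lambda>z. z \<in> U) (at u)"
      using U(1) u by (rule eventually_at_in_open')
    ultimately have "eventually (\<lambda>_. False) (at u)"
      by eventually_elim (use U(3) in auto)
    then show False by simp
  qed
  then have ev: "eventually (\<lambda>z. f z = g z) (at z)"
    by (simp add: eventually_cosparse_open_eq)
  then have pole: "is_pole f z \<longleftrightarrow> is_pole g z"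
    by (intro is_pole_cong) auto
  from f have "is_pole f z \<and> f z = 0 \<or> f \<midarrow>z\<rightarrow> f z" by (auto simp: nicely_meromorphic_on_def)
  moreover from g have "is_pole g z \<and> g z = 0 \<or> g \<midarrow>z\<rightarrow> g z" by (auto simp: nicely_meromorphic_on_def)
  ultimately show "f z = g z"
  proof (elim disjE conjE)
    assume "f \<midarrow>z\<rightarrow> f z" "g \<midarrow>z\<rightarrow> g z"
    then have "f \<midarrow>z\<rightarrow> g z" using tendsto_cong[OF ev] by blast
    with \<open>f \<midarrow>z\<rightarrow> f z\<close> show ?thesis using LIM_unique by blast
  qed (use pole not_tendsto_and_filterlim_at_infinity[of "at z"] in \<open>auto simp: is_pole_def\<close>)
qed

text \<open>Resolves the definite description. At s = 1 the quotient has a pole because the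
  numerator is 1 there, and division by zero gives the value 0 that the normalisation
  prescribes.\<close>

lemma zeta_eq: "zeta s = zeta_num s / (s - 1)"
proof -
  define f where "f = (\<lambda>s. zeta_num s / (s - 1))"
  have an: "zeta_num analytic_on A" for A
    using holomorphic_zeta_num analytic_on_open[OF open_UNIV] analytic_on_subset by blast
  have nice: "f nicely_meromorphic_on UNIV"
    unfolding nicely_meromorphic_on_def
  proof (intro conjI ballI)
    show "f meromorphic_on UNIV" unfolding f_def
      by (intro meromorphic_intros analytic_on_imp_meromorphic_on an)
    fix z :: complex
    show "is_pole f z \<and> f z = 0 \<or> f \<midarrow>z\<rightarrow> f z"
    proof (cases "z = 1")
      case True
      have "is_pole f 1" unfolding f_def
      proof (rule is_pole_divide)
        show "isCont zeta_num 1" using an by (rule analytic_at_imp_isCont)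
        show "filterlim (\<lambda>s::complex. s - 1) (at 0) (at 1)"
          by (auto simp: filterlim_at eventually_at_filter intro!: tendsto_eq_intros)
      qed (simp add: zeta_num_1)
      then show ?thesis using True by (simp add: f_def)
    next
      case False
      then have "f analytic_on {z}" unfolding f_def by (intro analytic_intros an) auto
      then show ?thesis using analytic_at_imp_isCont isContD by blast
    qed
  qed
  have sums: "(\<lambda>n. 1 / of_nat (Suc n) powr s) sums f s" if "Re s > 1" for s
  proof -
    have "f s = dirichlet_zeta s"
      using that by (simp add: f_def zeta_num_def dirichlet_zeta_eq)
    then show ?thesis
      using summable_dirichlet[OF that] by (simp add: dirichlet_zeta_def summable_sums powr_minus_divide)
  qed
  have "zeta = f"
    unfolding zeta_def
  proof (rule the_equality)
    fix g assume g: "g nicely_meromorphic_on UNIV \<and> (\<forall>s. Re s > 1 \<longrightarrow> (\<lambda>n. 1 / of_nat (Suc n) powr s) sums g s)"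
    show "g = f"
    proof (rule nicely_meromorphic_unique[OF _ nice open_Re_gt[of 1]])
      have "(2::complex) \<in> {s. Re s > 1}" by simp
      then show "{s. Re s > 1} \<noteq> {}" by blast
    qed (use g sums sums_unique2 in blast)+
  qed (use nice sums in auto)
  then show ?thesis unfolding f_def by (rule fun_cong)
qed

lemma zeta_eq_dirichlet: "Re s > 1 \<Longrightarrow> zeta s = dirichlet_zeta s"
  by (simp add: zeta_eq zeta_num_def dirichlet_zeta_eq)

lemma zeta_functional_equation:
  assumes "Re s < 0"
  shows "zeta s = chi s * zeta (1 - s)"
proof -
  have "s \<noteq> 1" using assms by auto
  then show ?thesis
    using assms zeta_eq_dirichlet[of "1 - s"]
    by (simp add: zeta_eq[of s] zeta_num_def em_zeta_functional_equation)
qed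

lemma holomorphic_zeta: "1 \<notin> A \<Longrightarrow> zeta holomorphic_on A"
  unfolding zeta_eq[abs_def]
  by (intro holomorphic_intros holomorphic_on_subset[OF holomorphic_zeta_num]) auto

section \<open>Asymptotics of the factor in the functional equation\<close>

text \<open>From n^2 + t^2 >= (n + t)^2 / 2 the terms are at most 2 / ((n + t - 1)(n + t)), which
  telescope to 2 / (t - 1); this is at most 4 / t for t >= 2.\<close>

lemma sum_inverse_quadratic_le:
  fixes t :: real
  assumes "t \<ge> 2"
  shows "summable (\<lambda>n. 1 / (real n ^ 2 + t ^ 2))" "(\<Sum>n. 1 / (real n ^ 2 + t ^ 2)) \<le> 4 / t"
proof -
  define b where "b = (\<lambda>n. 1 / (real n + t - 1))"
  have "filterlim (\<lambda>n. (t - 1) + real n) at_top sequentially"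
    by (intro filterlim_tendsto_add_at_top[OF tendsto_const] filterlim_real_sequentially)
  then have "filterlim (\<lambda>n. real n + t - 1) at_infinity sequentially"
    by (intro filterlim_at_top_imp_at_infinity) (simp add: algebra_simps)
  then have "b \<longlonglongrightarrow> 0" unfolding b_def by (intro tendsto_divide_0[OF tendsto_const])
  then have "(\<lambda>n. b n - b (Suc n)) sums (b 0 - 0)" by (rule telescope_sums')
  then have b: "(\<lambda>n. 2 * (b n - b (Suc n))) sums (2 * b 0)" by (intro sums_mult) simp
  have le: "1 / (real n ^ 2 + t ^ 2) \<le> 2 * (b n - b (Suc n))" for n
  proof -
    have pos: "real n + t - 1 > 0" "real n + t > 0" using assms by auto
    have "(real n + t - 1) * (real n + t) \<le> (real n + t) * (real n + t)"
      using pos by (intro mult_right_mono) auto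
    also have "\<dots> \<le> 2 * (real n ^ 2 + t ^ 2)"
      using sum_squares_bound[of "real n" t] by (simp add: power2_eq_square algebra_simps)
    finally have "(real n + t - 1) * (real n + t) \<le> 2 * (real n ^ 2 + t ^ 2)" .
    moreover have "1 / D \<le> 2 / P" if "P > 0" "P \<le> 2 * D" for P D :: real
      using that by (simp add: field_simps)
    ultimately have "1 / (real n ^ 2 + t ^ 2) \<le> 2 / ((real n + t - 1) * (real n + t))"
      using pos by (metis mult_pos_pos)
    moreover have "2 * (b n - b (Suc n)) = 2 / ((real n + t - 1) * (real n + t))"
      using pos by (simp add: b_def field_simps)
    ultimately show ?thesis by (simp only:)
  qed
  show s: "summable (\<lambda>n. 1 / (real n ^ 2 + t ^ 2))"
    using le by (intro summable_comparison_test'[OF sums_summable[OF b], of 0]) auto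
  have "(\<Sum>n. 1 / (real n ^ 2 + t ^ 2)) \<le> 2 * b 0"
    using suminf_le[OF le s sums_summable[OF b]] b by (simp add: sums_iff)
  also have "\<dots> \<le> 4 / t" using assms by (simp add: b_def field_simps)
  finally show "(\<Sum>n. 1 / (real n ^ 2 + t ^ 2)) \<le> 4 / t" .
qed

lemma norm_shift_ge:
  assumes "Re z > 0" "0 \<le> u"
  shows "real n ^ 2 + \<bar>Im z\<bar> ^ 2 \<le> norm (z + of_nat n + of_real u) ^ 2"
proof -
  have "real n ^ 2 \<le> (Re z + real n + u) ^ 2" using assms by (intro power_mono) auto
  then show ?thesis by (simp add: cmod_power2)
qed

lemma norm_Polygamma_1_le:
  assumes "Re z > 0" "\<bar>Im z\<bar> \<ge> 2"
  shows "norm (Polygamma 1 z) \<le> 4 / \<bar>Im z\<bar>"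
proof -
  note s = sum_inverse_quadratic_le[OF assms(2)]
  have le: "norm (inverse ((z + of_nat n) ^ 2)) \<le> 1 / (real n ^ 2 + \<bar>Im z\<bar> ^ 2)" for n
  proof -
    have "real n ^ 2 + \<bar>Im z\<bar> ^ 2 \<le> norm (z + of_nat n) ^ 2"
      using norm_shift_ge[of z 0 n] assms by simp
    then have "1 / norm (z + of_nat n) ^ 2 \<le> 1 / (real n ^ 2 + \<bar>Im z\<bar> ^ 2)"
      using assms by (intro frac_le) (auto intro!: add_nonneg_pos)
    then show ?thesis by (simp add: norm_divide norm_power inverse_eq_divide)
  qed
  have "norm (\<Sum>n. inverse ((z + of_nat n) ^ 2)) \<le> (\<Sum>n. 1 / (real n ^ 2 + \<bar>Im z\<bar> ^ 2))"
    by (rule norm_suminf_le[OF le s(1)])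
  then show ?thesis using s(2) by (simp add: Polygamma_def numeral_2_eq_2)
qed

text \<open>Stirling's formula to first order. The limit formula for the digamma function and
  telescoping of Ln(z + n) give Digamma(z) - Ln(z) as the series of Ln(z + n + 1) - Ln(z + n) - 1 /
  (z + n), whose terms are of order 1 / |z + n|^2 by the mean value inequality.\<close>

lemma norm_Digamma_minus_Ln_le:
  assumes z: "Re z > 0" "\<bar>Im z\<bar> \<ge> 2"
  shows "norm (Digamma z - Ln z) \<le> 4 / \<bar>Im z\<bar>"
proof -
  note s = sum_inverse_quadratic_le[OF assms(2)]
  define d where "d = (\<lambda>n. Ln (z + of_nat (Suc n)) - Ln (z + of_nat n) - inverse (z + of_nat n))"
  have pos: "real n ^ 2 + \<bar>Im z\<bar> ^ 2 > 0" for n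
    using z by (intro add_nonneg_pos zero_less_power) auto
  have le: "norm (d n) \<le> 1 / (real n ^ 2 + \<bar>Im z\<bar> ^ 2)" for n
  proof -
    define F where "F = (\<lambda>u. Ln (z + of_nat n + u) - u * inverse (z + of_nat n))"
    define S where "S = closed_segment (0::complex) 1"
    have S: "u = of_real (Re u) \<and> Re u \<ge> 0 \<and> Re u \<le> 1" if "u \<in> S" for u
      using that by (auto simp: S_def closed_segment_def complex_eq_iff)
    have "norm (F 1 - F 0) \<le> 1 / (real n ^ 2 + \<bar>Im z\<bar> ^ 2) * norm (1 - 0 :: complex)"
    proof (rule field_differentiable_bound[where S = S])
      fix u assume u: "u \<in> S"
      have nz: "z + of_nat n + u \<noteq> 0" "z + of_nat n \<noteq> 0"
        using z S[OF u] by (auto simp: complex_eq_iff)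
      have "z + of_nat n + u \<notin> \<real>\<^sub>\<le>\<^sub>0"
        using S[OF u] z by (auto simp: complex_nonpos_Reals_iff)
      then show "(F has_field_derivative (inverse (z + of_nat n + u) - inverse (z + of_nat n))) (at u within S)"
        unfolding F_def using nz by (auto intro!: derivative_eq_intros simp: inverse_eq_divide)
      have ge: "sqrt (real n ^ 2 + \<bar>Im z\<bar> ^ 2) \<le> norm (z + of_nat n + of_real v)" if "v \<ge> 0" for v
        using norm_shift_ge[OF z(1) that, of n] by (simp add: real_le_lsqrt)
      have "inverse (z + of_nat n + u) - inverse (z + of_nat n) = - u / ((z + of_nat n + u) * (z + of_nat n))"
        using nz by (simp add: field_simps)
      also have "norm \<dots> = norm u / (norm (z + of_nat n + u) * norm (z + of_nat n))"
        by (simp add: norm_divide norm_mult)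
      also have "\<dots> \<le> 1 / (sqrt (real n ^ 2 + \<bar>Im z\<bar> ^ 2) * sqrt (real n ^ 2 + \<bar>Im z\<bar> ^ 2))"
      proof (rule frac_le)
        have "norm u = \<bar>Re u\<bar>" using S[OF u] by (metis norm_of_real)
        then show "norm u \<le> 1" using S[OF u] by simp
        show "sqrt (real n ^ 2 + \<bar>Im z\<bar> ^ 2) * sqrt (real n ^ 2 + \<bar>Im z\<bar> ^ 2) \<le> norm (z + of_nat n + u) * norm (z + of_nat n)"
          using ge[of "Re u"] ge[of 0] S[OF u] pos[of n] by (intro mult_mono) auto
      qed (use pos[of n] in auto)
      also have "\<dots> = 1 / (real n ^ 2 + \<bar>Im z\<bar> ^ 2)" using pos[of n] by simp
      finally show "norm (inverse (z + of_nat n + u) - inverse (z + of_nat n)) \<le> 1 / (real n ^ 2 + \<bar>Im z\<bar> ^ 2)" .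
    qed (auto simp: S_def)
    moreover have "F 1 - F 0 = d n" by (simp add: F_def d_def add_ac)
    ultimately show ?thesis by simp
  qed
  have "d sums (Digamma z - Ln z)"
    unfolding sums_def
  proof (rule Lim_transform_eventually)
    have "z \<noteq> 0" using z by auto
    have "(\<lambda>m. 1 + z / of_nat m) \<longlonglongrightarrow> 1 + 0"
      by (intro tendsto_intros tendsto_divide_0[OF tendsto_const] tendsto_of_nat)
    then have "(\<lambda>m. Ln (1 + z / of_nat m)) \<longlonglongrightarrow> Ln (1 + 0)"
      by (intro tendsto_Ln) (auto simp: complex_nonpos_Reals_iff)
    \<comment> \<open>The summand Ln(1 + z / m) tends to 0; it is inserted because Ln(z + m) = ln m
      + Ln(1 + z / m).\<close>
    then show "(\<lambda>m. (of_real (ln (real m)) - (\<Sum>n<m. inverse (z + of_nat n))) + Ln (1 + z / of_nat m) - Ln z) \<longlonglongrightarrow> Digamma z - Ln z"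
      using tendsto_diff[OF tendsto_add[OF Digamma_LIMSEQ[OF \<open>z \<noteq> 0\<close>]] tendsto_const[of "Ln z"]] by fastforce
    show "eventually (\<lambda>m. of_real (ln (real m)) - (\<Sum>n<m. inverse (z + of_nat n)) + Ln (1 + z / of_nat m) - Ln z = (\<Sum>n<m. d n)) sequentially"
      using eventually_gt_at_top[of 0]
    proof eventually_elim
      case (elim m)
      have "(\<Sum>n<m. d n) = (\<Sum>n<m. Ln (z + of_nat (Suc n)) - Ln (z + of_nat n)) - (\<Sum>n<m. inverse (z + of_nat n))"
        by (simp add: d_def sum_subtractf)
      also have "(\<Sum>n<m. Ln (z + of_nat (Suc n)) - Ln (z + of_nat n)) = Ln (z + of_nat m) - Ln z"
        by (subst sum_lessThan_telescope) simp
      also have "z + of_nat m = of_real (real m) * (1 + z / of_nat m)"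
        using elim by (simp add: field_simps)
      also have "Ln (of_real (real m) * (1 + z / of_nat m)) = of_real (ln (real m)) + Ln (1 + z / of_nat m)"
        using elim z by (subst Ln_times_of_real) (auto simp: complex_eq_iff)
      finally show ?case by simp
    qed
  qed
  then have "Digamma z - Ln z = suminf d" by (simp add: sums_iff)
  also have "norm \<dots> \<le> (\<Sum>n. 1 / (real n ^ 2 + \<bar>Im z\<bar> ^ 2))"
    by (rule norm_suminf_le[OF le s(1)])
  also have "\<dots> \<le> 4 / \<bar>Im z\<bar>" by (rule s(2))
  finally show ?thesis .
qed

text \<open>A holomorphic logarithm of chi on the upper half plane. The sine is written as exp(-i pi
  s / 2) (i / 2) (1 - exp(i pi s)), and |exp(i pi s)| < 1 keeps the last factor in the right half
  plane, off the branch cut.\<close>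

definition chi_log :: "complex \<Rightarrow> complex" where
  "chi_log s = s * of_real (ln 2) + (s - 1) * of_real (ln pi) - \<i> * of_real pi * s / 2 + Ln (\<i> / 2)
     + Ln (1 - exp (\<i> * of_real pi * s)) + ln_Gamma (1 - s)"

definition chi_log' :: "complex \<Rightarrow> complex" where
  "chi_log' s = of_real (ln (2 * pi)) - \<i> * of_real pi / 2
     - \<i> * of_real pi * exp (\<i> * of_real pi * s) / (1 - exp (\<i> * of_real pi * s)) - Digamma (1 - s)"

definition chi_log'' :: "complex \<Rightarrow> complex" where
  "chi_log'' s = (of_real pi)^2 * exp (\<i> * of_real pi * s) / (1 - exp (\<i> * of_real pi * s))^2 + Polygamma 1 (1 - s)"

lemma norm_exp_upper: "norm (exp (\<i> * of_real pi * s)) = exp (- pi * Im s)"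
  by simp

lemma one_minus_exp_upper:
  assumes "Im s > 0"
  shows "1 - exp (\<i> * of_real pi * s) \<notin> \<real>\<^sub>\<le>\<^sub>0" "1 - exp (\<i> * of_real pi * s) \<noteq> 0"
proof -
  have "norm (exp (\<i> * of_real pi * s)) < 1"
    unfolding norm_exp_upper using assms by simp
  then have "Re (exp (\<i> * of_real pi * s)) < 1"
    using complex_Re_le_cmod[of "exp (\<i> * of_real pi * s)"] by linarith
  then show "1 - exp (\<i> * of_real pi * s) \<notin> \<real>\<^sub>\<le>\<^sub>0" "1 - exp (\<i> * of_real pi * s) \<noteq> 0"
    by (auto simp: complex_nonpos_Reals_iff complex_eq_iff)
qed

lemma one_minus_upper:
  assumes "Im s > 0"
  shows "1 - s \<notin> \<real>\<^sub>\<le>\<^sub>0" "1 - s \<notin> \<int>\<^sub>\<le>\<^sub>0"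
  using assms by (auto simp: complex_nonpos_Reals_iff elim!: nonpos_Ints_cases simp: complex_eq_iff)

lemma exp_chi_log:
  assumes "Im s > 0"
  shows "exp (chi_log s) = chi s"
proof -
  have "sin (of_real pi * s / 2) = (exp (\<i> * (of_real pi * s / 2)) - exp (- (\<i> * (of_real pi * s / 2)))) / (2 * \<i>)"
    by (rule sin_exp_eq)
  also have "exp (\<i> * (of_real pi * s / 2)) = exp (- (\<i> * of_real pi * s / 2)) * exp (\<i> * of_real pi * s)"
    by (simp add: field_simps flip: exp_add)
  also have "(exp (- (\<i> * of_real pi * s / 2)) * exp (\<i> * of_real pi * s) - exp (- (\<i> * (of_real pi * s / 2)))) / (2 * \<i>)
     = exp (- (\<i> * of_real pi * s / 2)) * (\<i> / 2) * (1 - exp (\<i> * of_real pi * s))"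
    by (simp add: field_simps)
  finally have "sin (of_real pi * s / 2) = exp (- (\<i> * of_real pi * s / 2)) * (\<i> / 2) * (1 - exp (\<i> * of_real pi * s))" .
  moreover have "Gamma (1 - s) = exp (ln_Gamma (1 - s))"
    using one_minus_upper[OF assms] by (simp add: Gamma_complex_altdef)
  moreover have "2 powr s = exp (s * of_real (ln 2))" "of_real pi powr (s - 1) = exp ((s - 1) * of_real (ln pi))"
    using Ln_of_real[of 2] Ln_of_real[of pi] by (auto simp: powr_def)
  moreover have "exp (chi_log s) = exp (s * of_real (ln 2)) * exp ((s - 1) * of_real (ln pi))
     * (exp (- (\<i> * of_real pi * s / 2)) * exp (Ln (\<i> / 2)) * exp (Ln (1 - exp (\<i> * of_real pi * s)))) * exp (ln_Gamma (1 - s))"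
    by (simp only: chi_log_def diff_conv_add_uminus exp_add mult.assoc)
  moreover have "exp (Ln (\<i> / 2)) = \<i> / 2" "exp (Ln (1 - exp (\<i> * of_real pi * s))) = 1 - exp (\<i> * of_real pi * s)"
    using one_minus_exp_upper(2)[OF assms] by auto
  ultimately show ?thesis by (simp only: chi_def)
qed

lemma has_field_derivative_chi_log:
  assumes "Im s > 0"
  shows "(chi_log has_field_derivative chi_log' s) (at s)"
  unfolding chi_log_def chi_log'_def using one_minus_exp_upper[OF assms] one_minus_upper[OF assms]
  by (auto intro!: derivative_eq_intros simp: ln_mult field_simps)

lemma has_field_derivative_chi_log':
  assumes "Im s > 0"
  shows "(chi_log' has_field_derivative chi_log'' s) (at s)"
  unfolding chi_log'_def chi_log''_def using one_minus_exp_upper[OF assms] one_minus_upper[OF assms]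
  by (auto intro!: derivative_eq_intros simp: field_simps power2_eq_square)

text \<open>The exponential decay is weakened to order 1 / Im s by exp x >= 1 + x, so that it merges
  with the error of Stirling's formula.\<close>

lemma exp_upper_bounds:
  assumes "Im s \<ge> 2"
  shows "norm (exp (\<i> * of_real pi * s)) \<le> 1 / (3 * Im s)" "norm (1 - exp (\<i> * of_real pi * s)) \<ge> 1 / 2"
proof -
  have "3 * Im s \<le> pi * Im s" using pi_gt3 assms by (intro mult_right_mono) auto
  also have "\<dots> \<le> exp (pi * Im s)" using exp_ge_add_one_self[of "pi * Im s"] by linarith
  finally have "3 * Im s \<le> exp (pi * Im s)" .
  then have "1 / exp (pi * Im s) \<le> 1 / (3 * Im s)" using assms by (intro divide_left_mono) auto
  then show *: "norm (exp (\<i> * of_real pi * s)) \<le> 1 / (3 * Im s)"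
    unfolding norm_exp_upper by (simp add: exp_minus inverse_eq_divide)
  also have "\<dots> \<le> 1 / 2" using assms by (simp add: field_simps)
  finally show "norm (1 - exp (\<i> * of_real pi * s)) \<ge> 1 / 2"
    using norm_triangle_ineq2[of 1 "exp (\<i> * of_real pi * s)"] by simp
qed

lemma chi_log'_approx:
  assumes "Re s < 1" "Im s \<ge> 2"
  shows "norm (chi_log' s - (of_real (ln (2 * pi)) - \<i> * of_real pi / 2 - Ln (1 - s))) \<le> 8 / Im s"
proof -
  define E where "E = exp (\<i> * of_real pi * s)"
  note E = exp_upper_bounds[OF assms(2), folded E_def]
  have "norm (Digamma (1 - s) - Ln (1 - s)) \<le> 4 / \<bar>Im (1 - s)\<bar>"
    using assms by (intro norm_Digamma_minus_Ln_le) auto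
  then have 1: "norm (Digamma (1 - s) - Ln (1 - s)) \<le> 4 / Im s" using assms by simp
  have "norm (\<i> * of_real pi * E / (1 - E)) = pi * norm E / norm (1 - E)"
    by (simp add: norm_mult norm_divide)
  also have "\<dots> \<le> 4 * (1 / (3 * Im s)) / (1 / 2)"
    using E assms pi_less_4 by (intro frac_le mult_mono) auto
  also have "\<dots> \<le> 4 / Im s" using assms by (simp add: field_simps)
  finally have 2: "norm (\<i> * of_real pi * E / (1 - E)) \<le> 4 / Im s" .
  have "chi_log' s - (of_real (ln (2 * pi)) - \<i> * of_real pi / 2 - Ln (1 - s)) =
     - (\<i> * of_real pi * E / (1 - E)) - (Digamma (1 - s) - Ln (1 - s))"
    by (simp add: chi_log'_def E_def)
  also have "norm \<dots> \<le> norm (- (\<i> * of_real pi * E / (1 - E))) + norm (Digamma (1 - s) - Ln (1 - s))"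
    by (rule norm_triangle_ineq4)
  also have "\<dots> \<le> 8 / Im s" using 1 2 by simp
  finally show ?thesis .
qed

lemma norm_chi_log''_le:
  assumes "Re s < 1" "Im s \<ge> 2"
  shows "norm (chi_log'' s) \<le> 26 / Im s"
proof -
  define E where "E = exp (\<i> * of_real pi * s)"
  note E = exp_upper_bounds[OF assms(2), folded E_def]
  have "norm (Polygamma 1 (1 - s)) \<le> 4 / \<bar>Im (1 - s)\<bar>"
    using assms by (intro norm_Polygamma_1_le) auto
  then have 1: "norm (Polygamma 1 (1 - s)) \<le> 4 / Im s" using assms by simp
  have "norm ((of_real pi)^2 * E / (1 - E)^2) = pi^2 * norm E / norm (1 - E)^2"
    by (simp add: norm_mult norm_divide norm_power)
  also have "\<dots> \<le> 4^2 * (1 / (3 * Im s)) / (1 / 2)^2"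
    using E assms pi_less_4 by (intro frac_le mult_mono power_mono) auto
  also have "\<dots> \<le> 22 / Im s" using assms by (simp add: field_simps power2_eq_square)
  finally have 2: "norm ((of_real pi)^2 * E / (1 - E)^2) \<le> 22 / Im s" .
  have "norm (chi_log'' s) \<le> norm ((of_real pi)^2 * E / (1 - E)^2) + norm (Polygamma 1 (1 - s))"
    unfolding chi_log''_def E_def by (rule norm_triangle_ineq)
  also have "\<dots> \<le> 26 / Im s" using 1 2 by simp
  finally show ?thesis .
qed

lemma norm_chi_critical_line:
  assumes "Re s = 1/2"
  shows "norm (chi s) = 1"
proof -
  have c: "1 - s = cnj s" using assms by (simp add: complex_eq_iff)
  define S where "S = norm (sin (of_real pi * s / 2))"
  have "cos (of_real pi * s / 2) = sin (of_real pi / 2 - of_real pi * s / 2)"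
    by (simp add: sin_diff)
  also have "of_real pi / 2 - of_real pi * s / 2 = cnj (of_real pi * s / 2)"
    using c by (simp flip: c add: field_simps)
  also have "norm (sin (cnj (of_real pi * s / 2))) = S"
    unfolding S_def by (metis complex_mod_cnj cnj_sin)
  finally have cs: "norm (cos (of_real pi * s / 2)) = S" .
  have "sin (of_real pi * s) = 2 * sin (of_real pi * s / 2) * cos (of_real pi * s / 2)"
    using sin_double[of "of_real pi * s / 2"] by simp
  then have ss: "norm (sin (of_real pi * s)) = 2 * S * S"
    by (simp only: norm_mult cs S_def[symmetric] norm_numeral)
  have "s \<notin> \<int>"
  proof
    assume "s \<in> \<int>"
    then obtain k where "s = of_int k" by (auto elim: Ints_cases)
    then have "real_of_int (2 * k) = real_of_int 1" using assms by simp
    then have "2 * k = 1" by (simp only: of_int_eq_iff)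
    then show False by presburger
  qed
  then have "sin (of_real pi * s) \<noteq> 0"
    by (auto simp: sin_eq_0 Ints_def mult.commute)
  then have S0: "S > 0" using ss by (auto simp: S_def)
  have "norm (Gamma s * Gamma (1 - s)) = pi / (2 * S * S)"
    unfolding Gamma_reflection_complex norm_divide ss by simp
  moreover have "norm (Gamma s) = norm (Gamma (1 - s))"
    unfolding c by (metis complex_mod_cnj cnj_Gamma)
  ultimately have G: "norm (Gamma (1 - s)) ^ 2 = pi / (2 * S * S)"
    by (simp add: norm_mult power2_eq_square)
  have "norm (2 powr s :: complex) = 2 powr (1/2)"
    using norm_powr_real_powr[of 2 s] assms by simp
  then have p2: "norm (2 powr s :: complex) ^ 2 = 2" by (simp add: powr_half_sqrt)
  have "norm (complex_of_real pi powr (s - 1)) = pi powr (-1/2)"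
    using norm_powr_real_powr[of "of_real pi" "s - 1"] assms by simp
  then have pp: "norm (complex_of_real pi powr (s - 1)) ^ 2 = 1 / pi"
    by (simp add: power2_eq_square powr_minus_divide flip: powr_add)
  have "norm (chi s) ^ 2 = norm (2 powr s :: complex) ^ 2 * norm (complex_of_real pi powr (s - 1)) ^ 2 * S ^ 2 * norm (Gamma (1 - s)) ^ 2"
    by (simp add: chi_def norm_mult power_mult_distrib S_def)
  also have "\<dots> = 1" unfolding G p2 pp using S0 by (simp add: power2_eq_square)
  finally show ?thesis by (metis abs_norm_cancel abs_one power2_eq_iff_nonneg power_one norm_ge_zero zero_le_one)
qed

section \<open>Polynomial growth\<close>

lemma norm_Ln_le:
  assumes "norm z \<ge> 1"
  shows "norm (Ln z) \<le> ln (norm z) + pi"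
proof -
  have "z \<noteq> 0" using assms by auto
  then have "\<bar>Re (Ln z)\<bar> = ln (norm z)" "\<bar>Im (Ln z)\<bar> \<le> pi"
    using assms mpi_less_Im_Ln[of z] Im_Ln_le_pi[of z] by auto
  then show ?thesis using cmod_le[of "Ln z"] by linarith
qed

text \<open>|chi| = 1 on the critical line. From there the logarithm is integrated horizontally over
  a bounded distance, along which its derivative is at most ln(Im s) + O(1); exponentiating gives a
  power of Im s.\<close>

lemma chi_growth:
  assumes A: "A \<ge> 0"
  obtains C k where "C \<ge> 0" "\<And>s. \<lbrakk>-A \<le> Re s; Re s \<le> 1/2; Im s \<ge> 2\<rbrakk> \<Longrightarrow> norm (chi s) \<le> C * Im s ^ k"
proof
  \<comment> \<open>The summands bound the Stirling error 8 / Im z <= 4, the two constants of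
    \<open>chi_log'_approx\<close>, and the imaginary part of Ln(1 - z). The exponent
    \<open>m\<close> below bounds the horizontal distance to the critical line.\<close>
  define c where "c = 4 + ln (2 * pi) + pi / 2 + pi"
  define m where "m = nat \<lceil>1/2 + A\<rceil>"
  have m: "1/2 + A \<le> real m" unfolding m_def using A by linarith
  have "ln (2 * pi) \<ge> 0" using pi_gt3 by (intro ln_ge_zero) linarith
  then have c: "c \<ge> 0" unfolding c_def using pi_gt_zero by linarith
  show "exp (m * c) * (2 + A) ^ m \<ge> 0" using A by simp
  fix s assume s: "-A \<le> Re s" "Re s \<le> 1/2" "Im s \<ge> 2"
  define t where "t = Im s"
  define B where "B = c + ln ((2 + A) * t)"
  define S where "S = closed_segment s (Complex (1/2) t)"
  have S: "Im z = t \<and> -A \<le> Re z \<and> Re z \<le> 1/2" if "z \<in> S" for z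
  proof -
    from that obtain u where u: "0 \<le> u" "u \<le> 1" "z = (1 - u) *\<^sub>R s + u *\<^sub>R Complex (1/2) t"
      by (auto simp: S_def closed_segment_def)
    have "Im z = (1 - u) * t + u * t" by (simp add: u(3) t_def)
    then have "Im z = t" by (simp flip: distrib_right)
    moreover have "z \<in> closed_segment s (Complex (1/2) t)" using that by (simp add: S_def)
    then have "Re z \<in> closed_segment (Re s) (1/2)"
      using u by (auto simp: closed_segment_def)
    then have "Re s \<le> Re z \<and> Re z \<le> 1/2" using s by (simp add: closed_segment_eq_real_ivl)
    ultimately show ?thesis using s by auto
  qed
  have t: "t \<ge> 2" using s by (simp add: t_def)
  have "(2 + A) * t \<ge> 1 * 1" using t A by (intro mult_mono) auto
  then have B: "B \<ge> 0" unfolding B_def using c by simp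
  have "norm (chi_log s - chi_log (Complex (1/2) t)) \<le> B * norm (s - Complex (1/2) t)"
  proof (rule field_differentiable_bound[where S = S])
    fix z assume z: "z \<in> S"
    have "Im z > 0" using S[OF z] t by simp
    then show "(chi_log has_field_derivative chi_log' z) (at z within S)"
      by (rule has_field_derivative_at_within[OF has_field_derivative_chi_log])
    have n1: "norm (1 - z) \<ge> 1" using abs_Im_le_cmod[of "1 - z"] S[OF z] t by simp
    have "norm (1 - z) \<le> \<bar>Re (1 - z)\<bar> + \<bar>Im (1 - z)\<bar>" by (rule cmod_le)
    also have "\<dots> \<le> (1 + A) + t" using S[OF z] t A by auto
    also have "\<dots> \<le> (1 + A) * t + t" using t A mult_left_mono[of 1 t "1 + A"] by simp
    finally have n2: "norm (1 - z) \<le> (2 + A) * t" by (simp add: algebra_simps)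
    have "norm (Ln (1 - z)) \<le> ln (norm (1 - z)) + pi" by (rule norm_Ln_le[OF n1])
    also have "ln (norm (1 - z)) \<le> ln ((2 + A) * t)" using n1 n2 by (subst ln_le_cancel_iff) auto
    finally have Ln: "norm (Ln (1 - z)) \<le> ln ((2 + A) * t) + pi" by simp
    have lp: "norm (complex_of_real (ln (2 * pi))) = ln (2 * pi)"
      using \<open>ln (2 * pi) \<ge> 0\<close> by (simp only: norm_of_real abs_of_nonneg)
    have ip: "norm (\<i> * complex_of_real pi / 2) = pi / 2" by (simp add: norm_mult norm_divide)
    define M where "M = of_real (ln (2 * pi)) - \<i> * of_real pi / 2 - Ln (1 - z)"
    have "norm M \<le> norm (complex_of_real (ln (2 * pi)) - \<i> * of_real pi / 2) + norm (Ln (1 - z))"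
      unfolding M_def by (rule norm_triangle_ineq4)
    also have "\<dots> \<le> norm (complex_of_real (ln (2 * pi))) + norm (\<i> * complex_of_real pi / 2) + norm (Ln (1 - z))"
      by (intro add_right_mono norm_triangle_ineq4)
    finally have M: "norm M \<le> ln (2 * pi) + pi / 2 + (ln ((2 + A) * t) + pi)"
      using Ln unfolding lp ip by linarith
    have "norm (chi_log' z - M) \<le> 8 / Im z"
      unfolding M_def using S[OF z] t by (intro chi_log'_approx) auto
    also have "\<dots> \<le> 4" using S[OF z] t by (simp add: field_simps)
    finally have "norm (chi_log' z) \<le> 4 + norm M"
      using norm_triangle_ineq2[of "chi_log' z" M] by linarith
    then show "norm (chi_log' z) \<le> B" using M by (simp add: B_def c_def)
  qed (auto simp: S_def)
  moreover have "norm (s - Complex (1/2) t) \<le> m"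
  proof -
    have "s - Complex (1/2) t = of_real (Re s - 1/2)" by (simp add: complex_eq_iff t_def)
    then have "norm (s - Complex (1/2) t) = \<bar>Re s - 1/2\<bar>" by (simp only: norm_of_real)
    then show ?thesis using s m by linarith
  qed
  ultimately have 1: "norm (chi_log s - chi_log (Complex (1/2) t)) \<le> m * B"
  proof -
    assume "norm (chi_log s - chi_log (Complex (1/2) t)) \<le> B * norm (s - Complex (1/2) t)"
      and "norm (s - Complex (1/2) t) \<le> m"
    moreover from this(2) B have "B * norm (s - Complex (1/2) t) \<le> B * m" by (rule mult_left_mono)
    ultimately show ?thesis by (simp add: mult.commute)
  qed
  have "norm (exp (chi_log (Complex (1/2) t))) = 1"
    using norm_chi_critical_line[of "Complex (1/2) t"] t by (subst exp_chi_log) auto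
  then have "Re (chi_log (Complex (1/2) t)) = 0" by simp
  then have "Re (chi_log s) \<le> m * B"
    using complex_Re_le_cmod[of "chi_log s - chi_log (Complex (1/2) t)"] 1 by simp
  then have "exp (Re (chi_log s)) \<le> exp (m * B)" by simp
  moreover have "norm (chi s) = exp (Re (chi_log s))"
    using exp_chi_log[of s] t norm_exp_eq_Re[of "chi_log s"] by (simp add: t_def)
  ultimately have "norm (chi s) \<le> exp (m * B)" by simp
  also have "\<dots> = exp (m * c) * exp (m * ln ((2 + A) * t))"
    by (simp add: B_def distrib_left exp_add)
  also have "exp (m * ln ((2 + A) * t)) = ((2 + A) * t) ^ m"
    using t A by (subst exp_of_nat_mult) auto
  finally show "norm (chi s) \<le> exp (m * c) * (2 + A) ^ m * Im s ^ m"
    by (simp add: power_mult_distrib t_def mult.assoc)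
qed

text \<open>For Re s >= -1/2 the Euler--Maclaurin errors are O(|Im s|^3 n^(-3/2)), and division by s
  - 1 leaves |Im s|^2. Both signs of Im s are covered because s |-> 1 - s leads into the lower half
  plane.\<close>

lemma zeta_growth_right:
  assumes A: "A \<ge> 1"
  obtains C where "C \<ge> 0" "\<And>s. \<lbrakk>-1/2 \<le> Re s; Re s \<le> A; \<bar>Im s\<bar> \<ge> 2\<rbrakk> \<Longrightarrow> norm (zeta s) \<le> C * \<bar>Im s\<bar> ^ 2"
proof
  define S where "S = (\<Sum>n. real (Suc n) powr (-3/2))"
  have sS: "summable (\<lambda>n. real (Suc n) powr (-3/2))"
  proof -
    have "summable (\<lambda>n. real n powr (-3/2))"
      by (subst summable_real_powr_iff) auto
    then show ?thesis by (subst summable_Suc_iff)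
  qed
  have S0: "S \<ge> 0" unfolding S_def using sS by (intro suminf_nonneg) auto
  define C where "C = 3/2 + (2 + A)^2 * S / 2"
  show "C \<ge> 0" using S0 by (simp add: C_def)
  fix s assume s: "-1/2 \<le> Re s" "Re s \<le> A" "\<bar>Im s\<bar> \<ge> 2"
  define t where "t = \<bar>Im s\<bar>"
  have t: "t \<ge> 2" using s by (simp add: t_def)
  have n1: "norm (s - 1) \<ge> 1" using abs_Im_le_cmod[of "s - 1"] t by (simp add: t_def)
  have le: "norm w \<le> (2 + A) * t" if "\<bar>Re w\<bar> \<le> 1 + A" "\<bar>Im w\<bar> = t" for w
  proof -
    have "norm w \<le> (1 + A) + t" using cmod_le[of w] that by linarith
    also have "\<dots> \<le> (1 + A) * t + t" using t A mult_left_mono[of 1 t "1 + A"] by simp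
    finally show ?thesis by (simp add: algebra_simps)
  qed
  have n2: "norm s \<le> (2 + A) * t" "norm (s + 1) \<le> (2 + A) * t"
    using s A by (auto intro!: le[unfolded t_def] simp: t_def)
  define N where "N = norm (s - 1) * (norm s * norm (s + 1)) / 2"
  have "norm (\<Sum>n. em_term n s) \<le> (\<Sum>n. N * real (Suc n) powr (-3/2))"
  proof (rule norm_suminf_le)
    fix n
    have "norm (em_term n s) \<le> norm ((s - 1) * s * (s + 1)) / 2 * real (Suc n) powr (-Re s - 2)"
      using s by (intro norm_em_term_le) auto
    also have "\<dots> \<le> norm ((s - 1) * s * (s + 1)) / 2 * real (Suc n) powr (-3/2)"
    proof (intro mult_left_mono powr_mono)
      show "-Re s - 2 \<le> -3/2" using s(1) by (simp add: field_simps)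
    qed auto
    finally show "norm (em_term n s) \<le> N * real (Suc n) powr (-3/2)"
      by (simp add: N_def norm_mult mult.assoc)
  qed (intro summable_mult sS)
  also have "\<dots> = N * S" unfolding S_def by (rule suminf_mult[OF sS])
  finally have sum: "norm (\<Sum>n. em_term n s) \<le> N * S" .
  have "norm (zeta_num s) \<le> norm (1 + (s - 1) / 2) + norm (\<Sum>n. em_term n s)"
    using s unfolding zeta_num_def em_zeta_def by (auto intro: norm_triangle_ineq)
  also have "norm (1 + (s - 1) / 2) \<le> 1 + norm (s - 1) / 2"
    using norm_triangle_ineq[of 1 "(s - 1) / 2"] by (simp add: norm_divide)
  finally have "norm (zeta_num s) \<le> 1 + norm (s - 1) / 2 + N * S" using sum by simp
  also have "\<dots> \<le> norm (s - 1) * (3/2 + norm s * norm (s + 1) / 2 * S)"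
    using n1 by (simp add: N_def algebra_simps)
  finally have "norm (zeta_num s) \<le> norm (s - 1) * (3/2 + norm s * norm (s + 1) / 2 * S)" .
  then have "norm (zeta s) \<le> 3/2 + norm s * norm (s + 1) / 2 * S"
    using n1 unfolding zeta_eq norm_divide by (subst pos_divide_le_eq) (auto simp: mult.commute)
  also have "\<dots> \<le> 3/2 * t^2 + ((2 + A) * t) * ((2 + A) * t) / 2 * S"
  proof -
    have "1 \<le> t^2" using t power_mono[of 1 t 2] by simp
    moreover have "norm s * norm (s + 1) / 2 * S \<le> ((2 + A) * t) * ((2 + A) * t) / 2 * S"
      using n2 S0 t A by (intro mult_right_mono divide_right_mono mult_mono) auto
    ultimately show ?thesis by simp
  qed
  also have "\<dots> = C * t^2" by (simp add: C_def algebra_simps power2_eq_square)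
  finally show "norm (zeta s) \<le> C * \<bar>Im s\<bar> ^ 2" by (simp add: t_def)
qed

lemma zeta_growth:
  assumes A: "A \<ge> 1"
  obtains C k where "C \<ge> 0" "\<And>s. \<lbrakk>\<bar>Re s\<bar> \<le> A; Im s \<ge> 2\<rbrakk> \<Longrightarrow> norm (zeta s) \<le> C * Im s ^ k"
proof -
  \<comment> \<open>Real parts up to A + 1 occur at the reflected point 1 - s.\<close>
  obtain C1 where C1: "C1 \<ge> 0" "\<And>s. \<lbrakk>-1/2 \<le> Re s; Re s \<le> A + 1; \<bar>Im s\<bar> \<ge> 2\<rbrakk> \<Longrightarrow> norm (zeta s) \<le> C1 * \<bar>Im s\<bar> ^ 2"
    using zeta_growth_right[of "A + 1"] A by auto
  obtain C2 k where C2: "C2 \<ge> 0" "\<And>s. \<lbrakk>-A \<le> Re s; Re s \<le> 1/2; Im s \<ge> 2\<rbrakk> \<Longrightarrow> norm (chi s) \<le> C2 * Im s ^ k"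
    using chi_growth[of A] A by auto
  show thesis
  proof
    show "C1 + C2 * C1 \<ge> 0" using C1 C2 by simp
    fix s assume s: "\<bar>Re s\<bar> \<le> A" "Im s \<ge> 2"
    have p: "Im s ^ 2 \<le> Im s ^ (k + 2)" using s by (intro power_increasing) auto
    have nn: "0 \<le> C1 * Im s ^ (k + 2)" "0 \<le> C2 * C1 * Im s ^ (k + 2)" using s C1 C2 by auto
    show "norm (zeta s) \<le> (C1 + C2 * C1) * Im s ^ (k + 2)"
    proof (cases "Re s \<ge> -1/2")
      case True
      have "norm (zeta s) \<le> C1 * Im s ^ 2" using C1(2)[of s] True s by auto
      also have "\<dots> \<le> C1 * Im s ^ (k + 2)" using C1(1) p by (rule mult_left_mono[rotated])
      finally show ?thesis using nn by (simp only: distrib_right)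
    next
      case False
      have "norm (zeta s) = norm (chi s) * norm (zeta (1 - s))"
        using zeta_functional_equation[of s] False by (simp add: norm_mult)
      also have "\<dots> \<le> (C2 * Im s ^ k) * (C1 * Im s ^ 2)"
        using C2(2)[of s] C1(2)[of "1 - s"] False s C2(1) by (intro mult_mono) auto
      also have "\<dots> = C2 * C1 * Im s ^ (k + 2)" by (simp add: power_add power2_eq_square)
      finally show ?thesis using nn by (simp only: distrib_right)
    qed
  qed
qed

text \<open>Cauchy's inequality on discs of radius 1 carries the growth of zeta over to its
  derivatives, at the price of one unit in the real and imaginary parts.\<close>

lemma nu_growth:
  assumes A: "A \<ge> 1"
  obtains C k where "C \<ge> 0" "\<And>s. \<lbrakk>\<bar>Re s\<bar> \<le> A; Im s \<ge> 3\<rbrakk> \<Longrightarrow> norm (nu s) \<le> C * Im s ^ k"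
proof -
  obtain C k where C: "C \<ge> 0" "\<And>s. \<lbrakk>\<bar>Re s\<bar> \<le> A + 1; Im s \<ge> 2\<rbrakk> \<Longrightarrow> norm (zeta s) \<le> C * Im s ^ k"
    using zeta_growth[of "A + 1"] A by auto
  show thesis
  proof
    show "3 * (C * 2 ^ k) ^ 2 \<ge> 0" by simp
    fix s assume s: "\<bar>Re s\<bar> \<le> A" "Im s \<ge> 3"
    define B where "B = C * (2 * Im s) ^ k"
    have B: "norm (zeta w) \<le> B" if "w \<in> cball s 1" for w
    proof -
      have "\<bar>Re (s - w)\<bar> \<le> 1" "\<bar>Im (s - w)\<bar> \<le> 1"
        using that abs_Re_le_cmod[of "s - w"] abs_Im_le_cmod[of "s - w"] by (auto simp: dist_norm)
      then have w: "\<bar>Re w\<bar> \<le> A + 1" "Im w \<ge> 2" "Im w \<le> 2 * Im s" using s by auto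
      have "norm (zeta w) \<le> C * Im w ^ k" using C(2) w by blast
      also have "\<dots> \<le> B" unfolding B_def using w C(1) by (intro mult_left_mono power_mono) auto
      finally show ?thesis .
    qed
    have "1 \<notin> cball s 1"
    proof
      assume "1 \<in> cball s 1"
      then show False using abs_Im_le_cmod[of "s - 1"] s by (simp add: dist_norm)
    qed
    then have hol: "zeta holomorphic_on cball s 1" by (rule holomorphic_zeta)
    have d: "norm ((deriv ^^ n) zeta s) \<le> fact n * B / 1 ^ n" for n
      using B by (intro Cauchy_inequality holomorphic_on_imp_continuous_on[OF hol] holomorphic_on_subset[OF hol]) (auto simp: dist_norm)
    have B0: "B \<ge> 0" using s C(1) by (simp add: B_def)
    have "norm (nu s) \<le> norm (zeta s) * norm ((deriv ^^ 2) zeta s) + norm (deriv zeta s) ^ 2"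
      unfolding nu_def using norm_triangle_ineq4[of "zeta s * (deriv ^^ 2) zeta s" "(deriv zeta s)^2"] by (simp add: norm_mult norm_power)
    also have "\<dots> \<le> B * (2 * B) + B ^ 2"
      using d[of 0] d[of 1] d[of 2] B0 by (intro add_mono mult_mono power_mono) auto
    also have "\<dots> = 3 * (C * 2 ^ k) ^ 2 * Im s ^ (2 * k)"
    proof -
      have "B = (C * 2 ^ k) * Im s ^ k" by (simp add: B_def power_mult_distrib)
      then have "B * B = (C * 2 ^ k) ^ 2 * Im s ^ (2 * k)"
        by (simp add: power2_eq_square power_mult mult_2 power_add)
      then show ?thesis by (simp add: power2_eq_square)
    qed
    finally show "norm (nu s) \<le> 3 * (C * 2 ^ k) ^ 2 * Im s ^ (2 * k)" .
  qed
qed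

section \<open>Zero counting in discs\<close>

lemma factor_zero:
  assumes "f holomorphic_on S" "open S" "z \<in> S" "f z = 0"
  obtains g where "g holomorphic_on S" "\<And>w. w \<in> S \<Longrightarrow> f w = (w - z) * g w"
proof
  define g where "g = (\<lambda>w. if w = z then deriv f z else (f w - f z) / (w - z))"
  show "g holomorphic_on S"
    unfolding g_def using assms by (intro pole_lemma) (auto simp: interior_open)
  show "f w = (w - z) * g w" for w using assms by (auto simp: g_def)
qed

lemma prod_list_norm_ge:
  assumes "\<And>z. z \<in> set zs \<Longrightarrow> a \<le> norm (w - z)" "a \<ge> 0"
  shows "a ^ length zs \<le> norm (\<Prod>z\<leftarrow>zs. w - z :: complex)"
  using assms by (induction zs) (auto simp: norm_mult intro!: mult_mono)

lemma prod_list_norm_le: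
  assumes "\<And>z. z \<in> set zs \<Longrightarrow> norm (w - z) \<le> a"
  shows "norm (\<Prod>z\<leftarrow>zs. w - z :: complex) \<le> a ^ length zs"
  using assms
proof (induction zs)
  case (Cons z zs)
  then have "norm (w - z) \<le> a" by simp
  moreover from this have "a \<ge> 0" using norm_ge_zero order_trans by blast
  ultimately show ?case using Cons by (auto simp: norm_mult intro!: mult_mono)
qed simp

text \<open>A substitute for Jensen's formula. Each factor w - z is at least 2 r on the circle of
  radius 3 r and at most r at the centre, so by the maximum principle every factor costs 2 in the
  ratio of M to |f(c)|. Repeated list entries account for multiple zeros.\<close>

lemma zero_count_bound:
  assumes r: "r > 0" and S: "open S" "cball c (3 * r) \<subseteq> S"
    and M: "\<And>w. w \<in> cball c (3 * r) \<Longrightarrow> norm (f w) \<le> M"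
    and zs: "set zs \<subseteq> cball c r" and g: "g holomorphic_on S"
    and fg: "\<And>w. w \<in> S \<Longrightarrow> f w = (\<Prod>z\<leftarrow>zs. w - z) * g w"
  shows "w \<in> cball c (3 * r) \<Longrightarrow> norm (g w) \<le> M / (2 * r) ^ length zs"
    and "norm (f c) \<le> r ^ length zs * norm (g c)"
    and "2 ^ length zs * norm (f c) \<le> M"
proof -
  have *: "norm (g w) \<le> M / (2 * r) ^ length zs" if w: "w \<in> cball c (3 * r)" for w
  proof (rule maximum_modulus_frontier[where f = g and \<xi> = w and S = "cball c (3 * r)"])
    show "g holomorphic_on interior (cball c (3 * r))"
      using S by (intro holomorphic_on_subset[OF g] order_trans[OF interior_subset])
    show "continuous_on (closure (cball c (3 * r))) g"
      using S by (intro holomorphic_on_imp_continuous_on holomorphic_on_subset[OF g]) auto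
    fix z assume "z \<in> frontier (cball c (3 * r))"
    then have z: "dist c z = 3 * r" using r by simp
    have "(2 * r) ^ length zs \<le> norm (\<Prod>x\<leftarrow>zs. z - x)"
    proof (rule prod_list_norm_ge)
      fix x assume "x \<in> set zs"
      then have "dist c x \<le> r" using zs by auto
      then show "2 * r \<le> norm (z - x)"
        using dist_triangle[of c z x] z by (simp add: dist_norm norm_minus_commute)
    qed (use r in auto)
    moreover have "(2 * r) ^ length zs > 0" using r by simp
    moreover have "norm (\<Prod>x\<leftarrow>zs. z - x) * norm (g z) \<le> M"
    proof -
      have "z \<in> cball c (3 * r)" using z by simp
      then show ?thesis using M[of z] fg[of z] S(2) by (metis norm_mult subsetD)
    qed
    ultimately show "norm (g z) \<le> M / (2 * r) ^ length zs"
      using mult_right_mono[of "(2 * r) ^ length zs" "norm (\<Prod>x\<leftarrow>zs. z - x)" "norm (g z)"]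
      by (simp only: pos_le_divide_eq mult.commute[of "norm (g z)"]) (erule order_trans[rotated], simp)
  qed (use w in auto)
  then show "w \<in> cball c (3 * r) \<Longrightarrow> norm (g w) \<le> M / (2 * r) ^ length zs" by blast
  have "c \<in> S" using S r by auto
  then have "norm (f c) = norm (\<Prod>x\<leftarrow>zs. c - x) * norm (g c)" using fg by (simp add: norm_mult)
  also have "\<dots> \<le> r ^ length zs * norm (g c)"
    using zs by (intro mult_right_mono prod_list_norm_le) (auto simp: dist_norm)
  finally show 1: "norm (f c) \<le> r ^ length zs * norm (g c)" .
  have "2 ^ length zs * norm (f c) \<le> 2 ^ length zs * (r ^ length zs * (M / (2 * r) ^ length zs))"
    using 1 *[of c] r by (intro mult_left_mono order_trans[OF 1]) auto
  also have "\<dots> = M" using r by (simp add: power_mult_distrib)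
  finally show "2 ^ length zs * norm (f c) \<le> M" .
qed

text \<open>
  The maximum principle bounds the number of linear factors that can be split off, so a factorization
  with the maximal number of them leaves a zero-free cofactor.
\<close>

lemma factor_out_zeros:
  assumes r: "r > 0" and S: "open S" "cball c (3 * r) \<subseteq> S"
    and f: "f holomorphic_on S" "f c \<noteq> 0"
    and M: "\<And>w. w \<in> cball c (3 * r) \<Longrightarrow> norm (f w) \<le> M"
  obtains zs g where "set zs \<subseteq> cball c r" "g holomorphic_on S"
    "\<And>w. w \<in> S \<Longrightarrow> f w = (\<Prod>z\<leftarrow>zs. w - z) * g w" "\<And>w. w \<in> cball c r \<Longrightarrow> g w \<noteq> 0"
proof -
  define P where "P = (\<lambda>n. \<exists>zs g. length zs = n \<and> set zs \<subseteq> cball c r \<and> g holomorphic_on S \<and>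
      (\<forall>w\<in>S. f w = (\<Prod>z\<leftarrow>zs. w - z) * g w))"
  have P0: "P 0" unfolding P_def using f by (intro exI[of _ "[]"] exI[of _ f]) auto
  \<comment> \<open>Any bound on the number of factors will do, since it only ensures that a
    greatest one exists; the crude n <= 2^n is enough.\<close>
  have bound: "n \<le> nat \<lceil>M / norm (f c)\<rceil>" if "P n" for n
  proof -
    from that obtain zs g where *: "length zs = n" "set zs \<subseteq> cball c r" "g holomorphic_on S"
      "\<And>w. w \<in> S \<Longrightarrow> f w = (\<Prod>z\<leftarrow>zs. w - z) * g w" unfolding P_def by blast
    have "2 ^ length zs * norm (f c) \<le> M"
      by (rule zero_count_bound(3)[OF r S M *(2,3,4)])
    then have "2 ^ n \<le> M / norm (f c)" using f *(1) by (simp add: field_simps)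
    moreover have "real n \<le> 2 ^ n" using of_nat_less_two_power[of n] less_imp_le by blast
    ultimately show ?thesis by linarith
  qed
  define n where "n = (GREATEST n. P n)"
  have Pn: "P n" unfolding n_def using P0 bound by (rule GreatestI_nat)
  have max: "m \<le> n" if "P m" for m unfolding n_def using that bound by (rule Greatest_le_nat)
  from Pn obtain zs g where *: "length zs = n" "set zs \<subseteq> cball c r" "g holomorphic_on S"
      "\<And>w. w \<in> S \<Longrightarrow> f w = (\<Prod>z\<leftarrow>zs. w - z) * g w" unfolding P_def by blast
  have "g w \<noteq> 0" if w: "w \<in> cball c r" for w
  proof
    assume "g w = 0"
    have "w \<in> S" using w S r by auto
    then obtain h where h: "h holomorphic_on S" "\<And>v. v \<in> S \<Longrightarrow> g v = (v - w) * h v"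
      using factor_zero[OF *(3) S(1) _ \<open>g w = 0\<close>] by blast
    have "P (Suc n)" unfolding P_def
      by (rule exI[of _ "w # zs"], rule exI[of _ h]) (use * h w in \<open>auto simp: mult_ac\<close>)
    then show False using max[of "Suc n"] by simp
  qed
  then show thesis using * that by blast
qed

text \<open>The map v |-> v / (2 A - v) sends the half plane Re v < A into the unit disc and fixes
  0, so the Schwarz lemma applies to its composition with h - h(c), rescaled to the unit
  disc.\<close>

lemma Borel_Caratheodory:
  assumes h: "h holomorphic_on ball c r" and A: "\<And>w. w \<in> ball c r \<Longrightarrow> Re (h w - h c) < A"
    and r1: "0 < r1" "r1 < r" and w: "w \<in> cball c r1"
  shows "norm (h w - h c) \<le> 2 * A * r1 / (r - r1)"
proof -
  have "r > 0" using r1 by simp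
  have A0: "A > 0" using A[of c] \<open>r > 0\<close> by simp
  define k where "k = (\<lambda>u. h (c + of_real r * u) - h c)"
  define \<phi> where "\<phi> = (\<lambda>u. k u / (2 * of_real A - k u))"
  have inb: "c + of_real r * u \<in> ball c r" if "norm u < 1" for u
    using that \<open>r > 0\<close> by (simp add: dist_norm norm_mult)
  have Rek: "Re (k u) < A" if "norm u < 1" for u
    unfolding k_def by (rule A[OF inb[OF that]])
  have lt: "norm (k u) < norm (2 * of_real A - k u)" if "norm u < 1" for u
  proof -
    have "norm (2 * of_real A - k u) ^ 2 - norm (k u) ^ 2 = 4 * A * (A - Re (k u))"
      unfolding cmod_power2 by (simp add: power2_eq_square algebra_simps)
    also have "\<dots> > 0" using Rek[OF that] A0 by simp
    finally have "norm (k u) ^ 2 < norm (2 * of_real A - k u) ^ 2" by simp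
    then show ?thesis by (rule power_less_imp_less_base) simp
  qed
  define u where "u = (w - c) / of_real r"
  have nu: "norm u \<le> r1 / r" "norm u < 1"
    using w r1 \<open>r > 0\<close> by (auto simp: u_def norm_divide dist_norm norm_minus_commute field_simps)
  have "norm (\<phi> u) \<le> norm u"
  proof (rule Schwarz_Lemma(1))
    have "k holomorphic_on ball 0 1"
    proof -
      have "(\<lambda>u. h (c + of_real r * u)) holomorphic_on ball 0 1"
        by (rule holomorphic_on_compose_gen[of "\<lambda>u. c + of_real r * u" _ h "ball c r", unfolded o_def])
          (use h inb in \<open>auto intro!: holomorphic_intros\<close>)
      then show ?thesis unfolding k_def by (intro holomorphic_on_diff holomorphic_on_const)
    qed
    moreover have "2 * of_real A - k u \<noteq> 0" if "u \<in> ball 0 1" for u using lt[of u] that by auto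
    ultimately show "\<phi> holomorphic_on ball 0 1" unfolding \<phi>_def by (intro holomorphic_intros) auto
    show "\<phi> 0 = 0" by (simp add: \<phi>_def k_def)
    show "norm (\<phi> z) < 1" if "norm z < 1" for z
      using lt[OF that] by (auto simp: \<phi>_def norm_divide divide_simps)
  qed (rule nu)
  then have "norm (k u) \<le> norm u * norm (2 * of_real A - k u)"
    using lt[OF nu(2)] by (auto simp: \<phi>_def norm_divide divide_simps split: if_splits)
  also have "\<dots> \<le> norm u * (2 * A + norm (k u))"
    using norm_triangle_ineq4[of "2 * of_real A" "k u"] A0 by (intro mult_left_mono) (auto simp: norm_mult)
  also have "\<dots> \<le> (r1 / r) * (2 * A + norm (k u))"
    using nu A0 by (intro mult_right_mono) auto
  finally have "norm (k u) * (r - r1) \<le> 2 * A * r1"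
    using \<open>r > 0\<close> by (simp add: field_simps)
  then have "norm (k u) \<le> 2 * A * r1 / (r - r1)" using r1 by (simp add: field_simps)
  moreover have "k u = h w - h c" using \<open>r > 0\<close> by (simp add: k_def u_def)
  ultimately show ?thesis by simp
qed

text \<open>Write f as a product of linear factors times exp h. On a horizontal segment missing the
  heights of the zeros each factor has a principal logarithm whose argument changes by at most 2 pi,
  and there are at most log_2(M / m) factors; Borel--Caratheodory bounds the variation of h.\<close>

lemma horizontal_log:
  assumes r: "0 < r1" "r1 < r" and S: "open S" "cball c (3 * r) \<subseteq> S"
    and f: "f holomorphic_on S" and m: "0 < m" "m \<le> norm (f c)"
    and M: "\<And>w. w \<in> cball c (3 * r) \<Longrightarrow> norm (f w) \<le> M"
    and ab: "a \<in> cball c r1" "b \<in> cball c r1" "Im a = y" "Im b = y"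
    and nz: "\<And>w. \<lbrakk>w \<in> S; Im w = y\<rbrakk> \<Longrightarrow> f w \<noteq> 0"
  obtains U G where "open U" "closed_segment a b \<subseteq> U" "G holomorphic_on U"
    "\<And>w. w \<in> U \<Longrightarrow> f w = exp (G w)"
    "\<bar>Im (G b - G a)\<bar> \<le> (2 * pi / ln 2 + 4 * r1 / (r - r1)) * (ln (M / m) + 1)"
proof -
  have r0: "r > 0" using r by simp
  have fc: "f c \<noteq> 0" using m by auto
  obtain zs g where zs: "set zs \<subseteq> cball c r" and g: "g holomorphic_on S"
    and fg: "\<And>w. w \<in> S \<Longrightarrow> f w = (\<Prod>z\<leftarrow>zs. w - z) * g w" and gnz: "\<And>w. w \<in> cball c r \<Longrightarrow> g w \<noteq> 0"
    using factor_out_zeros[OF r0 S f fc M] by blast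
  note zb = zero_count_bound[OF r0 S M zs g fg]
  define n where "n = length zs"
  have cS: "cball c r \<subseteq> S" using S r0 subset_cball[of r "3 * r" c] by auto
  have bS: "ball c r \<subseteq> S" using cS ball_subset_cball by blast
  obtain h where h: "h holomorphic_on ball c r" "\<And>w. w \<in> ball c r \<Longrightarrow> g w = exp (h w)"
  proof (rule contractible_imp_holomorphic_log[OF holomorphic_on_subset[OF g bS]])
    show "contractible (ball c r)" by (intro convex_imp_contractible convex_ball)
    show "g w \<noteq> 0" if "w \<in> ball c r" for w using gnz[of w] that by simp
  qed blast
  have Mm: "M > 0" "M \<ge> m" using M[of c] m r0 by auto
  have lnM: "ln (M / m) \<ge> 0" using m Mm by (intro ln_ge_zero) (simp add: field_simps)
  have n_le: "n * ln 2 \<le> ln (M / m)"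
  proof -
    have "2 ^ n * m \<le> 2 ^ n * norm (f c)" using m by (intro mult_left_mono) auto
    then have "2 ^ n * m \<le> M" using zb(3) unfolding n_def by linarith
    then have "2 ^ n \<le> M / m" using m by (simp add: pos_le_divide_eq)
    then have "ln (2 ^ n) \<le> ln (M / m)" using m Mm by (subst ln_le_cancel_iff) auto
    then show ?thesis by (simp add: ln_realpow)
  qed
  \<comment> \<open>The bounds for |g| on the disc and at the centre carry the same power of r,
    which cancels in the quotient. The summand 1 supplies the strict inequality that
    Borel--Caratheodory asks for.\<close>
  have Reh: "Re (h w - h c) < ln (M / m) + 1" if w: "w \<in> ball c r" for w
  proof -
    have pos: "norm (g w) > 0" "norm (g c) > 0" using gnz[of w] gnz[of c] w r0 by auto
    have 1: "norm (g w) \<le> M / (2 * r) ^ n" unfolding n_def using w r0 by (intro zb(1)) auto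
    have "(2 * r) ^ n \<ge> r ^ n" using r0 by (intro power_mono) auto
    then have "M / (2 * r) ^ n \<le> M / r ^ n" using Mm r0 by (intro divide_left_mono) auto
    with 1 have gw: "norm (g w) \<le> M / r ^ n" by simp
    have gc: "norm (g c) \<ge> m / r ^ n" using zb(2) m r0 unfolding n_def by (simp add: field_simps)
    have "Re (h w) = ln (norm (g w))" "Re (h c) = ln (norm (g c))"
      using h(2)[OF w] h(2)[of c] r0 by auto
    then have "Re (h w - h c) = ln (norm (g w) / norm (g c))"
      using pos by (simp add: ln_div)
    also have "norm (g w) / norm (g c) \<le> (M / r ^ n) / (m / r ^ n)"
      using gw gc m r0 Mm by (intro frac_le) auto
    then have "ln (norm (g w) / norm (g c)) \<le> ln (M / m)"
      using pos r0 m Mm by (subst ln_le_cancel_iff) auto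
    finally show ?thesis by simp
  qed
  have h_bound: "norm (h w - h c) \<le> 2 * (ln (M / m) + 1) * r1 / (r - r1)" if "w \<in> cball c r1" for w
    by (rule Borel_Caratheodory[OF h(1) Reh r that])
  \<comment> \<open>Removing the full horizontal lines through the zeros takes away the branch cuts
    of all Ln(w - z), while the segment at height y survives.\<close>
  define U where "U = ball c r - (\<Union>z\<in>set zs. {w. Im w = Im z})"
  define G where "G = (\<lambda>w. (\<Sum>z\<leftarrow>zs. Ln (w - z)) + h w)"
  have Unz: "w - z \<notin> \<real>\<^sub>\<le>\<^sub>0" "w - z \<noteq> 0" if "w \<in> U" "z \<in> set zs" for w z
    using that by (auto simp: U_def complex_nonpos_Reals_iff)
  have sum_hol: "(\<lambda>w. \<Sum>z\<leftarrow>xs. Ln (w - z)) holomorphic_on U" if "set xs \<subseteq> set zs" for xs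
    using that Unz by (induction xs) (auto intro!: holomorphic_intros)
  have exp_sum: "exp (\<Sum>z\<leftarrow>xs. Ln (w - z)) = (\<Prod>z\<leftarrow>xs. w - z)" if "set xs \<subseteq> set zs" "w \<in> U" for xs w
    using that Unz by (induction xs) (auto simp: exp_add)
  have zs_Im: "Im z \<noteq> y" if "z \<in> set zs" for z
  proof
    assume "Im z = y"
    have "z \<in> S" using that zs cS by auto
    moreover have "(\<Prod>x\<leftarrow>zs. z - x) = 0" using that by (auto simp: prod_list_zero_iff)
    ultimately have "f z = 0" using fg by simp
    then show False using nz \<open>z \<in> S\<close> \<open>Im z = y\<close> by blast
  qed
  have seg: "closed_segment a b \<subseteq> U"
  proof
    fix w assume w: "w \<in> closed_segment a b"
    have "w \<in> cball c r1" using w ab convex_cball[of c r1] by (meson convex_contains_segment subsetD)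
    then have wr: "w \<in> ball c r" using r by auto
    from w obtain u where "w = (1 - u) *\<^sub>R a + u *\<^sub>R b" by (auto simp: closed_segment_def)
    then have "Im w = (1 - u) * y + u * y" using ab by simp
    then have "Im w = y" by (simp flip: distrib_right)
    then have "Im w \<noteq> Im z" if "z \<in> set zs" for z using zs_Im[OF that] by simp
    then have "w \<notin> (\<Union>z\<in>set zs. {w. Im w = Im z})" by blast
    with wr show "w \<in> U" unfolding U_def by (rule DiffI)
  qed
  have abU: "a \<in> U" "b \<in> U" using seg by auto
  show thesis
  proof (rule that)
    show "open U" unfolding U_def
      by (intro open_Diff open_ball closed_UN ballI) (auto intro!: closed_Collect_eq continuous_intros)
    show "closed_segment a b \<subseteq> U" by (rule seg)
    show "G holomorphic_on U" unfolding G_def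
      by (intro holomorphic_on_add sum_hol holomorphic_on_subset[OF h(1)]) (auto simp: U_def)
    show "f w = exp (G w)" if "w \<in> U" for w
    proof -
      have "w \<in> ball c r" using that by (auto simp: U_def)
      then show ?thesis using fg[of w] bS h(2)[of w] exp_sum[OF subset_refl that]
        by (auto simp: G_def exp_add)
    qed
    have ImLn: "\<bar>Im (Ln (b - z)) - Im (Ln (a - z))\<bar> \<le> 2 * pi" if "z \<in> set zs" for z
      using mpi_less_Im_Ln[of "b - z"] Im_Ln_le_pi[of "b - z"] mpi_less_Im_Ln[of "a - z"] Im_Ln_le_pi[of "a - z"]
        Unz[OF abU(1) that] Unz[OF abU(2) that] by linarith
    have sum_bound: "\<bar>Im ((\<Sum>z\<leftarrow>xs. Ln (b - z)) - (\<Sum>z\<leftarrow>xs. Ln (a - z)))\<bar> \<le> 2 * pi * length xs" if "set xs \<subseteq> set zs" for xs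
      using that
    proof (induction xs)
      case (Cons x xs)
      then have "\<bar>Im (Ln (b - x)) - Im (Ln (a - x))\<bar> \<le> 2 * pi" using ImLn[of x] by simp
      with Cons show ?case by (simp add: algebra_simps)
    qed simp
    have "\<bar>Im (h b - h a)\<bar> \<le> norm (h b - h a)" by (rule abs_Im_le_cmod)
    also have "\<dots> \<le> norm (h b - h c) + norm (h a - h c)"
      using norm_triangle_ineq4[of "h b - h c" "h a - h c"] by simp
    also have "\<dots> \<le> 2 * (2 * (ln (M / m) + 1) * r1 / (r - r1))"
      using h_bound[OF ab(1)] h_bound[OF ab(2)] by linarith
    also have "2 * (2 * X * r1 / Y) = 4 * r1 / Y * X" for X Y :: real by simp
    finally have hb: "\<bar>Im (h b - h a)\<bar> \<le> 4 * r1 / (r - r1) * (ln (M / m) + 1)" .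
    have "2 * pi * n \<le> 2 * pi / ln 2 * ln (M / m)"
      using mult_left_mono[OF n_le, of "2 * pi / ln 2"] by simp
    also have "\<dots> \<le> 2 * pi / ln 2 * (ln (M / m) + 1)" by (intro mult_left_mono) auto
    finally have "\<bar>Im ((\<Sum>z\<leftarrow>zs. Ln (b - z)) - (\<Sum>z\<leftarrow>zs. Ln (a - z)))\<bar> \<le> 2 * pi / ln 2 * (ln (M / m) + 1)"
      using sum_bound[OF subset_refl] unfolding n_def by linarith
    with hb show "\<bar>Im (G b - G a)\<bar> \<le> (2 * pi / ln 2 + 4 * r1 / (r - r1)) * (ln (M / m) + 1)"
      unfolding G_def distrib_right by (simp del: times_divide_eq_left times_divide_eq_right)
  qed
qed

lemma contour_integral_log_deriv:
  assumes "open U" "closed_segment a b \<subseteq> U" "G holomorphic_on U" "\<And>w. w \<in> U \<Longrightarrow> f w = exp (G w)"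
  shows "((\<lambda>w. deriv f w / f w) has_contour_integral (G b - G a)) (linepath a b)"
proof -
  have D: "(G has_field_derivative deriv f w / f w) (at w within U)" if "w \<in> U" for w
  proof -
    have G: "(G has_field_derivative deriv G w) (at w)"
      using assms that by (simp add: holomorphic_derivI)
    then have "((\<lambda>w. exp (G w)) has_field_derivative exp (G w) * deriv G w) (at w)"
      by (auto intro!: derivative_eq_intros)
    then have "(f has_field_derivative exp (G w) * deriv G w) (at w)"
      by (rule has_field_derivative_transform_within_open[OF _ assms(1) that]) (use assms in auto)
    then have "deriv f w / f w = deriv G w" using assms(4)[OF that] by (simp add: DERIV_imp_deriv)
    then show ?thesis using G has_field_derivative_at_within by simp
  qed
  then show ?thesis
    using contour_integral_primitive[of U G "\<lambda>w. deriv f w / f w" "linepath a b"] assms by simp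
qed

section \<open>Behaviour in the right half plane\<close>

lemma has_field_derivative_dirichlet_term:
  "((\<lambda>s. of_nat (Suc n) powr (-s) :: complex) has_field_derivative (- of_real (ln (real (Suc n))) * of_nat (Suc n) powr (-s))) (at s)"
proof -
  have "Ln (of_nat (Suc n)) = of_real (ln (real (Suc n)))"
    using Ln_of_real[of "real (Suc n)"] by simp
  then have "(of_nat (Suc n) powr (-s) :: complex) = exp (- s * of_real (ln (real (Suc n))))" for s
    by (simp add: powr_def del: of_nat_Suc)
  then show ?thesis
    by (simp only:) (auto intro!: derivative_eq_intros simp del: of_nat_Suc)
qed

lemma higher_deriv_dirichlet_sum:
  "(deriv ^^ m) (\<lambda>s. \<Sum>k<n. of_nat (Suc k) powr (-s) :: complex) =
     (\<lambda>s. \<Sum>k<n. (- of_real (ln (real (Suc k)))) ^ m * of_nat (Suc k) powr (-s))"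
proof (induction m)
  case (Suc m)
  have "((\<lambda>s. \<Sum>k<n. (- of_real (ln (real (Suc k)))) ^ m * of_nat (Suc k) powr (-s) :: complex) has_field_derivative
      (\<Sum>k<n. (- of_real (ln (real (Suc k)))) ^ m * (- of_real (ln (real (Suc k))) * of_nat (Suc k) powr (-s)))) (at s)" for s
    by (intro DERIV_sum DERIV_cmult has_field_derivative_dirichlet_term)
  then have "deriv (\<lambda>s. \<Sum>k<n. (- of_real (ln (real (Suc k)))) ^ m * of_nat (Suc k) powr (-s) :: complex) s =
      (\<Sum>k<n. (- of_real (ln (real (Suc k)))) ^ Suc m * of_nat (Suc k) powr (-s))" for s
    by (subst DERIV_imp_deriv, assumption) (simp add: mult_ac)
  then show ?case unfolding funpow.simps o_def Suc.IH by (rule ext)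
qed simp

text \<open>Domination by n^(-2) makes the convergence uniform on Re s > 2, and uniform limits of
  holomorphic functions may be differentiated term by term.\<close>

lemma higher_deriv_zeta_sums:
  assumes "Re s > 2"
  shows "(\<lambda>k. (- of_real (ln (real (Suc k)))) ^ m * of_nat (Suc k) powr (-s)) sums (deriv ^^ m) zeta s"
proof -
  have "uniform_limit {s. Re s > 2} (\<lambda>n s. \<Sum>k<n. of_nat (Suc k) powr (-s) :: complex) (\<lambda>s. \<Sum>k. of_nat (Suc k) powr (-s)) sequentially"
  proof (rule Weierstrass_m_test)
    fix n and s :: complex assume "s \<in> {s. Re s > 2}"
    then show "norm (of_nat (Suc n) powr (-s) :: complex) \<le> real (Suc n) powr (-2)"
      by (subst norm_powr_real_powr) (auto intro!: powr_mono)
  next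
    have "summable (\<lambda>n. real n powr (-2))" by (subst summable_real_powr_iff) auto
    then show "summable (\<lambda>n. real (Suc n) powr (-2))" by (subst summable_Suc_iff)
  qed
  also have "?this \<longleftrightarrow> uniform_limit {s. Re s > 2} (\<lambda>n s. \<Sum>k<n. of_nat (Suc k) powr (-s) :: complex) zeta sequentially"
    by (intro uniform_limit_cong) (auto simp: zeta_eq_dirichlet dirichlet_zeta_def)
  finally have "(\<lambda>n. (deriv ^^ m) (\<lambda>s. \<Sum>k<n. of_nat (Suc k) powr (-s)) s) \<longlonglongrightarrow> (deriv ^^ m) zeta s"
    using assms by (intro higher_deriv_complex_uniform_limit[where A = "{s. Re s > 2}"] open_Re_gt)
      (auto intro!: always_eventually holomorphic_intros simp del: of_nat_Suc)
  then show ?thesis unfolding higher_deriv_dirichlet_sum sums_def .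
qed

text \<open>A telescoping majorant for the sum of n^(-4) over n >= 5; here n = k + 5, and the
  factors are n - 2, n - 1, n and n + 1.\<close>

lemma quartic_tail:
  "(\<lambda>k. 1 / ((real k + 3) * (real k + 4) * (real k + 5) * (real k + 6))) sums (1 / 180)"
proof -
  define b where "b = (\<lambda>k. 1 / (3 * ((real k + 3) * (real k + 4) * (real k + 5))))"
  have "b \<longlonglongrightarrow> 0" unfolding b_def by real_asymp
  then have "(\<lambda>k. b k - b (Suc k)) sums (b 0 - 0)" by (rule telescope_sums')
  moreover have "b k - b (Suc k) = 1 / ((real k + 3) * (real k + 4) * (real k + 5) * (real k + 6))" for k
    by (simp add: b_def divide_simps) (simp add: algebra_simps)
  ultimately show ?thesis by (simp add: b_def)
qed

text \<open>Measured against 2^(-s), the term n^(-s) has norm at most (n/2)^(-5) = 32 / n^5. The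
  terms n = 3 and n = 4 are kept, with 3^5 = 243 and 4^5 = 1024, and for n >= 5 the hypothesis on c
  reduces the tail to the quartic one. The power of -ln 1 is 1 for m = 0 and 0 otherwise, so one
  statement serves all three derivatives.\<close>

lemma higher_deriv_zeta_approx:
  assumes s: "Re s \<ge> 5" and c: "\<And>n. n \<ge> 5 \<Longrightarrow> ln (real n) ^ m \<le> c * real n"
  shows "norm ((deriv ^^ m) zeta s - (- of_real (ln 1)) ^ m - (- of_real (ln 2)) ^ m * 2 powr (-s))
     \<le> norm (2 powr (-s) :: complex) * (32 * (ln 3 ^ m / 243 + (2 * ln 2) ^ m / 1024 + c / 180))"
proof -
  define a where "a = (\<lambda>k. (- of_real (ln (real (Suc k)))) ^ m * of_nat (Suc k) powr (-s) :: complex)"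
  define q where "q = norm (2 powr (-s) :: complex)"
  have q: "q \<ge> 0" by (simp add: q_def)
  have a: "norm (a k) \<le> q * (32 * (ln (real (Suc k)) ^ m / real (Suc k) ^ 5))" if "k \<ge> 1" for k
  proof -
    have qeq: "q = 2 powr (- Re s)" unfolding q_def by (subst norm_powr_real_powr) auto
    have "norm (of_nat (Suc k) powr (-s) :: complex) = real (Suc k) powr (- Re s)"
      by (subst norm_powr_real_powr) auto
    also have "\<dots> = 2 powr (- Re s) * (real (Suc k) / 2) powr (- Re s)"
      by (subst powr_mult [symmetric]) (simp_all del: of_nat_Suc)
    also have "(real (Suc k) / 2) powr (- Re s) \<le> (real (Suc k) / 2) powr (-5)"
      using that s by (intro powr_mono) auto
    also have "(real (Suc k) / 2) powr (-5) = 32 / real (Suc k) ^ 5"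
      by (simp add: powr_minus powr_numeral power_divide del: of_nat_Suc)
    finally have "norm (of_nat (Suc k) powr (-s) :: complex) \<le> q * (32 / real (Suc k) ^ 5)"
      unfolding qeq by (simp add: mult_left_mono)
    then have "ln (real (Suc k)) ^ m * norm (of_nat (Suc k) powr (-s) :: complex) \<le> ln (real (Suc k)) ^ m * (q * (32 / real (Suc k) ^ 5))"
      by (intro mult_left_mono) auto
    then show ?thesis unfolding a_def norm_mult norm_power norm_minus_cancel norm_of_real by (simp add: mult_ac)
  qed
  have "a sums (deriv ^^ m) zeta s" unfolding a_def using s by (intro higher_deriv_zeta_sums) auto
  then have "(\<lambda>k. a (k + 4)) sums ((deriv ^^ m) zeta s - (\<Sum>k<4. a k))"
    by (rule sums_split_initial_segment)
  then have eq: "(deriv ^^ m) zeta s - (\<Sum>k<4. a k) = (\<Sum>k. a (k + 4))"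
    by (simp add: sums_iff)
  have "norm (\<Sum>k. a (k + 4)) \<le> (\<Sum>k. q * (32 * c) * (1 / ((real k + 3) * (real k + 4) * (real k + 5) * (real k + 6))))"
  proof (rule norm_suminf_le)
    fix k
    define n where "n = real (k + 5)"
    have n: "n \<ge> 5" by (simp add: n_def)
    have "ln (real (k + 5)) ^ m \<le> c * real (k + 5)" by (rule c) simp
    then have lnn: "ln n ^ m \<le> c * n" by (simp add: n_def)
    have "0 \<le> ln n ^ m" using n by simp
    then have c0: "c \<ge> 0" using lnn n by (smt (verit) mult_less_0_iff)
    have "norm (a (k + 4)) \<le> q * (32 * (ln n ^ m / n ^ 5))"
      using a[of "k + 4"] by (simp add: n_def add_ac)
    also have "\<dots> \<le> q * (32 * (c * n / n ^ 5))"
      using q lnn n by (intro mult_left_mono divide_right_mono) auto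
    also have "c * n / n ^ 5 = c * (1 / n ^ 4)" using n by (simp add: field_simps eval_nat_numeral)
    also have "q * (32 * (c * (1 / n ^ 4))) \<le> q * (32 * (c * (1 / ((n - 2) * (n - 1) * n * (n + 1)))))"
    proof (intro mult_left_mono)
      have "(n - 2) * (n - 1) * n * (n + 1) \<le> n ^ 4"
      proof -
        have "n ^ 4 - (n - 2) * (n - 1) * n * (n + 1) = n * (2 * n * (n - 1) + 3 * n - 2)"
          by (simp add: algebra_simps eval_nat_numeral)
        also have "\<dots> \<ge> 0"
        proof (intro mult_nonneg_nonneg)
          have "2 * n * (n - 1) \<ge> 0" using n by simp
          then show "2 * n * (n - 1) + 3 * n - 2 \<ge> 0" using n by linarith
        qed (use n in auto)
        finally show ?thesis by simp
      qed
      then show "1 / n ^ 4 \<le> 1 / ((n - 2) * (n - 1) * n * (n + 1))"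
        using n by (intro divide_left_mono) auto
    qed (use q c0 in auto)
    finally show "norm (a (k + 4)) \<le> q * (32 * c) * (1 / ((real k + 3) * (real k + 4) * (real k + 5) * (real k + 6)))"
      by (simp add: n_def add_ac mult_ac)
  qed (intro summable_mult sums_summable[OF quartic_tail])
  also have "\<dots> = q * (32 * c) * (1 / 180)"
    using quartic_tail by (intro sums_unique[symmetric] sums_mult)
  finally have tail: "norm ((deriv ^^ m) zeta s - (\<Sum>k<4. a k)) \<le> q * (32 * (c / 180))"
    unfolding eq by (simp add: mult_ac)
  have "norm ((deriv ^^ m) zeta s - a 0 - a 1) = norm (((deriv ^^ m) zeta s - (\<Sum>k<4. a k)) + a 2 + a 3)"
  proof -
    have "(\<Sum>k<4. a k) = a 0 + a 1 + a 2 + a 3" by (simp add: eval_nat_numeral)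
    then show ?thesis by (simp add: algebra_simps)
  qed
  also have "\<dots> \<le> norm ((deriv ^^ m) zeta s - (\<Sum>k<4. a k)) + norm (a 2) + norm (a 3)"
    by (intro order_trans[OF norm_triangle_ineq] add_right_mono norm_triangle_ineq)
  also have "\<dots> \<le> q * (32 * (c / 180)) + q * (32 * (ln 3 ^ m / 243)) + q * (32 * ((2 * ln 2) ^ m / 1024))"
  proof (intro add_mono tail)
    show "norm (a 2) \<le> q * (32 * (ln 3 ^ m / 243))" using a[of 2] by simp
    have "ln (4::real) = 2 * ln 2" using ln_realpow[of 2 2] by simp
    then show "norm (a 3) \<le> q * (32 * ((2 * ln 2) ^ m / 1024))" using a[of 3] by simp
  qed
  finally show ?thesis
    by (simp add: a_def q_def algebra_simps)
qed

section \<open>Numerical estimates for Re s >= 5\<close>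

lemma norm_le_of_approx: "norm (x - y) \<le> K \<Longrightarrow> norm y \<le> q \<Longrightarrow> norm x \<le> K + q"
  for x y :: "'a :: real_normed_vector"
  using norm_triangle_sub[of x y] by linarith

lemma ln_3_le: "5 * ln (3::real) \<le> 8 * ln 2"
proof -
  have "ln ((3::real) ^ 5) \<le> ln (2 ^ 8)" by (subst ln_le_cancel_iff) auto
  then have "real 5 * ln 3 \<le> real 8 * ln 2" by (simp only: ln_realpow zero_less_numeral)
  then show ?thesis by simp
qed

text \<open>The best constant would be 1 / e; the rational 2/5 comes from e >= 5/2, the quadratic
  Taylor bound.\<close>

lemma ln_le_linear:
  fixes x :: real
  assumes "x > 0"
  shows "ln x \<le> 2 / 5 * x"
proof -
  have "5 / 2 \<le> exp (1::real)" using exp_lower_Taylor_quadratic[of 1] by simp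
  then have "ln (5 / 2) \<le> (1::real)" by (metis exp_ln exp_le_cancel_iff less_divide_eq_numeral1(1) mult_zero_left zero_less_numeral)
  moreover have "ln (x * (2 / 5)) \<le> x * (2 / 5) - 1" using assms by (intro ln_le_minus_one) auto
  moreover have "ln (x * (2 / 5)) = ln x - ln (5 / 2)"
    using assms by (simp add: ln_mult ln_div)
  ultimately show ?thesis by linarith
qed

lemma ln_squared_le_linear:
  fixes x :: real
  assumes "x \<ge> 1"
  shows "ln x ^ 2 \<le> 16 / 25 * x"
proof -
  have "ln x = 2 * ln (sqrt x)" using assms by (simp add: ln_sqrt)
  moreover have "0 \<le> ln (sqrt x)" using assms by simp
  moreover have "ln (sqrt x) \<le> 2 / 5 * sqrt x" using assms by (intro ln_le_linear) auto
  ultimately have "ln x ^ 2 \<le> (2 * (2 / 5 * sqrt x)) ^ 2" by (intro power_mono) auto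
  then show ?thesis using assms by (simp add: power_mult_distrib power_divide)
qed

lemma norm_two_powr_le:
  assumes "Re s \<ge> 5"
  shows "norm (2 powr (-s) :: complex) \<le> 1 / 32"
proof -
  have "norm (2 powr (-s) :: complex) = 2 powr (- Re s)" by (subst norm_powr_real_powr) auto
  also have "\<dots> \<le> 2 powr (-5)" using assms by (intro powr_mono) auto
  also have "2 powr (-5) = (1 / 32 :: real)" by (simp add: powr_minus powr_numeral)
  finally show ?thesis .
qed

text \<open>The tail constants 1/5, 2/5 and 16/25 for the orders 0, 1 and 2 come from n >= 5 and the
  two logarithm bounds. Everything is expressed through ln 2, using ln 3 <= (8/5) ln 2 and ln 2 >=
  2/3.\<close>

lemma zeta_right_bounds:
  assumes s: "Re s \<ge> 5"
  defines "q \<equiv> norm (2 powr (-s) :: complex)"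
  shows "norm (zeta s - 1) \<le> 12 / 10 * q" "norm (deriv zeta s) \<le> 14 / 10 * ln 2 * q"
    "norm ((deriv ^^ 2) zeta s - (of_real (ln 2))\<^sup>2 * 2 powr (-s)) \<le> 72 / 100 * (ln 2)\<^sup>2 * q"
proof -
  have q: "q \<ge> 0" by (simp add: q_def)
  have L: "ln (2::real) \<ge> 2 / 3" by (rule ln2_ge_two_thirds)
  have L3: "ln (3::real) \<le> 8 / 5 * ln 2" using ln_3_le by simp
  have L30: "ln (3::real) \<ge> 0" by simp
  have "norm (zeta s - 1 - 2 powr (-s)) \<le> q * (32 * (1 / 243 + 1 / 1024 + 1 / 5 / 180))"
    using higher_deriv_zeta_approx[OF s, of 0 "1 / 5"] by (simp add: q_def)
  then have "norm (zeta s - 1) \<le> q * (32 * (1 / 243 + 1 / 1024 + 1 / 5 / 180)) + q"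
    by (rule norm_le_of_approx) (simp add: q_def)
  also have "\<dots> = q * (32 * (1 / 243 + 1 / 1024 + 1 / 5 / 180) + 1)" by (simp add: algebra_simps)
  also have "\<dots> \<le> q * (12 / 10)" using q by (intro mult_left_mono) auto
  finally show "norm (zeta s - 1) \<le> 12 / 10 * q" by (simp add: mult.commute)

  have "norm (deriv zeta s + of_real (ln 2) * 2 powr (-s)) \<le> q * (32 * (ln 3 / 243 + 2 * ln 2 / 1024 + 2 / 5 / 180))"
    using higher_deriv_zeta_approx[OF s, of 1 "2 / 5"] ln_le_linear by (simp add: q_def)
  moreover have "norm (of_real (ln 2) * 2 powr (-s) :: complex) = ln 2 * q" by (simp add: norm_mult q_def)
  ultimately have "norm (deriv zeta s) \<le> q * (32 * (ln 3 / 243 + 2 * ln 2 / 1024 + 2 / 5 / 180)) + ln 2 * q"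
    using norm_le_of_approx[of "deriv zeta s" "- (of_real (ln 2) * 2 powr (-s))"] by simp
  also have "\<dots> = q * (32 * (ln 3 / 243 + 2 * ln 2 / 1024 + 2 / 5 / 180) + ln 2)" by (simp add: algebra_simps)
  also have "\<dots> \<le> q * (14 / 10 * ln 2)" using q L L3 by (intro mult_left_mono) (auto simp: field_simps)
  finally show "norm (deriv zeta s) \<le> 14 / 10 * ln 2 * q" by (simp add: mult.commute)

  have "norm ((deriv ^^ 2) zeta s - (of_real (ln 2))\<^sup>2 * 2 powr (-s)) \<le> q * (32 * ((ln 3)\<^sup>2 / 243 + (2 * ln 2)\<^sup>2 / 1024 + 16 / 25 / 180))"
    using higher_deriv_zeta_approx[OF s, of 2 "16 / 25"] ln_squared_le_linear by (simp add: q_def)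
  also have "\<dots> \<le> q * (72 / 100 * (ln 2)\<^sup>2)"
  proof (intro mult_left_mono q)
    have "(ln (3::real))\<^sup>2 \<le> (8 / 5 * ln 2)\<^sup>2" using L3 L30 by (intro power_mono) auto
    moreover have "(2 / 3)\<^sup>2 \<le> (ln (2::real))\<^sup>2" using L by (intro power_mono) auto
    ultimately show "32 * ((ln 3)\<^sup>2 / 243 + (2 * ln 2)\<^sup>2 / 1024 + 16 / 25 / 180) \<le> 72 / 100 * (ln (2::real))\<^sup>2"
      by (simp add: power_mult_distrib power_divide field_simps)
  qed
  finally show "norm ((deriv ^^ 2) zeta s - (of_real (ln 2))\<^sup>2 * 2 powr (-s)) \<le> 72 / 100 * (ln 2)\<^sup>2 * q"
    by (simp add: mult.commute)
qed

text \<open>With M the main term, nu - M = (zeta - 1) zeta'' + (zeta'' - M) - zeta'^2. Relative to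
  |M| and with 2^(-Re s) <= 1/32, the three parts are at most about 0.065, 0.72 and 0.062, which
  leaves room below 9/10.\<close>

lemma nu_right_approx:
  assumes s: "Re s \<ge> 5"
  shows "norm (nu s - (of_real (ln 2))\<^sup>2 * 2 powr (-s)) \<le> 9 / 10 * norm ((of_real (ln 2))\<^sup>2 * 2 powr (-s) :: complex)"
proof -
  define q where "q = norm (2 powr (-s) :: complex)"
  define M :: complex where "M = (of_real (ln 2))\<^sup>2 * 2 powr (-s)"
  define P where "P = (ln (2::real))\<^sup>2"
  have P: "P \<ge> 0" by (simp add: P_def)
  have M: "norm M = P * q" by (simp add: M_def q_def P_def norm_mult norm_power)
  have q: "0 \<le> q" "q \<le> 1 / 32" using norm_two_powr_le[OF s] by (auto simp: q_def)
  note b = zeta_right_bounds[OF s, folded q_def M_def P_def]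
  have "norm ((deriv ^^ 2) zeta s) \<le> 72 / 100 * P * q + P * q"
    by (rule norm_le_of_approx[OF b(3)]) (simp add: M)
  then have "norm ((deriv ^^ 2) zeta s) \<le> 172 / 100 * (P * q)" by (simp add: algebra_simps)
  moreover have "norm (zeta s - 1) \<le> 12 / 10 * (1 / 32)" using b(1) q by linarith
  ultimately have 1: "norm ((zeta s - 1) * (deriv ^^ 2) zeta s) \<le> 12 / 10 * (1 / 32) * (172 / 100 * (P * q))"
    unfolding norm_mult using P q by (intro mult_mono) auto
  have "norm (deriv zeta s) ^ 2 \<le> (14 / 10 * ln 2 * q) ^ 2" using b(2) by (intro power_mono) auto
  also have "\<dots> = (14 / 10) ^ 2 * P * (q * q)" by (simp add: P_def power2_eq_square)
  also have "\<dots> \<le> (14 / 10) ^ 2 * P * (q * (1 / 32))" using P q by (intro mult_left_mono) auto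
  finally have 2: "norm ((deriv zeta s)\<^sup>2) \<le> (14 / 10) ^ 2 * P * (q * (1 / 32))" by (simp add: norm_power)
  have "nu s - M = (zeta s - 1) * (deriv ^^ 2) zeta s + ((deriv ^^ 2) zeta s - M) - (deriv zeta s)\<^sup>2"
    by (simp add: nu_def algebra_simps)
  also have "norm \<dots> \<le> norm ((zeta s - 1) * (deriv ^^ 2) zeta s) + norm ((deriv ^^ 2) zeta s - M) + norm ((deriv zeta s)\<^sup>2)"
    by (intro order_trans[OF norm_triangle_ineq4] add_right_mono norm_triangle_ineq)
  also have "\<dots> \<le> 12 / 10 * (1 / 32) * (172 / 100 * (P * q)) + 72 / 100 * P * q + (14 / 10) ^ 2 * P * (q * (1 / 32))"
    by (intro add_mono 1 2 b(3))
  also have "\<dots> = (12 / 10 * (1 / 32) * (172 / 100) + 72 / 100 + (14 / 10) ^ 2 / 32) * (P * q)"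
    by (simp add: algebra_simps)
  also have "\<dots> \<le> 9 / 10 * (P * q)" using P q by (intro mult_right_mono) (auto simp: power2_eq_square)
  finally show ?thesis by (simp add: M M_def[symmetric])
qed

section \<open>Reflection and the zeros of nu\<close>

text \<open>This is f^2 (log f)'' where f does not vanish. It is stated for an arbitrary f so that
  it can be evaluated separately on the factors of the functional equation.\<close>

definition nu_of :: "(complex \<Rightarrow> complex) \<Rightarrow> complex \<Rightarrow> complex" where
  "nu_of f s = f s * (deriv ^^ 2) f s - (deriv f s)\<^sup>2"

lemma nu_eq_nu_of: "nu = nu_of zeta"
  by (simp add: fun_eq_iff nu_def nu_of_def)

lemma holomorphic_nu_of: "f holomorphic_on S \<Longrightarrow> open S \<Longrightarrow> nu_of f holomorphic_on S"
  unfolding nu_of_def by (intro holomorphic_intros holomorphic_higher_deriv)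

text \<open>Additivity of (log f)'' under products, with denominators cleared. The Leibniz rule
  proves it at zeros of f and g as well.\<close>

lemma nu_of_mult:
  assumes S: "open S" "s \<in> S" and f: "f holomorphic_on S" and g: "g holomorphic_on S"
    and h: "\<And>z. z \<in> S \<Longrightarrow> h z = f z * g z"
  shows "nu_of h s = f s ^ 2 * nu_of g s + g s ^ 2 * nu_of f s"
proof -
  have hol: "(\<lambda>z. f z * g z) holomorphic_on S" by (intro holomorphic_intros f g)
  then have hh: "h holomorphic_on S" by (rule holomorphic_transform) (use h in auto)
  have "(deriv ^^ n) h s = (\<Sum>i=0..n. of_nat (n choose i) * (deriv ^^ i) f s * (deriv ^^ (n - i)) g s)" for n
  proof -
    have "(deriv ^^ n) h s = (deriv ^^ n) (\<lambda>z. f z * g z) s"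
      by (rule higher_deriv_transform_within_open[OF hh hol S h])
    also have "\<dots> = (\<Sum>i=0..n. of_nat (n choose i) * (deriv ^^ i) f s * (deriv ^^ (n - i)) g s)"
      by (rule higher_deriv_mult[OF f g S])
    finally show ?thesis .
  qed
  from this[of 1] this[of 2]
  have "deriv h s = f s * deriv g s + deriv f s * g s"
    "(deriv ^^ 2) h s = f s * (deriv ^^ 2) g s + 2 * deriv f s * deriv g s + (deriv ^^ 2) f s * g s"
    by (simp_all add: numeral_2_eq_2)
  then show ?thesis using h[OF S(2)] by (simp add: nu_of_def power2_eq_square algebra_simps)
qed

lemma nu_of_exp:
  assumes S: "open S" "s \<in> S" and K: "\<And>z. z \<in> S \<Longrightarrow> (K has_field_derivative K' z) (at z)"
    and K': "(K' has_field_derivative K2) (at s)"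
  shows "nu_of (\<lambda>z. exp (K z)) s = exp (2 * K s) * K2"
proof -
  have d: "((\<lambda>z. exp (K z)) has_field_derivative exp (K z) * K' z) (at z)" if "z \<in> S" for z
    using K[OF that] by (auto intro!: derivative_eq_intros)
  have d2: "((\<lambda>z. exp (K z) * K' z) has_field_derivative (exp (K s) * K' s * K' s + exp (K s) * K2)) (at s)"
    using K[OF S(2)] K' by (auto intro!: derivative_eq_intros simp: algebra_simps)
  have "(deriv (\<lambda>z. exp (K z)) has_field_derivative (exp (K s) * K' s * K' s + exp (K s) * K2)) (at s)"
    by (rule has_field_derivative_transform_within_open[OF d2 S]) (use d DERIV_imp_deriv in metis)
  then have "(deriv ^^ 2) (\<lambda>z. exp (K z)) s = exp (K s) * K' s * K' s + exp (K s) * K2"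
    by (simp add: numeral_2_eq_2 DERIV_imp_deriv)
  moreover have "deriv (\<lambda>z. exp (K z)) s = exp (K s) * K' s" using d[OF S(2)] by (rule DERIV_imp_deriv)
  ultimately show ?thesis
    unfolding nu_of_def exp_double by (simp add: power2_eq_square algebra_simps)
qed

text \<open>The second derivative changes sign twice under z |-> 1 - z, and the first one occurs
  squared.\<close>

lemma nu_of_reflect:
  assumes S: "open S" "1 - s \<in> S" and f: "f holomorphic_on S"
  shows "nu_of (\<lambda>z. f (1 - z)) s = nu_of f (1 - s)"
proof -
  define S' where "S' = (\<lambda>z. 1 - z) -` S"
  have S': "open S'" unfolding S'_def by (intro open_vimage S continuous_intros)
  have l: "((\<lambda>z. 1 - z) has_field_derivative -1) (at z)" for z :: complex
    by (auto intro!: derivative_eq_intros)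
  have d: "((\<lambda>z. f (1 - z)) has_field_derivative - deriv f (1 - z)) (at z)" if "z \<in> S'" for z
  proof -
    have "(f has_field_derivative deriv f (1 - z)) (at (1 - z))"
      using that by (intro holomorphic_derivI[OF f S(1)]) (simp add: S'_def)
    from DERIV_chain2[OF this l] show ?thesis by simp
  qed
  have "deriv f holomorphic_on S" using f S(1) by (rule holomorphic_deriv)
  then have d2: "((\<lambda>z. - deriv f (1 - z)) has_field_derivative deriv (deriv f) (1 - s)) (at s)"
    using DERIV_minus[OF DERIV_chain2[OF holomorphic_derivI[OF _ S] l]] by simp
  have sS: "s \<in> S'" using S by (simp add: S'_def)
  have "(deriv (\<lambda>z. f (1 - z)) has_field_derivative deriv (deriv f) (1 - s)) (at s)"
    by (rule has_field_derivative_transform_within_open[OF d2 S' sS]) (use d DERIV_imp_deriv in metis)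
  then have "(deriv ^^ 2) (\<lambda>z. f (1 - z)) s = (deriv ^^ 2) f (1 - s)"
    by (simp add: numeral_2_eq_2 DERIV_imp_deriv)
  moreover have "deriv (\<lambda>z. f (1 - z)) s = - deriv f (1 - s)" using d[OF sS] by (rule DERIV_imp_deriv)
  ultimately show ?thesis by (simp add: nu_of_def)
qed

lemma nu_reflection:
  assumes s: "Re s < 0" "Im s > 0"
  shows "nu s = exp (2 * chi_log s) * (chi_log'' s * zeta (1 - s) ^ 2 + nu (1 - s))"
proof -
  define H where "H = {z. Re z < 0} \<inter> {z. Im z > 0}"
  have H: "open H" "s \<in> H" using s unfolding H_def by (auto intro!: open_Int open_halfspace_Re_lt open_halfspace_Im_gt)
  have hz: "zeta holomorphic_on {z. Re z > 1}" by (intro holomorphic_zeta) auto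
  have 1: "(\<lambda>z. exp (chi_log z)) holomorphic_on H"
    unfolding holomorphic_on_open[OF H(1)]
    using has_field_derivative_chi_log by (fastforce simp: H_def intro!: derivative_eq_intros)
  have 2: "(\<lambda>z. zeta (1 - z)) holomorphic_on H"
    by (rule holomorphic_on_compose_gen[of "\<lambda>z. 1 - z" _ zeta "{z. Re z > 1}", unfolded o_def])
      (auto intro!: holomorphic_intros hz simp: H_def)
  have "nu_of zeta s = exp (chi_log s) ^ 2 * nu_of (\<lambda>z. zeta (1 - z)) s + zeta (1 - s) ^ 2 * nu_of (\<lambda>z. exp (chi_log z)) s"
    by (rule nu_of_mult[OF H 1 2]) (auto simp: H_def exp_chi_log zeta_functional_equation)
  also have "nu_of (\<lambda>z. zeta (1 - z)) s = nu_of zeta (1 - s)"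
    by (rule nu_of_reflect[OF open_Re_gt _ hz]) (use s in auto)
  also have "nu_of (\<lambda>z. exp (chi_log z)) s = exp (2 * chi_log s) * chi_log'' s"
    by (rule nu_of_exp[OF H]) (auto simp: H_def s intro!: has_field_derivative_chi_log has_field_derivative_chi_log')
  finally show ?thesis unfolding nu_eq_nu_of exp_double by (simp add: algebra_simps)
qed

section \<open>Isolation of the zeros\<close>

lemma holomorphic_nu: "1 \<notin> S \<Longrightarrow> open S \<Longrightarrow> nu holomorphic_on S"
  unfolding nu_eq_nu_of by (intro holomorphic_nu_of holomorphic_zeta)

text \<open>The entire function (s - 1)^4 nu(s), which keeps the zeros of nu from accumulating at the pole.\<close>

definition nu_num :: "complex \<Rightarrow> complex" where
  "nu_num s = zeta_num s ^ 2 + (s - 1) ^ 2 * nu_of zeta_num s"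

lemma holomorphic_nu_num: "nu_num holomorphic_on UNIV"
  unfolding nu_num_def by (intro holomorphic_intros holomorphic_zeta_num holomorphic_nu_of open_UNIV)

lemma nu_num_1: "nu_num 1 = 1"
  by (simp add: nu_num_def zeta_num_1)

text \<open>The product rule for zeta = \<open>zeta_num\<close> times 1 / (z - 1): for the second
  factor, 2 / (z - 1)^4 - 1 / (z - 1)^4 leaves 1 / (z - 1)^4.\<close>

lemma nu_num_eq:
  assumes "s \<noteq> 1"
  shows "nu_num s = (s - 1) ^ 4 * nu s"
proof -
  define S where "S = - {1::complex}"
  have S: "open S" "s \<in> S" using assms by (auto simp: S_def)
  define g where "g = (\<lambda>z::complex. 1 / (z - 1))"
  have g: "g holomorphic_on S" unfolding g_def S_def by (intro holomorphic_intros) auto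
  have "nu_of g s = 1 / (s - 1) ^ 4"
  proof -
    have d: "(g has_field_derivative - 1 / (z - 1) ^ 2) (at z)" if "z \<in> S" for z
      using that unfolding g_def S_def by (auto intro!: derivative_eq_intros simp: power2_eq_square)
    have d2: "((\<lambda>z. - 1 / (z - 1) ^ 2) has_field_derivative 2 / (s - 1) ^ 3) (at s)"
    proof -
      have "((\<lambda>x. - 1 / x ^ 2) has_field_derivative 2 / x ^ 3) (at x)" if "x \<noteq> 0" for x :: complex
        using that by (auto intro!: derivative_eq_intros simp: field_simps eval_nat_numeral)
      note this[of "s - 1"]
      moreover have "((\<lambda>z. z - 1) has_field_derivative 1) (at s)"
        by (auto intro!: derivative_eq_intros)
      ultimately show ?thesis using DERIV_chain2[of "\<lambda>x. - 1 / x ^ 2" _ "\<lambda>z. z - 1" s 1 UNIV] assms by auto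
    qed
    have "(deriv g has_field_derivative 2 / (s - 1) ^ 3) (at s)"
      by (rule has_field_derivative_transform_within_open[OF d2 S]) (use d DERIV_imp_deriv in metis)
    then have "(deriv ^^ 2) g s = 2 / (s - 1) ^ 3" by (simp add: numeral_2_eq_2 DERIV_imp_deriv)
    moreover have "deriv g s = - 1 / (s - 1) ^ 2" using d[OF S(2)] by (rule DERIV_imp_deriv)
    ultimately show ?thesis using assms unfolding nu_of_def g_def
      by (simp add: field_simps eval_nat_numeral)
  qed
  moreover have "nu_of zeta s = zeta_num s ^ 2 * nu_of g s + g s ^ 2 * nu_of zeta_num s"
    by (rule nu_of_mult[OF S _ g]) (auto simp: g_def zeta_eq intro!: holomorphic_on_subset[OF holomorphic_zeta_num])
  ultimately have "nu s = zeta_num s ^ 2 / (s - 1) ^ 4 + nu_of zeta_num s / (s - 1) ^ 2"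
    by (simp add: nu_eq_nu_of g_def power_divide)
  then have "(s - 1) ^ 4 * nu s = zeta_num s ^ 2 * ((s - 1) ^ 4 / (s - 1) ^ 4) + nu_of zeta_num s * ((s - 1) ^ 4 / (s - 1) ^ 2)"
    by (simp add: distrib_left mult_ac)
  also have "(s - 1) ^ 4 / (s - 1) ^ 4 = 1" using assms by simp
  also have "(s - 1) ^ 4 / (s - 1) ^ 2 = (s - 1) ^ 2" using assms by (simp add: eval_nat_numeral)
  finally show ?thesis by (simp add: nu_num_def mult.commute)
qed

text \<open>A nonconstant entire function has finitely many zeros in a compact set. If
  \<open>nu_num\<close> were constant, nu would decay only like (s - 1)^(-4), contradicting its
  exponential decay to the right.\<close>

lemma finite_nu_zeros_compact:
  assumes "compact K"
  shows "finite {s \<in> K. s \<noteq> 1 \<and> nu s = 0}"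
proof -
  have "\<not> nu_num constant_on UNIV"
  proof
    assume "nu_num constant_on UNIV"
    then have c: "nu_num s = 1" for s using nu_num_1 by (metis UNIV_I constant_on_def)
    have d: "nu s = 1 / (s - 1) ^ 4" if "s \<noteq> 1" for s
      using nu_num_eq[OF that] c[of s] that by (simp add: field_simps)
    \<comment> \<open>At s = 101 the two decay rates compare as 100^(-4) against less than 2 *
      2^(-101).\<close>
    have "norm (nu 101 - (of_real (ln 2))\<^sup>2 * 2 powr (-101)) \<le> 9 / 10 * norm ((of_real (ln 2))\<^sup>2 * 2 powr (-101) :: complex)"
      by (rule nu_right_approx) simp
    then have "norm (nu 101) \<le> 9 / 10 * norm ((of_real (ln 2))\<^sup>2 * 2 powr (-101) :: complex) + norm ((of_real (ln 2))\<^sup>2 * 2 powr (-101) :: complex)"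
      by (rule norm_le_of_approx) simp
    also have "\<dots> = 19 / 10 * norm ((of_real (ln 2))\<^sup>2 * 2 powr (-101) :: complex)" by simp
    also have "norm ((of_real (ln 2))\<^sup>2 * 2 powr (-101) :: complex) = (ln 2)\<^sup>2 * (1 / 2 ^ 101)"
    proof -
      have "norm (2 powr (-101) :: complex) = 2 powr (-101)"
        using norm_powr_real_powr[of 2 "-101"] by simp
      also have "\<dots> = 1 / 2 ^ 101" by (simp add: powr_minus powr_numeral inverse_eq_divide)
      finally show ?thesis by (simp only: norm_mult norm_power norm_of_real power2_abs)
    qed
    also have "(ln 2)\<^sup>2 * (1 / 2 ^ 101) \<le> 1 * (1 / 2 ^ 101 :: real)"
      using ln_2_less_1 by (intro mult_right_mono power_le_one) auto
    finally have "norm (nu 101) \<le> 19 / 10 * (1 / 2 ^ 101)" by simp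
    moreover have "norm (nu 101) = 1 / 100 ^ 4"
    proof -
      have e: "nu 101 = 1 / 100 ^ 4" using d[of 101] by simp
      show ?thesis unfolding e norm_divide norm_power by (simp only: norm_one norm_numeral)
    qed
    ultimately show False by simp
  qed
  then have "finite {s \<in> K. nu_num s = 0}"
    using assms by (intro holomorphic_compact_finite_zeros[OF holomorphic_nu_num]) auto
  then show ?thesis by (rule rev_finite_subset) (auto simp: nu_num_eq)
qed

section \<open>Explicit logarithms of nu on the vertical sides\<close>

lemma near_one_upper_half:
  assumes "norm (v - 1) \<le> c" "c < 1"
  shows "v \<notin> \<real>\<^sub>\<le>\<^sub>0" "v \<noteq> 0" "\<bar>Im (Ln v)\<bar> \<le> pi / 2"
proof -
  \<comment> \<open>A disc of radius less than 1 about 1 lies in the right half plane, where the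
    principal argument is at most pi / 2. This is how a relative error below 1 becomes a bound on
    the argument.\<close>
  have "\<bar>Re (v - 1)\<bar> \<le> norm (v - 1)" by (rule abs_Re_le_cmod)
  then have Re: "Re v > 0" using assms by auto
  then show "v \<notin> \<real>\<^sub>\<le>\<^sub>0" "v \<noteq> 0" by (auto simp: complex_nonpos_Reals_iff)
  then show "\<bar>Im (Ln v)\<bar> \<le> pi / 2" using Re Re_Ln_pos_lt_imp[OF Re] Re_Ln_pos_lt[of v] by (auto simp: abs_if)
qed

text \<open>The leading Dirichlet term, written as an exponential so that its logarithm is
  explicit.\<close>

definition nu_main :: "complex \<Rightarrow> complex" where
  "nu_main w = exp (2 * of_real (ln (ln 2)) - w * of_real (ln 2))"

lemma nu_main_eq: "nu_main w = (of_real (ln 2))\<^sup>2 * 2 powr (-w)"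
proof -
  have "exp (2 * complex_of_real (ln (ln 2))) = (of_real (ln 2))\<^sup>2"
    by (simp add: exp_double exp_of_real)
  moreover have "(2 powr (-w) :: complex) = exp (- w * of_real (ln 2))"
    using Ln_of_real[of 2] by (simp add: powr_def)
  ultimately show ?thesis by (simp add: nu_main_def exp_diff exp_minus divide_inverse)
qed

lemma norm_nu_main: "norm (nu_main w) = exp (2 * ln (ln 2) - Re w * ln 2)"
  by (simp add: nu_main_def)

lemma nu_main_nonzero [simp]: "nu_main w \<noteq> 0"
  by (simp add: nu_main_def)

lemma nu_right_ratio:
  assumes "Re s \<ge> 5"
  shows "norm (nu s / nu_main s - 1) \<le> 9 / 10"
proof -
  have "nu s / nu_main s - 1 = (nu s - nu_main s) / nu_main s" by (simp add: diff_divide_distrib)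
  also have "norm \<dots> \<le> 9 / 10"
    using nu_right_approx[OF assms] by (simp add: norm_divide divide_le_eq nu_main_eq[symmetric])
  finally show ?thesis .
qed

lemma nu_nonzero_right: "Re s \<ge> 5 \<Longrightarrow> nu s \<noteq> 0"
  using near_one_upper_half(2)[OF nu_right_ratio] by fastforce

text \<open>The argument of the leading term is exactly -Im(s) ln 2; the quotient of nu by it
  contributes at most pi / 2 at either end.\<close>

lemma nu_right_log:
  obtains U G where "open U" "{s. Re s = 6} \<subseteq> U" "G holomorphic_on U"
    "\<And>w. w \<in> U \<Longrightarrow> nu w = exp (G w)"
    "\<And>a b. \<lbrakk>Re a = 6; Re b = 6\<rbrakk> \<Longrightarrow> \<bar>Im (G b - G a) + (Im b - Im a) * ln 2\<bar> \<le> pi"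
proof
  define U where "U = {s. Re s > 5}"
  define G where "G = (\<lambda>s. 2 * of_real (ln (ln 2)) - s * of_real (ln 2) + Ln (nu s / nu_main s))"
  show "open U" unfolding U_def by (rule open_Re_gt)
  show "{s. Re s = 6} \<subseteq> U" by (auto simp: U_def)
  have near: "norm (nu s / nu_main s - 1) \<le> 9 / 10" if "s \<in> U" for s
    using that by (intro nu_right_ratio) (auto simp: U_def)
  note Ln = near_one_upper_half[OF near]
  have "nu holomorphic_on U" using \<open>open U\<close> by (intro holomorphic_nu) (auto simp: U_def)
  moreover have "nu_main holomorphic_on U" unfolding nu_main_def by (intro holomorphic_intros)
  ultimately show "G holomorphic_on U" unfolding G_def using Ln(1)
    by (intro holomorphic_intros) auto
  show "nu w = exp (G w)" if "w \<in> U" for w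
    using Ln(2)[OF that] unfolding G_def exp_add nu_main_def[symmetric] by simp
  fix a b :: complex assume ab: "Re a = 6" "Re b = 6"
  then have "\<bar>Im (Ln (nu a / nu_main a))\<bar> \<le> pi / 2" "\<bar>Im (Ln (nu b / nu_main b))\<bar> \<le> pi / 2"
    using Ln(3)[of a] Ln(3)[of b] by (auto simp: U_def)
  then show "\<bar>Im (G b - G a) + (Im b - Im a) * ln 2\<bar> \<le> pi"
    by (simp add: G_def algebra_simps)
qed

definition nu_left_ratio :: "complex \<Rightarrow> complex" where
  "nu_left_ratio s = (chi_log'' s * zeta (1 - s) ^ 2 + nu (1 - s)) / nu_main (1 - s)"

text \<open>Since Re(1 - s) <= 7, the main term is at least (2/3)^2 2^(-7). With |zeta(1 - s)| <= 2
  and |(log chi)''| <= 26 / Im s, the height 600000 makes the additional term at most 1/20 of it, so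
  the total error 9/10 + 1/20 stays below 1.\<close>

lemma norm_nu_left_ratio_le:
  assumes s: "-6 \<le> Re s" "Re s \<le> -4" "Im s \<ge> 600000"
  shows "norm (nu_left_ratio s - 1) \<le> 19 / 20"
proof -
  define w where "w = 1 - s"
  have w: "Re w \<ge> 5" "Re w \<le> 7" using s by (auto simp: w_def)
  have z2: "norm (zeta w) \<le> 2"
  proof -
    have "norm (zeta w - 1) \<le> 12 / 10 * norm (2 powr (-w) :: complex)" by (rule zeta_right_bounds(1)[OF w(1)])
    also have "\<dots> \<le> 1" using norm_two_powr_le[OF w(1)] by simp
    finally have "norm (zeta w) \<le> 1 + 1" by (rule norm_le_of_approx) simp
    then show ?thesis by simp
  qed
  have K: "norm (chi_log'' s) \<le> 26 / 600000"
  proof -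
    have "norm (chi_log'' s) \<le> 26 / Im s" using s by (intro norm_chi_log''_le) auto
    also have "\<dots> \<le> 26 / 600000" using s by (intro divide_left_mono) auto
    finally show ?thesis .
  qed
  have M: "norm (nu_main w) \<ge> 4 / 9 * (1 / 128)"
  proof -
    have "norm (nu_main w) = (ln 2)\<^sup>2 * 2 powr (- Re w)"
      unfolding nu_main_eq norm_mult norm_power using norm_powr_real_powr[of 2 "-w"] by simp
    moreover have "(2 / 3)\<^sup>2 \<le> (ln (2::real))\<^sup>2" using ln2_ge_two_thirds by (intro power_mono) auto
    moreover have "2 powr (-7) \<le> 2 powr (- Re w)" using w by (intro powr_mono) auto
    moreover have "2 powr (-7) = (1 / 128 :: real)" by (simp add: powr_minus powr_numeral)
    ultimately show ?thesis
      using mult_mono[of "(2 / 3)\<^sup>2" "(ln (2::real))\<^sup>2" "1 / 128" "2 powr (- Re w)"] by (simp add: power_divide)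
  qed
  have "norm (chi_log'' s * zeta w ^ 2 / nu_main w) = norm (chi_log'' s) * norm (zeta w) ^ 2 / norm (nu_main w)"
    by (simp add: norm_mult norm_divide norm_power)
  also have "\<dots> \<le> (26 / 600000) * 2 ^ 2 / (4 / 9 * (1 / 128))"
    using K z2 M by (intro frac_le mult_mono power_mono) auto
  also have "\<dots> \<le> 1 / 20" by simp
  finally have 1: "norm (chi_log'' s * zeta w ^ 2 / nu_main w) \<le> 1 / 20" .
  have "nu_left_ratio s - 1 = chi_log'' s * zeta w ^ 2 / nu_main w + (nu w / nu_main w - 1)"
    by (simp add: nu_left_ratio_def w_def add_divide_distrib)
  also have "norm \<dots> \<le> 1 / 20 + 9 / 10"
    by (intro order_trans[OF norm_triangle_ineq] add_mono 1 nu_right_ratio w)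
  finally show ?thesis by simp
qed

lemma nu_left_eq:
  assumes "Re s < 0" "Im s > 0"
  shows "nu s = exp (2 * chi_log s) * (nu_main (1 - s) * nu_left_ratio s)"
  using nu_reflection[OF assms] by (simp add: nu_left_ratio_def)

lemma nu_nonzero_left:
  assumes s: "-6 \<le> Re s" "Re s \<le> -4" "Im s \<ge> 600000"
  shows "nu s \<noteq> 0"
  using nu_left_eq[of s] s near_one_upper_half(2)[OF norm_nu_left_ratio_le[OF s]] by simp

lemma nu_left_log:
  obtains U G where "open U" "{s. Re s = -5 \<and> Im s > 600000} \<subseteq> U" "G holomorphic_on U"
    "\<And>w. w \<in> U \<Longrightarrow> nu w = exp (G w)"
    "\<And>a b. \<lbrakk>Re a = -5; Re b = -5; Im a > 600000; Im b > 600000\<rbrakk> \<Longrightarrow>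
       \<bar>Im (G b - G a) - 2 * Im (chi_log b - chi_log a) - (Im b - Im a) * ln 2\<bar> \<le> pi"
proof
  define U where "U = {s. Re s > -6} \<inter> {s. Re s < -4} \<inter> {s. Im s > 600000}"
  define G where "G = (\<lambda>s. 2 * chi_log s + (2 * of_real (ln (ln 2)) - (1 - s) * of_real (ln 2)) + Ln (nu_left_ratio s))"
  show oU: "open U" unfolding U_def by (intro open_Int open_Re_gt open_Re_lt open_halfspace_Im_gt)
  show "{s. Re s = -5 \<and> Im s > 600000} \<subseteq> U" by (auto simp: U_def)
  have near: "norm (nu_left_ratio s - 1) \<le> 19 / 20" if "s \<in> U" for s
    using that by (intro norm_nu_left_ratio_le) (auto simp: U_def)
  note Ln = near_one_upper_half[OF near]
  have hr: "(\<lambda>s. f (1 - s)) holomorphic_on U" if "f holomorphic_on {s. Re s > 1}" for f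
    by (rule holomorphic_on_compose_gen[of "\<lambda>z. 1 - z" _ f "{z. Re z > 1}", unfolded o_def])
      (auto intro!: holomorphic_intros that simp: U_def)
  have 1: "(\<lambda>s. zeta (1 - s)) holomorphic_on U" by (intro hr holomorphic_zeta) auto
  have 2: "(\<lambda>s. nu (1 - s)) holomorphic_on U" by (intro hr holomorphic_nu open_Re_gt) auto
  have 3: "(\<lambda>s. nu_main (1 - s)) holomorphic_on U" unfolding nu_main_def by (intro holomorphic_intros)
  have 4: "chi_log holomorphic_on U" unfolding holomorphic_on_open[OF oU]
  proof
    fix s assume "s \<in> U"
    then have "Im s > 0" by (simp add: U_def)
    then show "\<exists>f'. (chi_log has_field_derivative f') (at s)" using has_field_derivative_chi_log by blast
  qed
  have 5: "chi_log'' holomorphic_on U"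
  proof -
    have "1 - s \<notin> \<int>\<^sub>\<le>\<^sub>0" "1 - exp (\<i> * of_real pi * s) \<noteq> 0" if "s \<in> U" for s
      using that one_minus_upper[of s] one_minus_exp_upper[of s] by (auto simp: U_def)
    then have "(\<lambda>s. Polygamma 1 (1 - s)) holomorphic_on U"
      by (intro holomorphic_on_compose_gen[of "\<lambda>z. 1 - z" _ "Polygamma 1" "- \<int>\<^sub>\<le>\<^sub>0", unfolded o_def] holomorphic_on_Polygamma)
        (auto intro!: holomorphic_intros)
    then show ?thesis unfolding chi_log''_def
      using \<open>\<And>s. s \<in> U \<Longrightarrow> 1 - exp (\<i> * of_real pi * s) \<noteq> 0\<close> by (intro holomorphic_intros) auto
  qed
  have "nu_left_ratio holomorphic_on U" unfolding nu_left_ratio_def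
    by (intro holomorphic_intros 1 2 3 5) auto
  then show "G holomorphic_on U" unfolding G_def using Ln(1) 4
    by (intro holomorphic_intros) auto
  show "nu w = exp (G w)" if "w \<in> U" for w
  proof -
    have "exp (G w) = exp (2 * chi_log w) * nu_main (1 - w) * nu_left_ratio w"
      using Ln(2)[OF that] unfolding G_def exp_add nu_main_def[symmetric] by simp
    then show ?thesis using nu_left_eq[of w] that by (simp add: U_def)
  qed
  fix a b :: complex assume ab: "Re a = -5" "Re b = -5" "Im a > 600000" "Im b > 600000"
  then have "\<bar>Im (Ln (nu_left_ratio a))\<bar> \<le> pi / 2" "\<bar>Im (Ln (nu_left_ratio b))\<bar> \<le> pi / 2"
    using Ln(3)[of a] Ln(3)[of b] by (auto simp: U_def)
  then show "\<bar>Im (G b - G a) - 2 * Im (chi_log b - chi_log a) - (Im b - Im a) * ln 2\<bar> \<le> pi"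
    by (simp add: G_def algebra_simps)
qed

text \<open>The derivative in t is Re \<open>chi_log'\<close> = ln(2 pi) - ln|1 - s| + O(1/t), and F
  is an antiderivative of ln(2 pi) - ln t. The constant 26 is 8 from Stirling plus 18 from |1 - s|^2
  = 36 + t^2; the error is integrated by showing that 26 ln t plus or minus the difference D is
  increasing.\<close>

lemma chi_log_arg:
  assumes "2 \<le> t0" "t0 \<le> t"
  defines "F \<equiv> \<lambda>t. t * ln (2 * pi) - t * ln t + t"
  shows "\<bar>Im (chi_log (Complex (-5) t) - chi_log (Complex (-5) t0)) - (F t - F t0)\<bar> \<le> 26 * (ln t - ln t0)"
proof -
  define D where "D = (\<lambda>t. Im (chi_log (Complex (-5) t)) - F t)"
  define D' where "D' = (\<lambda>t. Re (chi_log' (Complex (-5) t)) - (ln (2 * pi) - ln t))"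
  have dD: "(D has_real_derivative D' x) (at x)" if "x \<ge> t0" for x
  proof -
    have x: "x > 0" using that assms by simp
    have "((\<lambda>t. Complex (-5) t) has_vector_derivative \<i>) (at x)"
      unfolding Complex_eq by (auto intro!: derivative_eq_intros)
    moreover have "(chi_log has_field_derivative chi_log' (Complex (-5) x)) (at (Complex (-5) x))"
      using x by (intro has_field_derivative_chi_log) simp
    ultimately have "((\<lambda>t. chi_log (Complex (-5) t)) has_vector_derivative (\<i> * chi_log' (Complex (-5) x))) (at x)"
      using field_vector_diff_chain_at[of "Complex (-5)" \<i> x chi_log] by (simp add: o_def)
    then have "((\<lambda>t. Im (chi_log (Complex (-5) t))) has_vector_derivative Im (\<i> * chi_log' (Complex (-5) x))) (at x)"
      by (rule bounded_linear.has_vector_derivative[OF bounded_linear_Im])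
    then have 1: "((\<lambda>t. Im (chi_log (Complex (-5) t))) has_real_derivative Re (chi_log' (Complex (-5) x))) (at x)"
      by (simp add: has_real_derivative_iff_has_vector_derivative)
    have "(F has_real_derivative ln (2 * pi) - ln x) (at x)"
      unfolding F_def using x by (auto intro!: derivative_eq_intros)
    with 1 show ?thesis unfolding D_def D'_def by (rule DERIV_diff)
  qed
  have bound: "\<bar>D' x\<bar> \<le> 26 / x" if "x \<ge> t0" for x
  proof -
    have x: "x \<ge> 2" using that assms by simp
    define s where "s = Complex (-5) x"
    have "norm (chi_log' s - (of_real (ln (2 * pi)) - \<i> * of_real pi / 2 - Ln (1 - s))) \<le> 8 / Im s"
      using x by (intro chi_log'_approx) (auto simp: s_def)
    then have "\<bar>Re (chi_log' s - (of_real (ln (2 * pi)) - \<i> * of_real pi / 2 - Ln (1 - s)))\<bar> \<le> 8 / x"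
      using abs_Re_le_cmod order_trans by (fastforce simp: s_def)
    moreover have "Re (Ln (1 - s)) = ln (norm (1 - s))"
      using x by (subst Re_Ln) (auto simp: s_def complex_eq_iff)
    ultimately have 1: "\<bar>Re (chi_log' s) - (ln (2 * pi) - ln (norm (1 - s)))\<bar> \<le> 8 / x"
      by simp
    have n: "norm (1 - s) \<ge> x" "norm (1 - s) ^ 2 = 36 + x ^ 2"
      using abs_Im_le_cmod[of "1 - s"] x by (auto simp: s_def cmod_power2)
    have "2 * ln (norm (1 - s)) = ln (norm (1 - s) ^ 2)" using n(1) x by (simp add: ln_realpow)
    also have "norm (1 - s) ^ 2 = x ^ 2 * (1 + 36 / x ^ 2)" unfolding n(2) using x by (simp add: field_simps)
    also have "ln \<dots> = ln (x ^ 2) + ln (1 + 36 / x ^ 2)"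
    proof -
      have "x ^ 2 > 0" "1 + 36 / x ^ 2 > 0" using x by (auto intro: add_pos_nonneg)
      then show ?thesis by (subst ln_mult_pos) auto
    qed
    also have "ln (x ^ 2) = 2 * ln x" using x by (simp add: ln_realpow)
    also have "ln (1 + 36 / x ^ 2) \<le> 36 / x ^ 2" by (intro ln_add_one_self_le_self) auto
    also have "36 / x ^ 2 \<le> 36 / x" using x by (intro divide_left_mono) (auto simp: power2_eq_square)
    finally have "2 * ln (norm (1 - s)) \<le> 2 * ln x + 36 / x" by simp
    then have "ln (norm (1 - s)) \<le> ln x + 18 / x" by (simp add: field_simps)
    moreover have "ln x \<le> ln (norm (1 - s))" using n x by (subst ln_le_cancel_iff) auto
    ultimately have "\<bar>Re (chi_log' s) - (ln (2 * pi) - ln x)\<bar> \<le> 8 / x + 18 / x" using 1 by linarith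
    then show ?thesis by (simp add: D'_def s_def)
  qed
  have "D t \<le> D t0 + 26 * (ln t - ln t0)"
  proof -
    have "26 * ln t0 - D t0 \<le> 26 * ln t - D t"
    proof (rule DERIV_nonneg_imp_nondecreasing[OF assms(2)])
      fix x assume x: "t0 \<le> x" "x \<le> t"
      have "((\<lambda>x. 26 * ln x - D x) has_real_derivative 26 / x - D' x) (at x)"
        using x assms by (auto intro!: derivative_eq_intros dD)
      moreover have "26 / x - D' x \<ge> 0" using bound[OF x(1)] by linarith
      ultimately show "\<exists>y. ((\<lambda>x. 26 * ln x - D x) has_real_derivative y) (at x) \<and> y \<ge> 0" by blast
    qed
    then show ?thesis by simp
  qed
  moreover have "D t0 - 26 * (ln t - ln t0) \<le> D t"
  proof -
    have "26 * ln t0 + D t0 \<le> 26 * ln t + D t"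
    proof (rule DERIV_nonneg_imp_nondecreasing[OF assms(2)])
      fix x assume x: "t0 \<le> x" "x \<le> t"
      have "((\<lambda>x. 26 * ln x + D x) has_real_derivative 26 / x + D' x) (at x)"
        using x assms by (auto intro!: derivative_eq_intros dD)
      moreover have "26 / x + D' x \<ge> 0" using bound[OF x(1)] by linarith
      ultimately show "\<exists>y. ((\<lambda>x. 26 * ln x + D x) has_real_derivative y) (at x) \<and> y \<ge> 0" by blast
    qed
    then show ?thesis by simp
  qed
  moreover have "Im (chi_log (Complex (-5) t) - chi_log (Complex (-5) t0)) - (F t - F t0) = D t - D t0"
    by (simp add: D_def)
  ultimately show ?thesis by linarith
qed

section \<open>Counting zeros in a rectangle\<close>

text \<open>The interval from -31 to 43 contains the real parts in the disc of radius 37 about 6 + i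
  y, on which \<open>horizontal_edge\<close> works.\<close>

definition zero_free_height :: "real \<Rightarrow> bool" where
  "zero_free_height y \<longleftrightarrow> (\<forall>s. Im s = y \<and> -31 \<le> Re s \<and> Re s \<le> 43 \<longrightarrow> nu s \<noteq> 0)"

lemma exists_zero_free_height:
  assumes "0 < a" "a < b"
  obtains y where "a < y" "y < b" "zero_free_height y"
proof -
  define Z where "Z = {s \<in> cbox (Complex (-31) a) (Complex 43 b). s \<noteq> 1 \<and> nu s = 0}"
  have "finite Z" unfolding Z_def by (rule finite_nu_zeros_compact[OF compact_cbox])
  then have "infinite ({a<..<b} - Im ` Z)"
    using assms by (intro Diff_infinite_finite finite_imageI infinite_Ioo)
  then obtain y where y: "y \<in> {a<..<b} - Im ` Z" using infinite_imp_nonempty by blast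
  have "zero_free_height y" unfolding zero_free_height_def
  proof (intro allI impI notI)
    fix s assume "Im s = y \<and> -31 \<le> Re s \<and> Re s \<le> 43" "nu s = 0"
    then have "s \<in> Z" using y assms by (auto simp: Z_def in_cbox_complex_iff)
    then show False using y \<open>Im s = y \<and> _\<close> by auto
  qed
  then show thesis using y that by auto
qed

text \<open>\<open>horizontal_log\<close> about 6 + i T: radius 11 reaches the left corner, 12 is
  slightly larger, and 3 * 12 = 36 still fits into the disc of radius 37. The lower bound at the
  centre is independent of T and the upper bound is polynomial in T, so their logarithmic ratio is
  O(log T).\<close>

lemma horizontal_edge:
  obtains C where "C \<ge> 0" "\<And>T. \<lbrakk>T \<ge> 100; zero_free_height T\<rbrakk> \<Longrightarrow>
    \<exists>U G. open U \<and> closed_segment (Complex 6 T) (Complex (-5) T) \<subseteq> U \<and> G holomorphic_on U \<and>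
      (\<forall>w\<in>U. nu w = exp (G w)) \<and> \<bar>Im (G (Complex (-5) T) - G (Complex 6 T))\<bar> \<le> C * ln T"
proof -
  obtain C k where C: "C \<ge> 0" "\<And>s. \<lbrakk>\<bar>Re s\<bar> \<le> 50; Im s \<ge> 3\<rbrakk> \<Longrightarrow> norm (nu s) \<le> C * Im s ^ k"
    using nu_growth[of 50] by auto
  \<comment> \<open>One tenth of the leading term at Re s = 6, since nu differs from it by a factor
    within 9/10 of 1.\<close>
  define m :: real where "m = exp (2 * ln (ln 2) - 6 * ln 2) / 10"
  have m: "m > 0" by (simp add: m_def)
  define K where "K = 2 * pi / ln 2 + 4 * 11 / (12 - 11 :: real)"
  have K: "K \<ge> 0" by (simp add: K_def)
  define c0 where "c0 = ln ((C + 1) * 2 ^ k / m)"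
  show thesis
  proof
    show "K * (\<bar>c0\<bar> + k + 1) \<ge> 0" using K by simp
    fix T assume T: "T \<ge> 100" "zero_free_height T"
    define c where "c = Complex 6 T"
    \<comment> \<open>2 T bounds the imaginary parts, as T + 36 <= 2 T; C + 1 in place of C keeps
      the logarithm meaningful if C = 0.\<close>
    define M where "M = (C + 1) * (2 * T) ^ k"
    have ball: "\<bar>Re w - 6\<bar> \<le> d \<and> \<bar>Im w - T\<bar> \<le> d" if "dist c w \<le> d" for w d
      using that abs_Re_le_cmod[of "c - w"] abs_Im_le_cmod[of "c - w"] by (auto simp: c_def dist_norm)
    have mc: "m \<le> norm (nu c)"
    proof -
      have "norm (nu c / nu_main c - 1) \<le> 9 / 10" by (rule nu_right_ratio) (simp add: c_def)
      then have "norm (nu c / nu_main c) \<ge> 1 / 10"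
        using norm_triangle_ineq2[of 1 "1 - nu c / nu_main c"] by (simp add: norm_minus_commute)
      then have "norm (nu c) \<ge> norm (nu_main c) / 10" by (simp add: norm_divide field_simps)
      then show ?thesis by (simp add: norm_nu_main m_def c_def)
    qed
    have S: "cball c (3 * 12) \<subseteq> ball c 37" by auto
    have S1: "1 \<notin> ball c 37"
    proof
      assume "1 \<in> ball c 37"
      then have "dist c 1 \<le> 37" by simp
      from ball[OF this] T show False by simp
    qed
    have hol: "nu holomorphic_on ball c 37" using S1 by (intro holomorphic_nu) auto
    have MM: "norm (nu w) \<le> M" if "w \<in> cball c (3 * 12)" for w
    proof -
      have w: "\<bar>Re w\<bar> \<le> 50" "Im w \<ge> 3" "Im w \<le> 2 * T"
        using ball[of w 36] that T by auto
      have "norm (nu w) \<le> C * Im w ^ k" using C(2) w by blast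
      also have "\<dots> \<le> (C + 1) * (2 * T) ^ k" using w C(1) by (intro mult_mono power_mono) auto
      finally show ?thesis by (simp add: M_def)
    qed
    have nz: "nu w \<noteq> 0" if "w \<in> ball c 37" "Im w = T" for w
    proof -
      have "dist c w \<le> 37" using that by simp
      from ball[OF this] T(2) that(2) show ?thesis unfolding zero_free_height_def by auto
    qed
    have cc: "Complex 6 T \<in> cball c 11" "Complex (-5) T \<in> cball c 11"
    proof -
      have "c - Complex (-5) T = of_real 11" by (simp add: c_def complex_eq_iff)
      then have "dist c (Complex (-5) T) = 11" by (simp add: dist_norm)
      then show "Complex 6 T \<in> cball c 11" "Complex (-5) T \<in> cball c 11" by (auto simp: c_def)
    qed
    have r: "(0::real) < 11" "(11::real) < 12" and im: "Im (Complex 6 T) = T" "Im (Complex (-5) T) = T"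
      by simp_all
    obtain U G where UG: "open U" "closed_segment (Complex 6 T) (Complex (-5) T) \<subseteq> U" "G holomorphic_on U"
      "\<And>w. w \<in> U \<Longrightarrow> nu w = exp (G w)"
      "\<bar>Im (G (Complex (-5) T) - G (Complex 6 T))\<bar> \<le> (2 * pi / ln 2 + 4 * 11 / (12 - 11)) * (ln (M / m) + 1)"
      by (rule horizontal_log[OF r open_ball S hol m mc MM cc im nz]) (assumption | rule that)+
    have lnT: "ln T \<ge> 1"
    proof -
      have "exp 1 \<le> T" using exp_le T by linarith
      then have "ln (exp 1) \<le> ln T" using T by (subst ln_le_cancel_iff) auto
      then show ?thesis by simp
    qed
    have "M / m = ((C + 1) * 2 ^ k / m) * T ^ k" by (simp add: M_def power_mult_distrib)
    then have "ln (M / m) = c0 + ln (T ^ k)" unfolding c0_def using m C(1) T by (simp only:) (subst ln_mult_pos, auto)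
    also have "ln (T ^ k) = k * ln T" using T by (simp add: ln_realpow)
    finally have "ln (M / m) + 1 \<le> \<bar>c0\<bar> * 1 + k * ln T + 1 * 1" by simp
    also have "\<dots> \<le> \<bar>c0\<bar> * ln T + k * ln T + 1 * ln T" using lnT by (intro add_mono mult_left_mono) auto
    finally have "ln (M / m) + 1 \<le> (\<bar>c0\<bar> + k + 1) * ln T" by (simp add: algebra_simps)
    then have "K * (ln (M / m) + 1) \<le> K * (\<bar>c0\<bar> + k + 1) * ln T"
      using mult_left_mono[OF _ K] by (simp add: mult.assoc)
    then show "\<exists>U G. open U \<and> closed_segment (Complex 6 T) (Complex (-5) T) \<subseteq> U \<and> G holomorphic_on U \<and>
      (\<forall>w\<in>U. nu w = exp (G w)) \<and> \<bar>Im (G (Complex (-5) T) - G (Complex 6 T))\<bar> \<le> K * (\<bar>c0\<bar> + k + 1) * ln T"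
      using UG unfolding K_def by (intro exI[of _ U] exI[of _ G]) auto
  qed
qed

lemma finite_nu_zeros: "finite (nu_zeros T)"
proof (rule finite_subset)
  show "nu_zeros T \<subseteq> {s \<in> cbox (Complex (-4) 0) (Complex 5 T). s \<noteq> 1 \<and> nu s = 0}"
    using nu_nonzero_right by (force simp: nu_zeros_def in_cbox_complex_iff)
qed (rule finite_nu_zeros_compact[OF compact_cbox])

text \<open>The order is meaningful only if nu does not vanish identically near p, which follows
  from the finiteness of its zeros in a disc. Positivity shows that \<open>nat\<close> in
  \<open>N_nu\<close> loses nothing.\<close>

lemma zorder_nu_pos:
  assumes "Im p > 0" "nu p = 0"
  shows "zorder nu p > 0"
proof -
  have H: "nu holomorphic_on {s. Im s > 0}" "open {s. Im s > 0}"
    by (auto intro!: holomorphic_nu open_halfspace_Im_gt)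
  define F where "F = {s \<in> cball p 1. s \<noteq> 1 \<and> nu s = 0}"
  have "finite F" unfolding F_def by (rule finite_nu_zeros_compact) auto
  then have "open (- (F - {p}))" by (intro open_Compl finite_imp_closed) auto
  then have "eventually (\<lambda>s. s \<in> - (F - {p})) (at p)" by (rule eventually_at_in_open') auto
  moreover have "eventually (\<lambda>s. s \<in> ball p 1 - {p}) (at p)" by (intro eventually_at_in_open) auto
  moreover have "eventually (\<lambda>s. s \<in> {s. Im s > 0}) (at p)"
    by (intro eventually_at_in_open' H(2)) (use assms in auto)
  ultimately have "eventually (\<lambda>s. nu s \<noteq> 0) (at p)"
    by eventually_elim (auto simp: F_def)
  then have "frequently (\<lambda>s. nu s \<noteq> 0) (at p)" by (intro eventually_frequently) auto
  then show ?thesis using zorder_pos_iff[OF H(1,2), of p] assms by auto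
qed

text \<open>The rectangle extends to Re s = -5 although \<open>N_nu\<close> counts only Re s > -4;
  above height 600000 the strip between has no zeros, and there are none with Re s >= 5. No zero
  lies at height T0, so the rectangle contains exactly the zeros gained between T0 and T.\<close>

lemma nu_zeros_rectangle:
  assumes T: "600000 < T0" "T0 < T" "zero_free_height T0" "zero_free_height T"
  defines "a \<equiv> Complex (-5) T0" and "b \<equiv> Complex 6 T"
  shows "contour_integral (rectpath a b) (\<lambda>w. deriv nu w / nu w) = of_real (2 * pi) * \<i> * of_real (real (N_nu T) - real (N_nu T0))"
    and "\<And>w. w \<in> path_image (rectpath a b) \<Longrightarrow> nu w \<noteq> 0"
proof -
  have ab: "Re a = -5" "Im a = T0" "Re b = 6" "Im b = T" by (simp_all add: a_def b_def)
  \<comment> \<open>A slightly larger open box for the argument principle; its zeros outside the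
    rectangle have winding number 0.\<close>
  define S where "S = box (Complex (-6) (T0 - 1)) (Complex 7 (T + 1))"
  have Sd: "w \<in> S \<longleftrightarrow> -6 < Re w \<and> Re w < 7 \<and> T0 - 1 < Im w \<and> Im w < T + 1" for w
    by (auto simp: S_def in_box_complex_iff)
  have zf: "nu w \<noteq> 0" if "Im w = T0 \<or> Im w = T" "-6 \<le> Re w" "Re w \<le> 7" for w
    using that T(3,4) unfolding zero_free_height_def by auto
  have pim: "path_image (rectpath a b) = cbox a b - box a b"
    using ab T by (intro path_image_rectpath_cbox_minus_box) auto
  show pnz: "nu w \<noteq> 0" if "w \<in> path_image (rectpath a b)" for w
  proof -
    have w: "w \<in> cbox a b" "w \<notin> box a b" using that unfolding pim by auto
    then consider "Im w = T0 \<or> Im w = T" | "Re w = -5" | "Re w = 6"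
      by (force simp: in_cbox_complex_iff in_box_complex_iff ab)
    then show ?thesis
    proof cases
      case 1 then show ?thesis using w by (intro zf) (auto simp: in_cbox_complex_iff ab)
    next
      case 2 then show ?thesis using w T by (intro nu_nonzero_left) (auto simp: in_cbox_complex_iff ab)
    next
      case 3 then show ?thesis by (intro nu_nonzero_right) auto
    qed
  qed
  \<comment> \<open>The clause \<open>w \<in> {}\<close> matches the form of the argument principle
    with an empty set of poles.\<close>
  define pz where "pz = {w \<in> S. nu w = 0 \<or> w \<in> {}}"
  define Z where "Z = {w \<in> box a b. nu w = 0}"
  have fin: "finite pz"
  proof (rule finite_subset)
    show "pz \<subseteq> {s \<in> cbox (Complex (-6) (T0 - 1)) (Complex 7 (T + 1)). s \<noteq> 1 \<and> nu s = 0}"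
      using T by (auto simp: pz_def Sd in_cbox_complex_iff)
  qed (rule finite_nu_zeros_compact[OF compact_cbox])
  have ZS: "Z \<subseteq> pz" using T by (auto simp: Z_def pz_def Sd in_box_complex_iff ab)
  have AP: "contour_integral (rectpath a b) (\<lambda>x. deriv nu x * 1 / nu x) =
      of_real (2 * pi) * \<i> * (\<Sum>p\<in>pz. winding_number (rectpath a b) p * 1 * of_int (zorder nu p))"
    unfolding pz_def
  proof (rule argument_principle)
    show "open S" "connected S" by (auto simp: S_def intro: convex_connected)
    show "nu holomorphic_on S - {}" using T by (intro holomorphic_nu) (auto simp: S_def in_box_complex_iff open_box)
    have "cbox a b \<subseteq> S" by (auto simp: Sd in_cbox_complex_iff ab)
    then show "path_image (rectpath a b) \<subseteq> S - {w \<in> S. nu w = 0 \<or> w \<in> {}}"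
      using pnz pim by auto
    show "\<forall>z. z \<notin> S \<longrightarrow> winding_number (rectpath a b) z = 0"
      using \<open>cbox a b \<subseteq> S\<close> ab T by (intro allI impI winding_number_rectpath_outside) auto
    show "finite {w \<in> S. nu w = 0 \<or> w \<in> {}}" using fin unfolding pz_def .
  qed auto
  also have "(\<Sum>p\<in>pz. winding_number (rectpath a b) p * 1 * of_int (zorder nu p)) = (\<Sum>p\<in>Z. of_int (zorder nu p))"
  proof (rule sum.mono_neutral_cong_right[OF fin ZS])
    show "\<forall>p\<in>pz - Z. winding_number (rectpath a b) p * 1 * of_int (zorder nu p) = 0"
    proof
      fix p assume p: "p \<in> pz - Z"
      then have "nu p = 0" "p \<notin> box a b" by (auto simp: pz_def Z_def)
      then have "p \<notin> cbox a b" using pnz[of p] pim by auto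
      then have "winding_number (rectpath a b) p = 0" using ab T by (intro winding_number_rectpath_outside) auto
      then show "winding_number (rectpath a b) p * 1 * of_int (zorder nu p) = 0" by simp
    qed
  qed (auto simp: Z_def winding_number_rectpath)
  also have "\<dots> = of_real (\<Sum>p\<in>Z. real (nat (zorder nu p)))"
    unfolding of_real_sum using T zorder_nu_pos
    by (intro sum.cong refl) (force simp: Z_def in_box_complex_iff ab)
  also have "(\<Sum>p\<in>Z. real (nat (zorder nu p))) = real (N_nu T) - real (N_nu T0)"
  proof -
    have "nu_zeros T = nu_zeros T0 \<union> Z"
    proof (intro equalityI subsetI)
      fix p assume p: "p \<in> nu_zeros T"
      have R5: "Re p < 5" using nu_nonzero_right[of p] p by (force simp: nu_zeros_def)
      have "Im p \<noteq> T0" using zf[of p] p R5 by (auto simp: nu_zeros_def)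
      then show "p \<in> nu_zeros T0 \<union> Z" using p R5 by (auto simp: nu_zeros_def Z_def in_box_complex_iff ab)
    next
      fix p assume p: "p \<in> nu_zeros T0 \<union> Z"
      show "p \<in> nu_zeros T"
      proof (cases "p \<in> Z")
        case True
        then have "nu p = 0" "-5 < Re p" "T0 < Im p" "Im p < T" by (auto simp: Z_def in_box_complex_iff ab)
        moreover from this have "-4 < Re p" using nu_nonzero_left[of p] T by force
        ultimately show ?thesis using T by (auto simp: nu_zeros_def)
      qed (use p T in \<open>auto simp: nu_zeros_def\<close>)
    qed
    moreover have "nu_zeros T0 \<inter> Z = {}" by (auto simp: nu_zeros_def Z_def in_box_complex_iff ab)
    moreover have "finite Z" using ZS fin by (rule finite_subset)
    ultimately have "N_nu T = N_nu T0 + (\<Sum>p\<in>Z. nat (zorder nu p))"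
      unfolding N_nu_def using finite_nu_zeros[of T0] by (simp add: sum.union_disjoint)
    then show ?thesis by simp
  qed
  finally show "contour_integral (rectpath a b) (\<lambda>w. deriv nu w / nu w) = of_real (2 * pi) * \<i> * of_real (real (N_nu T) - real (N_nu T0))"
    by simp
qed

definition main_term :: "real \<Rightarrow> real" where
  "main_term T = 2 * (T / (2 * pi) * ln (T / (2 * pi)) - T / (2 * pi)) - ln 2 / pi * T"

lemma N_nu_zero_free_height:
  obtains C T1 where "T1 \<ge> 600001" "\<And>T. \<lbrakk>T \<ge> T1; zero_free_height T\<rbrakk> \<Longrightarrow> \<bar>real (N_nu T) - main_term T\<bar> \<le> C * ln T"
proof -
  \<comment> \<open>One fixed zero-free base height in the range of the left-side estimates; the
    bottom side and the zeros below it only contribute constants.\<close>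
  obtain T0 where T0: "600000 < T0" "T0 < 600001" "zero_free_height T0"
    using exists_zero_free_height[of 600000 600001] by auto
  obtain C where C: "C \<ge> 0" "\<And>T. \<lbrakk>T \<ge> 100; zero_free_height T\<rbrakk> \<Longrightarrow>
    \<exists>U G. open U \<and> closed_segment (Complex 6 T) (Complex (-5) T) \<subseteq> U \<and> G holomorphic_on U \<and>
      (\<forall>w\<in>U. nu w = exp (G w)) \<and> \<bar>Im (G (Complex (-5) T) - G (Complex 6 T))\<bar> \<le> C * ln T"
    using horizontal_edge by blast
  obtain UR GR where R: "open UR" "{s. Re s = 6} \<subseteq> UR" "GR holomorphic_on UR"
    "\<And>w. w \<in> UR \<Longrightarrow> nu w = exp (GR w)"
    "\<And>a b. \<lbrakk>Re a = 6; Re b = 6\<rbrakk> \<Longrightarrow> \<bar>Im (GR b - GR a) + (Im b - Im a) * ln 2\<bar> \<le> pi"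
    using nu_right_log by blast
  obtain UL GL where L: "open UL" "{s. Re s = -5 \<and> Im s > 600000} \<subseteq> UL" "GL holomorphic_on UL"
    "\<And>w. w \<in> UL \<Longrightarrow> nu w = exp (GL w)"
    "\<And>a b. \<lbrakk>Re a = -5; Re b = -5; Im a > 600000; Im b > 600000\<rbrakk> \<Longrightarrow>
       \<bar>Im (GL b - GL a) - 2 * Im (chi_log b - chi_log a) - (Im b - Im a) * ln 2\<bar> \<le> pi"
    using nu_left_log by blast
  define f where "f = (\<lambda>w. deriv nu w / nu w)"
  define I1 where "I1 = contour_integral (linepath (Complex (-5) T0) (Complex 6 T0)) f"
  define F where "F = (\<lambda>t::real. t * ln (2 * pi) - t * ln t + t)"
  define D where "D = \<bar>Im I1\<bar> + 2 * pi + 2 * (T0 * ln 2) + 2 * \<bar>F T0\<bar>"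
  \<comment> \<open>The final bookkeeping in abstract reals. X is 2 pi times the number of zeros
    gained; i, a, b and c are the imaginary parts for the bottom, right, top and upward left side; k
    is the change of Im \<open>chi_log\<close>, and tl, t0l stand for T ln 2 and T0 ln 2.\<close>
  have combine: "\<bar>X - (- 2 * FT - 2 * tl)\<bar> \<le> (\<bar>i\<bar> + 2 * p + 2 * t0l + 2 * \<bar>FT0\<bar>) + Cl + 52 * lT"
    if "X = i + a + b - c" "\<bar>a + (tl - t0l)\<bar> \<le> p" "\<bar>c - 2 * k - (tl - t0l)\<bar> \<le> p"
      "\<bar>k - (FT - FT0)\<bar> \<le> 26 * (lT - lT0)" "\<bar>b\<bar> \<le> Cl" "0 \<le> lT0" "0 \<le> t0l"
    for X i a b c k FT FT0 tl t0l p Cl lT lT0 :: real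
  proof -
    note h = that(1) that(2-5)[unfolded abs_le_iff] that(6,7) abs_ge_self[of i] abs_ge_minus_self[of i]
      abs_ge_self[of FT0] abs_ge_minus_self[of FT0]
    define ai where "ai = \<bar>i\<bar>"
    define aF where "aF = \<bar>FT0\<bar>"
    show ?thesis
      using h unfolding ai_def[symmetric] aF_def[symmetric] by (intro abs_leI) (clarsimp, argo)+
  qed
  have D0: "D \<ge> 0" unfolding D_def using T0 by (intro add_nonneg_nonneg) auto
  show thesis
  proof
    show "(600001::real) \<ge> 600001" by simp
    fix T assume T: "T \<ge> 600001" "zero_free_height T"
    have TT: "T0 < T" "T \<ge> 100" using T T0 by auto
    obtain U G where UG: "open U" "closed_segment (Complex 6 T) (Complex (-5) T) \<subseteq> U" "G holomorphic_on U"
      "\<And>w. w \<in> U \<Longrightarrow> nu w = exp (G w)" and G: "\<bar>Im (G (Complex (-5) T) - G (Complex 6 T))\<bar> \<le> C * ln T"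
      using C(2)[OF TT(2) T(2)] by blast
    define a where "a = Complex (-5) T0"
    define b where "b = Complex 6 T"
    note rect = nu_zeros_rectangle[OF T0(1) TT(1) T0(3) T(2), folded a_def b_def f_def]
    have rp: "rectpath a b = linepath (Complex (-5) T0) (Complex 6 T0) +++ linepath (Complex 6 T0) (Complex 6 T)
        +++ linepath (Complex 6 T) (Complex (-5) T) +++ linepath (Complex (-5) T) (Complex (-5) T0)"
      by (simp add: rectpath_def Let_def a_def b_def)
    have vert: "closed_segment (Complex x y1) (Complex x y2) \<subseteq> {s. Re s = x \<and> min y1 y2 \<le> Im s}" for x y1 y2
    proof
      fix w assume "w \<in> closed_segment (Complex x y1) (Complex x y2)"
      then obtain u where u: "0 \<le> u" "u \<le> 1" "w = (1 - u) *\<^sub>R Complex x y1 + u *\<^sub>R Complex x y2"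
        by (auto simp: closed_segment_def)
      have w: "Re w = (1 - u) * x + u * x" "Im w = (1 - u) * y1 + u * y2" by (simp_all add: u(3))
      have "min y1 y2 = (1 - u) * min y1 y2 + u * min y1 y2" by (simp add: algebra_simps)
      also have "\<dots> \<le> (1 - u) * y1 + u * y2" using u by (intro add_mono mult_left_mono) auto
      finally have "min y1 y2 \<le> Im w" by (simp only: w(2))
      moreover have "Re w = x" unfolding w(1) by (simp flip: distrib_right)
      ultimately show "w \<in> {s. Re s = x \<and> min y1 y2 \<le> Im s}" by simp
    qed
    have c1: "(f has_contour_integral I1) (linepath (Complex (-5) T0) (Complex 6 T0))"
    proof -
      have seg: "closed_segment (Complex (-5) T0) (Complex 6 T0) \<subseteq> path_image (rectpath a b)"
        unfolding rp by (simp add: path_image_join)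
      have Im: "Im w = T0" if "w \<in> closed_segment (Complex (-5) T0) (Complex 6 T0)" for w
      proof -
        from that obtain u where "w = (1 - u) *\<^sub>R Complex (-5) T0 + u *\<^sub>R Complex 6 T0"
          by (auto simp: closed_segment_def)
        then have "Im w = (1 - u) * T0 + u * T0" by simp
        then show ?thesis by (simp flip: distrib_right)
      qed
      have hol: "nu holomorphic_on {s. Im s > 0}" by (intro holomorphic_nu open_halfspace_Im_gt) auto
      have "continuous_on (closed_segment (Complex (-5) T0) (Complex 6 T0)) f" unfolding f_def
      proof (intro continuous_on_divide)
        show "continuous_on (closed_segment (Complex (-5) T0) (Complex 6 T0)) nu"
          by (rule holomorphic_on_imp_continuous_on[OF holomorphic_on_subset[OF hol]]) (use Im T0 in auto)
        show "continuous_on (closed_segment (Complex (-5) T0) (Complex 6 T0)) (deriv nu)"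
          by (rule holomorphic_on_imp_continuous_on[OF holomorphic_on_subset[OF holomorphic_deriv[OF hol open_halfspace_Im_gt]]]) (use Im T0 in auto)
      qed (use rect(2) seg in blast)
      then show ?thesis unfolding I1_def
        by (intro has_contour_integral_integral contour_integrable_continuous_linepath)
    qed
    have c2: "(f has_contour_integral (GR (Complex 6 T) - GR (Complex 6 T0))) (linepath (Complex 6 T0) (Complex 6 T))"
      unfolding f_def using vert[of 6 T0 T] R(2) by (intro contour_integral_log_deriv[OF R(1) _ R(3,4)]) auto
    have c3: "(f has_contour_integral (G (Complex (-5) T) - G (Complex 6 T))) (linepath (Complex 6 T) (Complex (-5) T))"
      unfolding f_def by (rule contour_integral_log_deriv[OF UG])
    have c4: "(f has_contour_integral (GL (Complex (-5) T0) - GL (Complex (-5) T))) (linepath (Complex (-5) T) (Complex (-5) T0))"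
    proof -
      have "closed_segment (Complex (-5) T) (Complex (-5) T0) \<subseteq> UL"
        using vert[of "-5" T T0] L(2) T0 TT by (intro order_trans[OF vert]) auto
      then show ?thesis unfolding f_def by (rule contour_integral_log_deriv[OF L(1) _ L(3,4)])
    qed
    have "(f has_contour_integral (I1 + ((GR (Complex 6 T) - GR (Complex 6 T0)) + ((G (Complex (-5) T) - G (Complex 6 T)) + (GL (Complex (-5) T0) - GL (Complex (-5) T)))))) (rectpath a b)"
      unfolding rp by (intro has_contour_integral_join c1 c2 c3 c4 valid_path_join) auto
    from contour_integral_unique[OF this] rect(1)
    have "of_real (2 * pi) * \<i> * of_real (real (N_nu T) - real (N_nu T0)) =
      I1 + ((GR (Complex 6 T) - GR (Complex 6 T0)) + ((G (Complex (-5) T) - G (Complex 6 T)) + (GL (Complex (-5) T0) - GL (Complex (-5) T))))"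
      by simp
    then have "Im (of_real (2 * pi) * \<i> * of_real (real (N_nu T) - real (N_nu T0))) =
      Im (I1 + ((GR (Complex 6 T) - GR (Complex 6 T0)) + ((G (Complex (-5) T) - G (Complex 6 T)) + (GL (Complex (-5) T0) - GL (Complex (-5) T)))))"
      by (rule arg_cong)
    then have E: "2 * pi * (real (N_nu T) - real (N_nu T0)) =
       Im I1 + Im (GR (Complex 6 T) - GR (Complex 6 T0)) + Im (G (Complex (-5) T) - G (Complex 6 T)) - Im (GL (Complex (-5) T) - GL (Complex (-5) T0))"
      by simp
    have b1: "\<bar>Im (GR (Complex 6 T) - GR (Complex 6 T0)) + (T - T0) * ln 2\<bar> \<le> pi"
      using R(5)[of "Complex 6 T0" "Complex 6 T"] by simp
    have b2: "\<bar>Im (GL (Complex (-5) T) - GL (Complex (-5) T0)) - 2 * Im (chi_log (Complex (-5) T) - chi_log (Complex (-5) T0)) - (T - T0) * ln 2\<bar> \<le> pi"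
      using L(5)[of "Complex (-5) T0" "Complex (-5) T"] T0 TT by simp
    have b3: "\<bar>Im (chi_log (Complex (-5) T) - chi_log (Complex (-5) T0)) - (F T - F T0)\<bar> \<le> 26 * (ln T - ln T0)"
      unfolding F_def using T0 TT by (intro chi_log_arg) auto
    have lnT: "ln T \<ge> 1"
    proof -
      have "exp 1 \<le> T" using exp_le T by linarith
      then have "ln (exp 1) \<le> ln T" using T by (subst ln_le_cancel_iff) auto
      then show ?thesis by simp
    qed
    have lnT0: "ln T0 \<ge> 0" using T0 by simp
    have main: "2 * pi * main_term T = - 2 * F T - 2 * (T * ln 2)"
    proof -
      have "ln (T / (2 * pi)) = ln T - ln (2 * pi)" using TT by (intro ln_divide_pos) auto
      moreover have "2 * pi * (2 * (T / (2 * pi) * l - T / (2 * pi)) - ln 2 / pi * T) = 2 * T * l - 2 * T - 2 * T * ln 2" for l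
        by (simp add: field_simps)
      ultimately show ?thesis unfolding main_term_def F_def by (simp only:) (simp add: algebra_simps)
    qed
    have exp: "(T - T0) * ln 2 = T * ln 2 - T0 * ln 2" by (simp add: algebra_simps)
    have t0l: "T0 * ln 2 \<ge> 0" using T0 by simp
    have "\<bar>2 * pi * (real (N_nu T) - real (N_nu T0)) - 2 * pi * main_term T\<bar> \<le> D + C * ln T + 52 * ln T"
      unfolding main D_def by (rule combine[OF E b1[unfolded exp] b2[unfolded exp] b3 G lnT0 t0l])
    also have "\<dots> \<le> D * ln T + C * ln T + 52 * ln T"
      using mult_left_mono[OF lnT D0] by simp
    finally have "\<bar>2 * pi * (real (N_nu T) - real (N_nu T0) - main_term T)\<bar> \<le> (D + C + 52) * ln T"
      by (simp add: algebra_simps)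
    then have "2 * pi * \<bar>real (N_nu T) - real (N_nu T0) - main_term T\<bar> \<le> (D + C + 52) * ln T"
      by (simp add: abs_mult)
    moreover have "1 * \<bar>real (N_nu T) - real (N_nu T0) - main_term T\<bar> \<le> 2 * pi * \<bar>real (N_nu T) - real (N_nu T0) - main_term T\<bar>"
      using pi_gt3 by (intro mult_right_mono) auto
    ultimately have "1 * \<bar>real (N_nu T) - real (N_nu T0) - main_term T\<bar> \<le> (D + C + 52) * ln T"
      by (rule order_trans[rotated])
    then have "\<bar>real (N_nu T) - real (N_nu T0) - main_term T\<bar> \<le> (D + C + 52) * ln T" by simp
    moreover have "real (N_nu T0) \<le> real (N_nu T0) * ln T" using mult_left_mono[OF lnT, of "real (N_nu T0)"] by simp
    ultimately have "\<bar>real (N_nu T) - main_term T\<bar> \<le> (D + C + 52) * ln T + real (N_nu T0) * ln T" by linarith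
    then show "\<bar>real (N_nu T) - main_term T\<bar> \<le> (D + C + 52 + real (N_nu T0)) * ln T"
      by (simp add: algebra_simps)
  qed
qed

section \<open>From zero-free heights to all heights\<close>

lemma N_nu_mono: "T \<le> T' \<Longrightarrow> N_nu T \<le> N_nu T'"
  unfolding N_nu_def by (intro sum_mono2 finite_nu_zeros) (auto simp: nu_zeros_def)

text \<open>The derivative of the main term is (ln t - ln(4 pi)) / pi, which for t >= 100 > 4 pi is
  nonnegative and at most ln t. A shift of the height by 1 therefore costs only O(log T).\<close>

lemma main_term_increment:
  assumes "100 \<le> x" "x \<le> y" "y \<le> x + 1"
  shows "main_term x \<le> main_term y" "main_term y \<le> main_term x + ln y"
proof -
  have d: "(main_term has_real_derivative (ln t - ln (4 * pi)) / pi) (at t)" if "t \<ge> x" for t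
  proof -
    have t: "t > 0" using that assms by simp
    have "ln (4 * pi) = ln 2 + ln (2 * pi)" using ln_mult_pos[of 2 "2 * pi"] by simp
    moreover have "ln (t / (2 * pi)) = ln t - ln (2 * pi)" using t by (intro ln_divide_pos) auto
    ultimately have "2 * (1 / (2 * pi) * ln (t / (2 * pi)) + t / (2 * pi) * (1 / t) - 1 / (2 * pi)) - ln 2 / pi = (ln t - ln (4 * pi)) / pi"
      using t by (simp add: field_simps)
    moreover have "(main_term has_real_derivative (2 * (1 / (2 * pi) * ln (t / (2 * pi)) + t / (2 * pi) * (1 / t) - 1 / (2 * pi)) - ln 2 / pi)) (at t)"
      unfolding main_term_def using t by (auto intro!: derivative_eq_intros simp: field_simps)
    ultimately show ?thesis by simp
  qed
  have pos: "0 \<le> (ln t - ln (4 * pi)) / pi" if "t \<ge> x" for t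
  proof -
    have "4 * pi \<le> t" using that assms pi_less_4 by linarith
    then have "ln (4 * pi) \<le> ln t" using that assms by (subst ln_le_cancel_iff) auto
    then show ?thesis by simp
  qed
  have le: "(ln t - ln (4 * pi)) / pi \<le> ln y" if "t \<ge> x" "t \<le> y" for t
  proof -
    have "ln (4 * pi) \<ge> 0" using pi_gt3 by (intro ln_ge_zero) linarith
    moreover have "ln t \<le> ln y" using that assms by (subst ln_le_cancel_iff) auto
    moreover have "ln y \<ge> 0" using assms by simp
    ultimately have "ln t - ln (4 * pi) \<le> ln y * 1" unfolding mult_1_right by linarith
    also have "\<dots> \<le> ln y * pi" using \<open>ln y \<ge> 0\<close> pi_gt3 by (intro mult_left_mono) auto
    finally show ?thesis by (simp add: divide_le_eq)
  qed
  show "main_term x \<le> main_term y"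
    by (rule DERIV_nonneg_imp_nondecreasing[OF assms(2)]) (use d pos in blast)
  have "x * ln y - main_term x \<le> y * ln y - main_term y"
  proof (rule DERIV_nonneg_imp_nondecreasing[OF assms(2)])
    fix t assume t: "x \<le> t" "t \<le> y"
    have "((\<lambda>t. t * ln y - main_term t) has_real_derivative (ln y - (ln t - ln (4 * pi)) / pi)) (at t)"
      using t by (auto intro!: derivative_eq_intros d)
    then show "\<exists>z. ((\<lambda>t. t * ln y - main_term t) has_real_derivative z) (at t) \<and> z \<ge> 0"
      using le[OF t] by (intro exI[of _ "ln y - (ln t - ln (4 * pi)) / pi"]) auto
  qed
  then have "main_term y \<le> main_term x + (y - x) * ln y" by (simp add: algebra_simps)
  also have "(y - x) * ln y \<le> 1 * ln y" using assms by (intro mult_right_mono) auto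
  finally show "main_term y \<le> main_term x + ln y" by simp
qed

theorem theorem2:
  shows "(\<lambda>T::real. real (N_nu T)
           - (2 * (T / (2 * pi) * ln (T / (2 * pi)) - T / (2 * pi)) - ln 2 / pi * T))
         \<in> O[at_top](\<lambda>T. ln T)"
proof -
  obtain C T1 where C: "T1 \<ge> 600001" "\<And>T. \<lbrakk>T \<ge> T1; zero_free_height T\<rbrakk> \<Longrightarrow> \<bar>real (N_nu T) - main_term T\<bar> \<le> C * ln T"
    by (rule N_nu_zero_free_height) (assumption | rule that)+
  have "eventually (\<lambda>T. norm (real (N_nu T) - main_term T) \<le> (2 * \<bar>C\<bar> + 2) * norm (ln T)) at_top"
    using eventually_ge_at_top[of "T1 + 1"]
  proof eventually_elim
    case (elim T)
    \<comment> \<open>Zero-free heights within distance 1 on either side of T: monotonicity encloses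
      the count at T between theirs.\<close>
    obtain x where x: "T - 1 < x" "x < T" "zero_free_height x" using exists_zero_free_height[of "T - 1" T] elim C(1) by auto
    obtain y where y: "T < y" "y < T + 1" "zero_free_height y" using exists_zero_free_height[of T "T + 1"] elim C(1) by auto
    \<comment> \<open>T + 1 <= 2 T <= T^2 gives ln y <= 2 ln T.\<close>
    have "2 * T \<le> T * T" using elim C(1) by (intro mult_right_mono) auto
    then have "y \<le> T * T" using y elim C(1) by linarith
    then have "ln y \<le> ln (T * T)" using y elim C(1) by (subst ln_le_cancel_iff) auto
    then have lny: "ln y \<le> 2 * ln T" using elim C(1) by (simp add: ln_mult)
    have lnx: "ln x \<le> ln T" using x elim C(1) by (subst ln_le_cancel_iff) auto
    have ln0: "ln x \<ge> 0" "ln T \<ge> 0" "ln y \<ge> 0" using x y elim C(1) by auto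
    have "\<bar>real (N_nu x) - main_term x\<bar> \<le> C * ln x" using x elim C(1) by (intro C(2)) auto
    also have "\<dots> \<le> \<bar>C\<bar> * ln T" using lnx ln0 by (intro mult_mono) auto
    finally have 1: "\<bar>real (N_nu x) - main_term x\<bar> \<le> \<bar>C\<bar> * ln T" .
    have "\<bar>real (N_nu y) - main_term y\<bar> \<le> C * ln y" using y elim C(1) by (intro C(2)) auto
    also have "\<dots> \<le> \<bar>C\<bar> * (2 * ln T)" using lny ln0 by (intro mult_mono) auto
    finally have 2: "\<bar>real (N_nu y) - main_term y\<bar> \<le> 2 * (\<bar>C\<bar> * ln T)" by simp
    have 3: "real (N_nu x) \<le> real (N_nu T)" "real (N_nu T) \<le> real (N_nu y)" using x y by (auto intro: N_nu_mono)
    have 4: "main_term T \<le> main_term x + ln T" "main_term y \<le> main_term T + ln y"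
      using main_term_increment[of x T] main_term_increment[of T y] x y elim C(1) by auto
    have "\<bar>C\<bar> * ln T \<ge> 0" using ln0 by simp
    then have "\<bar>real (N_nu T) - main_term T\<bar> \<le> 2 * (\<bar>C\<bar> * ln T) + 2 * ln T"
      using 1 2 3 4 lny ln0 by linarith
    also have "\<dots> = (2 * \<bar>C\<bar> + 2) * ln T" by (simp add: algebra_simps)
    finally show ?case using ln0 by simp
  qed
  then show ?thesis unfolding main_term_def by (rule bigoI)
qed

end
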